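(* Let $b_0>0$ and $\frac12<\alpha<1$, let $A$ be the self-adjoint Jacobi operator in $\ell^2(\mathbb{N}_0)$ with zero diagonal and off-diagonal weights $b_0$, $b_{2k-1}=b_{2k}=k^\alpha$ ($k=1,2,3,\dots$), and let $f$ be its spectral density. Then there is a constant $f_0\neq 0$ such that $$f(x)\sim f_0\,|x|^{\frac{3\alpha-2}{1-\alpha}}\,,\qquad x\to 0,$$ i.e. $f(x)\,|x|^{-\frac{3\alpha-2}{1-\alpha}}\to f_0$ as $x\to0$, $x\ne0$.
   Context: The Jacobi matrix is the infinite symmetric tridiagonal matrix with rows and columns indexed by $n=0,1,2,\dots$, zero diagonal entries, and entries $b_n$ in positions $(n,n+1)$ and $(n+1,n)$, where $b_0>0$ and $b_{2k-1}=b_{2k}=k^\alpha$ for $k\ge1$. For $\alpha\in(1/2,1)$ it defines an unbounded self-adjoint operator $A$ in $\ell^2(\mathbb{N}_0)$. Let $e_0=(1,0,0,\dots)$, let $E_A$ be the spectral measure (projection-valued) of $A$, and let $\sigma(B)=\langle E_A(B)e_0,e_0\rangle$ be the scalar spectral measure of $A$ (a probability measure on $\mathbb{R}$). The spectral density $f$ is the density with respect to Lebesgue measure of the absolutely continuous part of $\sigma$ (there may be an atom of $\sigma$ at $x=0$). On $\mathbb{R}\setminus\{0\}$ the density $f$ agrees almost everywhere with a positive continuous function, and $f(x)$ for $x\neq0$ denotes the value of this continuous representative. *)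

theory Defs
  imports "HOL-Analysis.Analysis"
begin

section \<open>The Hilbert space of square-summable complex sequences\<close>

definition ell2 :: "(nat \<Rightarrow> complex) set" where
  "ell2 = {u. summable (\<lambda>n. (cmod (u n))\<^sup>2)}"

text \<open>Linear in the first argument.\<close>

definition ell2_inner :: "(nat \<Rightarrow> complex) \<Rightarrow> (nat \<Rightarrow> complex) \<Rightarrow> complex" where
  "ell2_inner u v = (\<Sum>n. u n * cnj (v n))"

definition ell2_norm :: "(nat \<Rightarrow> complex) \<Rightarrow> real" where
  "ell2_norm u = sqrt (\<Sum>n. (cmod (u n))\<^sup>2)"

definition e0 :: "nat \<Rightarrow> complex" where
  "e0 n = (if n = 0 then 1 else 0)"


section \<open>Projection-valued measures on the Borel sets of the real line\<close>

text \<open>Operators are functions on all sequences; only their values on \<^const>\<open>ell2\<close>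
  (or on the stated domain) are meaningful.\<close>

definition orth_projection :: "((nat \<Rightarrow> complex) \<Rightarrow> (nat \<Rightarrow> complex)) \<Rightarrow> bool" where
  "orth_projection P \<longleftrightarrow>
     (\<forall>u\<in>ell2. P u \<in> ell2) \<and>
     (\<forall>u\<in>ell2. \<forall>v\<in>ell2. P (\<lambda>n. u n + v n) = (\<lambda>n. P u n + P v n)) \<and>
     (\<forall>c. \<forall>u\<in>ell2. P (\<lambda>n. c * u n) = (\<lambda>n. c * P u n)) \<and>
     (\<forall>u\<in>ell2. P (P u) = P u) \<and>
     (\<forall>u\<in>ell2. \<forall>v\<in>ell2. ell2_inner (P u) v = ell2_inner u (P v))"

definition projection_valued_measure ::
    "(real set \<Rightarrow> (nat \<Rightarrow> complex) \<Rightarrow> (nat \<Rightarrow> complex)) \<Rightarrow> bool" where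
  "projection_valued_measure E \<longleftrightarrow>
     (\<forall>B\<in>sets borel. orth_projection (E B)) \<and>
     (\<forall>u\<in>ell2. E {} u = (\<lambda>n. 0)) \<and>
     (\<forall>u\<in>ell2. E UNIV u = u) \<and>
     (\<forall>B\<in>sets borel. \<forall>C\<in>sets borel. \<forall>u\<in>ell2. E (B \<inter> C) u = E B (E C u)) \<and>
     (\<forall>F :: nat \<Rightarrow> real set. range F \<subseteq> sets borel \<longrightarrow> disjoint_family F \<longrightarrow>
        (\<forall>u\<in>ell2. (\<lambda>m. ell2_norm (\<lambda>n. E (\<Union>i. F i) u n - (\<Sum>i<m. E (F i) u n)))
                     \<longlonglongrightarrow> 0))"

text \<open>The finite measure \<open>B \<mapsto> \<langle>E(B)u, u\<rangle>\<close>.\<close>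

definition scalar_spectral_measure ::
    "(real set \<Rightarrow> (nat \<Rightarrow> complex) \<Rightarrow> (nat \<Rightarrow> complex)) \<Rightarrow> (nat \<Rightarrow> complex) \<Rightarrow> real measure" where
  "scalar_spectral_measure E u =
     measure_of UNIV (sets borel) (\<lambda>B. ennreal (Re (ell2_inner (E B u) u)))"

text \<open>\<open>\<integral> x d\<langle>E(x)u, v\<rangle>\<close>, where the complex measure \<open>B \<mapsto> \<langle>E(B)u, v\<rangle>\<close> is written through
  positive measures by polarization. Used only for \<open>u\<close>, \<open>v\<close> in the domain of \<open>\<integral> x dE(x)\<close>,
  where each of the four integrals converges absolutely.\<close>

definition spectral_form ::
    "(real set \<Rightarrow> (nat \<Rightarrow> complex) \<Rightarrow> (nat \<Rightarrow> complex)) \<Rightarrow>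
     (nat \<Rightarrow> complex) \<Rightarrow> (nat \<Rightarrow> complex) \<Rightarrow> complex" where
  "spectral_form E u v =
     (\<Sum>k<4. \<i> ^ k * complex_of_real
        (\<integral>x. x \<partial>scalar_spectral_measure E (\<lambda>n. u n + \<i> ^ k * v n))) / 4"

text \<open>\<open>E\<close> is the spectral measure of the operator \<open>A\<close> with domain \<open>D\<close>, that is
  \<open>A = \<integral> x dE(x)\<close> with equality of domains. Such an \<open>E\<close> exists exactly when \<open>A\<close> is
  self-adjoint, and it is then unique (on Borel sets and on \<^const>\<open>ell2\<close>).\<close>

definition is_spectral_measure_of ::
    "(nat \<Rightarrow> complex) set \<Rightarrow> ((nat \<Rightarrow> complex) \<Rightarrow> (nat \<Rightarrow> complex)) \<Rightarrow>
     (real set \<Rightarrow> (nat \<Rightarrow> complex) \<Rightarrow> (nat \<Rightarrow> complex)) \<Rightarrow> bool" where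
  "is_spectral_measure_of D A E \<longleftrightarrow>
     projection_valued_measure E \<and>
     D = {u \<in> ell2. integrable (scalar_spectral_measure E u) (\<lambda>x. x\<^sup>2)} \<and>
     (\<forall>u\<in>D. A u \<in> ell2) \<and>
     (\<forall>u\<in>D. \<forall>v\<in>D. ell2_inner (A u) v = spectral_form E u v)"


section \<open>Density of the absolutely continuous part\<close>

text \<open>The Lebesgue decomposition of \<open>\<sigma>\<close> into \<open>f(x) dx\<close> and a part \<open>\<sigma>\<^sub>s\<close> carried by a
  Lebesgue null set.\<close>

definition is_ac_density :: "real measure \<Rightarrow> (real \<Rightarrow> real) \<Rightarrow> bool" where
  "is_ac_density \<sigma> f \<longleftrightarrow>
     f \<in> borel_measurable borel \<and> (AE x in lborel. 0 \<le> f x) \<and>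
     (\<exists>\<sigma>\<^sub>s. sets \<sigma>\<^sub>s = sets borel \<and>
        (\<exists>N\<in>sets borel. emeasure lborel N = 0 \<and> emeasure \<sigma>\<^sub>s (- N) = 0) \<and>
        (\<forall>B\<in>sets borel.
           emeasure \<sigma> B = emeasure (density lborel (\<lambda>x. ennreal (f x))) B + emeasure \<sigma>\<^sub>s B))"


section \<open>Jacobi operators with zero diagonal\<close>

definition jacobi_apply :: "(nat \<Rightarrow> real) \<Rightarrow> (nat \<Rightarrow> complex) \<Rightarrow> (nat \<Rightarrow> complex)" where
  "jacobi_apply b u n =
     complex_of_real (b n) * u (Suc n) +
     (if n = 0 then 0 else complex_of_real (b (n - 1)) * u (n - 1))"

text \<open>The maximal domain. Here \<open>\<Sum> 1 / b\<^sub>n\<close> diverges for weights growing no faster than \<open>n\<close>,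
  so by Carleman's criterion the operator on this domain is self-adjoint and is the closure of its
  restriction to the finitely supported sequences.\<close>

definition jacobi_domain :: "(nat \<Rightarrow> real) \<Rightarrow> (nat \<Rightarrow> complex) set" where
  "jacobi_domain b = {u \<in> ell2. jacobi_apply b u \<in> ell2}"

definition weights :: "real \<Rightarrow> real \<Rightarrow> nat \<Rightarrow> real" where
  "weights b0 \<alpha> n = (if n = 0 then b0 else real ((n + 1) div 2) powr \<alpha>)"

lemma weights_simps:
  "weights b0 \<alpha> 0 = b0"
  "k \<ge> 1 \<Longrightarrow> weights b0 \<alpha> (2 * k - 1) = real k powr \<alpha>"
  "k \<ge> 1 \<Longrightarrow> weights b0 \<alpha> (2 * k) = real k powr \<alpha>"
  by (auto simp: weights_def)

definition is_spectral_density_of_jacobi :: "(nat \<Rightarrow> real) \<Rightarrow> (real \<Rightarrow> real) \<Rightarrow> bool" where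
  "is_spectral_density_of_jacobi b f \<longleftrightarrow>
     (\<exists>E. is_spectral_measure_of (jacobi_domain b) (jacobi_apply b) E \<and>
          is_ac_density (scalar_spectral_measure E e0) f)"

end

theory Submission imports Defs
  "HOL-Complex_Analysis.Complex_Analysis" "HOL-Probability.Sinc_Integral" "HOL-Real_Asymp.Real_Asymp"
begin

text \<open>
The orthogonal polynomials \<open>p\<^sub>n\<close> of the Jacobi matrix control its spectral measure \<open>\<sigma>\<close>: whenever
\<open>b\<^sub>n (p\<^sub>n(x)\<^sup>2 + p\<^sub>n\<^sub>+\<^sub>1(x)\<^sup>2)\<close> converges to a positive limit \<open>G(x)\<close> along a subsequence, uniformly near \<open>x\<close>,
the measure has density \<open>1 / (\<pi> G)\<close> there. So the theorem is a statement about how \<open>G(x)\<close> behaves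
as \<open>x\<close> tends to 0.

\<^bold>\<open>From the operator to the polynomials.\<close> Cut the matrix after row \<open>n\<close> and impose the dissipative
boundary condition \<open>u\<^sub>n\<^sub>+\<^sub>1 = - \<i> u\<^sub>n\<close>. The resulting Weyl function \<open>m\<^sub>n\<close> is rational and holomorphic on the closed
upper half plane, has imaginary part \<open>1 / (b\<^sub>n (p\<^sub>n\<^sup>2 + p\<^sub>n\<^sub>+\<^sub>1\<^sup>2))\<close> on the real line, and
\<open>Im m\<^sub>n\<close> is the Poisson integral of these boundary values (\<open>Im_weyl_poisson\<close>). Green's identity bounds \<open>m\<^sub>n(z)\<close> by \<open>1 / Im z\<close>, and every limit
point of \<open>m\<^sub>n(z)\<close> yields a square-summable \<open>u\<close> with \<open>J u = z u + e\<^sub>0\<close>. For such a \<open>u\<close> the spectral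
theorem gives \<open>\<sigma> = |x - z|\<^sup>2 \<sigma>\<^sub>u\<close>, so the Poisson integral of \<open>\<sigma>\<close> at \<open>z\<close> equals \<open>Im u\<^sub>0\<close>
(\<open>poisson_integral_of_resolvent_solution\<close>). Hence \<open>Im m\<^sub>n(z)\<close> converges to the Poisson integral of \<open>\<sigma>\<close>
(\<open>Im_weyl_tendsto\<close>), and Stieltjes inversion transfers locally uniform convergence of the
densities to \<open>\<sigma>\<close> (\<open>ac_density_eq\<close>).

\<^bold>\<open>The polynomials at a fixed point.\<close> Because the weights come in equal pairs, the even and odd
polynomials, suitably signed and scaled, solve \<open>s\<^sub>k\<^sub>+\<^sub>1 = s\<^sub>k - x t\<^sub>k\<close> and
\<open>t\<^sub>k\<^sub>+\<^sub>1 = t\<^sub>k + x s\<^sub>k\<^sub>+\<^sub>1 / g\<^sub>k\<^sub>+\<^sub>1\<^sup>2\<close> with \<open>g\<^sub>k = k\<^sup>\<alpha>\<close>, a symplectic discretization of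
\<open>s'' = - x\<^sup>2 s / g\<^sup>2\<close>. The energy \<open>s\<^sup>2 / g + g t\<^sup>2\<close> is exactly \<open>b (p\<^sup>2 + p\<^sup>2)\<close> at index \<open>2 k\<close>. After adding a small
multiple of \<open>s t\<close> it changes in one step by a relative amount that is bounded by a multiple of the decrement of an explicit sequence
\<open>\<eta>\<^sub>k\<close> tending to 0, so it converges, and at index \<open>k\<close> it is within the factor \<open>exp (10 \<eta>\<^sub>k)\<close> of its
limit \<open>G\<close> (\<open>energy_limit\<close>).

\<^bold>\<open>Small \<open>x\<close>.\<close> With \<open>\<theta> = 2 - 2 \<alpha>\<close>, the natural scale is \<open>x\<^sup>2 k\<^sup>\<theta> = V\<close> with \<open>V\<close> fixed. There \<open>\<eta>\<^sub>k\<close> is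
at most of order \<open>V\<^sup>-\<^sup>1\<^sup>/\<^sup>2\<close>, uniformly in \<open>x\<close>. Expanding \<open>s\<^sub>k\<close> and \<open>t\<^sub>k\<close> in powers of \<open>x\<close>, the coefficients have
power asymptotics in \<open>k\<close> (Stolz--Cesaro) and factorial bounds, so by Tannery's theorem the
rescaled energy at scale \<open>V\<close> converges to an explicit \<open>h(V)\<close> as \<open>x\<close> tends to 0
(\<open>energy_rescaled_tendsto\<close>). The hypothesis \<open>\<alpha> > 1 / 2\<close> enters here: then \<open>\<Sum> k\<^sup>-\<^sup>2\<^sup>\<alpha>\<close> converges
and the leading coefficient of \<open>t\<^sub>k\<close> stays bounded. Since the rescaled \<open>G\<close> lies within a factor
\<open>exp (O(V\<^sup>-\<^sup>1\<^sup>/\<^sup>2))\<close> of \<open>h(V)\<close> for every large \<open>V\<close>, it has a limit, which is positive because otherwise the power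
series in \<open>h\<close> would vanish on a half line (\<open>limit_energy_asymptotics\<close>).
\<close>


section \<open>The Poisson formula for the half plane\<close>

text \<open>The imaginary part of \<open>1 / (t - z)\<close>; its integral over the real line is \<open>\<pi>\<close>, not 1.\<close>

definition poisson :: "complex \<Rightarrow> real \<Rightarrow> real" where
  "poisson z t = Im z / ((t - Re z)\<^sup>2 + (Im z)\<^sup>2)"

lemma poisson_nonneg: "0 < Im z \<Longrightarrow> 0 \<le> poisson z t"
  by (simp add: poisson_def)

lemma poisson_measurable [measurable]: "poisson z \<in> borel_measurable borel"
  unfolding poisson_def[abs_def] by measurable

lemma poisson_integral:
  assumes "0 < Im z"
  shows "integrable lborel (poisson z)" "(\<integral>t. poisson z t \<partial>lborel) = pi"
proof -
  have i: "integrable lborel (\<lambda>x::real. inverse (1 + x\<^sup>2))"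
    using integrable_inverse_1_plus_square by (simp add: set_integrable_def)
  have v: "(\<integral>x. inverse (1 + (x::real)\<^sup>2) \<partial>lborel) = pi"
    using LBINT_inverse_1_plus_square
    by (simp add: interval_lebesgue_integral_def set_lebesgue_integral_def)
  have eq: "poisson z (Re z + Im z * x) = inverse (Im z) * inverse (1 + x\<^sup>2)" for x
  proof -
    have "(Im z * x)\<^sup>2 + (Im z)\<^sup>2 = (Im z)\<^sup>2 * (1 + x\<^sup>2)"
      by (simp add: power_mult_distrib algebra_simps)
    hence "poisson z (Re z + Im z * x) = Im z / ((Im z)\<^sup>2 * (1 + x\<^sup>2))" by (simp add: poisson_def)
    also have "\<dots> = inverse (Im z) * inverse (1 + x\<^sup>2)"
      using assms by (simp add: power2_eq_square[of "Im z"] inverse_eq_divide)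
    finally show ?thesis .
  qed
  have "integrable lborel (\<lambda>x. poisson z (Re z + Im z * x))"
    unfolding eq using i by simp
  thus "integrable lborel (poisson z)"
    using lborel_integrable_real_affine_iff[of "Im z" "poisson z" "Re z"] assms by simp
  have "(\<integral>t. poisson z t \<partial>lborel) = \<bar>Im z\<bar> * (\<integral>x. poisson z (Re z + Im z * x) \<partial>lborel)"
    using lborel_integral_real_affine[of "Im z" "poisson z" "Re z"] assms by simp
  also have "\<dots> = pi" unfolding eq using v assms by simp
  finally show "(\<integral>t. poisson z t \<partial>lborel) = pi" .
qed

text \<open>Cauchy's theorem on a half disc of radius \<open>R\<close>: the integral over the diameter is the negative
of the integral over the semicircle. One point \<open>z\<close> is allowed where \<open>h\<close> is merely continuous; this
accommodates a removable singularity.\<close>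

lemma half_plane_Cauchy_decay:
  assumes cont: "continuous_on {w. 0 \<le> Im w} h"
    and diff: "\<And>w. 0 < Im w \<Longrightarrow> w \<noteq> z \<Longrightarrow> h field_differentiable at w"
    and bound: "\<And>w. 0 \<le> Im w \<Longrightarrow> R \<le> cmod w \<Longrightarrow> cmod (h w) \<le> B"
    and R: "0 < R" and B: "0 \<le> B"
  shows "cmod (integral {-R..R} (\<lambda>t. h (of_real t))) \<le> B * R * pi"
proof -
  define g1 where "g1 = part_circlepath 0 R 0 pi"
  define g2 where "g2 = linepath (of_real (-R) :: complex) (of_real R)"
  let ?S = "{w. 0 \<le> Im w}"
  have conv: "convex ?S" by (rule convex_halfspace_Im_ge)
  have vp: "valid_path g1" "valid_path g2" by (simp_all add: g1_def g2_def)
  have ends: "pathfinish g1 = pathstart g2" "pathfinish g2 = pathstart g1"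
    by (simp_all add: g1_def g2_def)
  have g1S: "path_image g1 \<subseteq> ?S"
  proof
    fix w assume "w \<in> path_image g1"
    then obtain t where t: "0 \<le> t" "t \<le> pi" "w = of_real R * cis t"
      using pi_ge_zero by (auto simp: g1_def path_image_part_circlepath' closed_segment_eq_real_ivl split: if_splits)
    have "Im w = R * sin t" unfolding t(3) by simp
    thus "w \<in> ?S" using t R by (simp add: sin_ge_zero)
  qed
  have g2S: "path_image g2 \<subseteq> ?S"
    unfolding g2_def path_image_linepath by (intro closed_segment_subset conv) auto
  have "(h has_contour_integral 0) (g1 +++ g2)"
  proof (rule Cauchy_theorem_convex[OF cont conv, of "{z}"])
    show "path_image (g1 +++ g2) \<subseteq> ?S" using g1S g2S ends by (simp add: path_image_join)
    fix w assume w: "w \<in> interior ?S - {z}"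
    have "interior ?S = {w. 0 < Im w}" using interior_halfspace_ge[of \<i> 0] by (simp add: inner_complex_def)
    thus "h field_differentiable at w" using w diff by auto
  qed (use vp ends in \<open>simp_all add: valid_path_join\<close>)
  have ci1: "h contour_integrable_on g1"
    unfolding g1_def using continuous_on_subset[OF cont g1S] 
    by (intro contour_integrable_continuous_part_circlepath) (simp add: g1_def)
  have ci2: "h contour_integrable_on g2"
    unfolding g2_def using continuous_on_subset[OF cont g2S] 
    by (intro contour_integrable_continuous_linepath) (simp add: g2_def)
  have "contour_integral g1 h + contour_integral g2 h = contour_integral (g1 +++ g2) h"
    using ci1 ci2 vp ends by simp
  also have "\<dots> = 0" using \<open>(h has_contour_integral 0) (g1 +++ g2)\<close> by (rule contour_integral_unique)
  finally have sum: "contour_integral g2 h = - contour_integral g1 h" by (simp add: eq_neg_iff_add_eq_0 add.commute)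
  have "(h has_contour_integral contour_integral g2 h) g2"
    by (rule has_contour_integral_integral[OF ci2])
  hence "((\<lambda>t. h (of_real t)) has_integral contour_integral g2 h) {-R..R}"
    unfolding g2_def by (subst (asm) has_contour_integral_linepath_Reals_iff) (use R in auto)
  hence "integral {-R..R} (\<lambda>t. h (of_real t)) = - contour_integral g1 h"
    using sum by (simp add: integral_unique)
  moreover have "cmod (contour_integral g1 h) \<le> B * R * (pi - 0)"
  proof (rule has_contour_integral_bound_part_circlepath[OF _ B R pi_ge_zero])
    show "(h has_contour_integral contour_integral g1 h) (part_circlepath 0 R 0 pi)"
      using has_contour_integral_integral[OF ci1] by (simp add: g1_def)
    fix w assume w: "w \<in> path_image (part_circlepath 0 R 0 pi)"
    hence "cmod w = R" using R by (auto simp: path_image_part_circlepath' norm_mult)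
    thus "cmod (h w) \<le> B" using w g1S by (intro bound) (auto simp: g1_def)
  qed
  ultimately show ?thesis by simp
qed

text \<open>Subtracting \<open>f z\<close> removes the pole: \<open>(f w - f z) / ((w - z) (w - cnj z))\<close> is continuous on the
closed half plane and decays like \<open>1 / |w|\<^sup>2\<close>, so its integral over the real line vanishes by Cauchy's
theorem. On the real line the denominator is \<open>|t - z|\<^sup>2\<close>, and the two terms are the Poisson integrals of \<open>f\<close>
and of the constant \<open>f z\<close>.\<close>

theorem poisson_formula_half_plane:
  assumes cont: "continuous_on {w. 0 \<le> Im w} f"
    and hol: "f holomorphic_on {w. 0 < Im w}"
    and bound: "\<And>w. 0 \<le> Im w \<Longrightarrow> cmod (f w) \<le> C"
    and z: "0 < Im z"
  shows "integrable lborel (\<lambda>t. f (of_real t) * of_real (poisson z t))"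
    "(\<integral>t. f (of_real t) * of_real (poisson z t) \<partial>lborel) = of_real pi * f z"
proof -
  have C: "0 \<le> C" using bound[of 0] by (metis Im_complex_of_real norm_ge_zero of_real_0 order_refl order_trans)
  have fm[measurable]: "(\<lambda>t. f (of_real t)) \<in> borel_measurable borel"
    by (intro borel_measurable_continuous_onI continuous_on_compose2[OF cont]) (auto intro: continuous_intros)
  show int: "integrable lborel (\<lambda>t. f (of_real t) * of_real (poisson z t))"
  proof (rule Bochner_Integration.integrable_bound)
    show "integrable lborel (\<lambda>t. C * poisson z t)" using poisson_integral(1)[OF z] by simp
    show "AE t in lborel. cmod (f (of_real t) * of_real (poisson z t)) \<le> norm (C * poisson z t)"
      using bound poisson_nonneg[OF z] C by (auto simp: norm_mult intro!: mult_right_mono)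
  qed simp
  define \<phi> where "\<phi> w = (if w = z then deriv f z else (f w - f z) / (w - z))" for w
  define h where "h w = \<phi> w / (w - cnj z)" for w
  have nz: "w - cnj z \<noteq> 0" if "0 \<le> Im w" for w
    using that z by (auto simp: complex_eq_iff)
  have opn: "open {w. 0 < Im w}" by (rule open_halfspace_Im_gt)
  have \<phi>_z: "isCont \<phi> z"
  proof -
    have "(f has_field_derivative deriv f z) (at z)"
      using hol opn z by (intro holomorphic_derivI[OF hol opn]) auto
    hence "((\<lambda>w. (f w - f z) / (w - z)) \<longlongrightarrow> deriv f z) (at z)"
      by (simp add: has_field_derivative_iff)
    moreover have "\<forall>\<^sub>F w in at z. (f w - f z) / (w - z) = \<phi> w"
      by (auto simp: \<phi>_def eventually_at_filter)
    ultimately have "(\<phi> \<longlongrightarrow> deriv f z) (at z)" by (rule Lim_transform_eventually)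
    thus ?thesis by (simp add: isCont_def \<phi>_def)
  qed
  have \<phi>_cont: "continuous_on {w. 0 \<le> Im w} \<phi>"
    unfolding continuous_on_eq_continuous_within
  proof
    fix w assume w: "w \<in> {w. 0 \<le> Im w}"
    show "continuous (at w within {w. 0 \<le> Im w}) \<phi>"
    proof (cases "w = z")
      case True
      thus ?thesis using \<phi>_z by (simp add: continuous_at_imp_continuous_at_within)
    next
      case False
      have c: "(f \<longlongrightarrow> f w) (at w within {w. 0 \<le> Im w})"
        using cont w by (simp add: continuous_on)
      have "((\<lambda>w. (f w - f z) / (w - z)) \<longlongrightarrow> (f w - f z) / (w - z)) (at w within {w. 0 \<le> Im w})"
        using False by (intro tendsto_intros c) auto
      moreover have "\<forall>\<^sub>F v in at w within {w. 0 \<le> Im w}. (f v - f z) / (v - z) = \<phi> v"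
        using tendsto_imp_eventually_ne[OF tendsto_ident_at False]
        by eventually_elim (auto simp: \<phi>_def)
      ultimately have "(\<phi> \<longlongrightarrow> (f w - f z) / (w - z)) (at w within {w. 0 \<le> Im w})"
        by (rule Lim_transform_eventually)
      thus ?thesis using False by (simp add: continuous_within \<phi>_def)
    qed
  qed
  have h_cont: "continuous_on {w. 0 \<le> Im w} h"
    unfolding h_def using nz by (intro continuous_intros \<phi>_cont) auto
  have h_diff: "h field_differentiable at w" if "0 < Im w" "w \<noteq> z" for w
  proof -
    have "(\<lambda>v. (f v - f z) / (v - z) / (v - cnj z)) field_differentiable at w"
      using that nz[of w] hol opn
      by (intro field_differentiable_divide field_differentiable_diff field_differentiable_const
            field_differentiable_ident holomorphic_on_imp_differentiable_at[OF hol opn]) auto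
    moreover have "\<forall>\<^sub>F v in nhds w. (f v - f z) / (v - z) / (v - cnj z) = h v"
      using t1_space_nhds[OF that(2)] by eventually_elim (simp add: h_def \<phi>_def)
    ultimately show ?thesis
      unfolding field_differentiable_def
      by (subst DERIV_cong_ev[OF refl _ refl, of h "\<lambda>v. (f v - f z) / (v - z) / (v - cnj z)"])
        (auto simp: eq_commute)
  qed
  have h_real: "h (of_real t) = (f (of_real t) - f z) * of_real (poisson z t / Im z)" for t
  proof -
    have "of_real t \<noteq> z" using z by auto
    moreover have "(of_real t - z) * (of_real t - cnj z) = of_real ((t - Re z)\<^sup>2 + (Im z)\<^sup>2)"
      by (auto simp: complex_eq_iff power2_eq_square algebra_simps)
    ultimately show ?thesis using z
      by (simp add: h_def \<phi>_def poisson_def divide_divide_eq_left)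
  qed
  have h_int: "integrable lborel (\<lambda>t. h (of_real t))"
  proof -
    have "integrable lborel (\<lambda>t. (f (of_real t) * of_real (poisson z t) - f z * of_real (poisson z t)) / of_real (Im z))"
      using int poisson_integral(1)[OF z] by simp
    thus ?thesis by (simp add: h_real left_diff_distrib)
  qed
  have tail: "cmod (integral {-R..R} (\<lambda>t. h (of_real t))) \<le> 2 * C / (R - cmod z)\<^sup>2 * R * pi"
    if R: "cmod z < R" for R
  proof (rule half_plane_Cauchy_decay[OF h_cont h_diff])
    show "0 < R" using R by (rule le_less_trans[OF norm_ge_zero])
    show "0 \<le> 2 * C / (R - cmod z)\<^sup>2" using C by simp
    fix w assume w: "0 \<le> Im w" "R \<le> cmod w"
    have d: "R - cmod z \<le> cmod (w - z)" "R - cmod z \<le> cmod (w - cnj z)"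
      using norm_triangle_ineq2[of w z] norm_triangle_ineq2[of w "cnj z"] w by auto
    have ne: "w \<noteq> z" using w R by auto
    have "cmod (h w) = cmod (f w - f z) / (cmod (w - z) * cmod (w - cnj z))"
      using ne by (simp add: h_def \<phi>_def norm_divide norm_mult)
    also have "\<dots> \<le> 2 * C / (R - cmod z)\<^sup>2"
    proof (rule frac_le)
      show "cmod (f w - f z) \<le> 2 * C"
        using norm_triangle_ineq4[of "f w" "f z"] bound[of w] bound[of z] w z by simp
      show "(R - cmod z)\<^sup>2 \<le> cmod (w - z) * cmod (w - cnj z)"
        unfolding power2_eq_square using d R by (intro mult_mono) auto
    qed (use R C in auto)
    finally show "cmod (h w) \<le> 2 * C / (R - cmod z)\<^sup>2" .
  qed
  have lim0: "(\<lambda>n. integral {-real n..real n} (\<lambda>t. h (of_real t))) \<longlonglongrightarrow> 0"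
  proof (rule Lim_null_comparison)
    show "\<forall>\<^sub>F n in sequentially. cmod (integral {-real n..real n} (\<lambda>t. h (of_real t)))
        \<le> 2 * C / (real n - cmod z)\<^sup>2 * real n * pi"
      using eventually_gt_at_top[of "nat \<lceil>cmod z\<rceil>"]
      by eventually_elim (intro tail, linarith)
    show "(\<lambda>n. 2 * C / (real n - cmod z)\<^sup>2 * real n * pi) \<longlonglongrightarrow> 0"
      by real_asymp
  qed
  have "(\<lambda>n. integral {-real n..real n} (\<lambda>t. h (of_real t))) \<longlonglongrightarrow> (\<integral>t. h (of_real t) \<partial>lborel)"
  proof -
    have [measurable]: "(\<lambda>t. h (of_real t)) \<in> borel_measurable borel"
      using h_int by (auto dest: borel_measurable_integrable)
    have "(\<lambda>n. \<integral>t. indicator {-real n..real n} t *\<^sub>R h (of_real t) \<partial>lborel) \<longlonglongrightarrow> (\<integral>t. h (of_real t) \<partial>lborel)"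
    proof (rule integral_dominated_convergence)
      show "integrable lborel (\<lambda>t. norm (h (of_real t)))" using h_int by simp
      show "AE t in lborel. (\<lambda>n. indicator {-real n..real n} t *\<^sub>R h (of_real t)) \<longlonglongrightarrow> h (of_real t)"
      proof (rule AE_I2)
        fix t :: real
        have "\<forall>\<^sub>F n in sequentially. indicator {-real n..real n} t *\<^sub>R h (of_real t) = h (of_real t)"
          using eventually_gt_at_top[of "nat \<lceil>\<bar>t\<bar>\<rceil>"]
          by eventually_elim (auto simp: indicator_def; linarith)
        thus "(\<lambda>n. indicator {-real n..real n} t *\<^sub>R h (of_real t)) \<longlonglongrightarrow> h (of_real t)"
          by (rule tendsto_eventually)
      qed
    qed (auto simp: indicator_def)
    moreover have "(\<integral>t. indicator {-real n..real n} t *\<^sub>R h (of_real t) \<partial>lborel)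
        = integral {-real n..real n} (\<lambda>t. h (of_real t))" for n
      using set_borel_integral_eq_integral(2)[of "{-real n..real n}" "\<lambda>t. h (of_real t)"]
        integrable_mult_indicator[OF _ h_int, of "{-real n..real n}"]
      by (simp add: set_lebesgue_integral_def set_integrable_def)
    ultimately show ?thesis by simp
  qed
  from LIMSEQ_unique[OF this lim0] have "(\<integral>t. h (of_real t) \<partial>lborel) = 0" .
  moreover have "(\<integral>t. h (of_real t) \<partial>lborel)
      = ((\<integral>t. f (of_real t) * of_real (poisson z t) \<partial>lborel) - f z * of_real pi) / of_real (Im z)"
  proof -
    have "(\<integral>t. h (of_real t) \<partial>lborel)
      = (\<integral>t. (f (of_real t) * of_real (poisson z t) - f z * of_real (poisson z t)) / of_real (Im z) \<partial>lborel)"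
      by (simp add: h_real left_diff_distrib)
    also have "\<dots> = ((\<integral>t. f (of_real t) * of_real (poisson z t) \<partial>lborel) - f z * of_real pi) / of_real (Im z)"
      using int poisson_integral[OF z] by simp
    finally show ?thesis .
  qed
  ultimately show "(\<integral>t. f (of_real t) * of_real (poisson z t) \<partial>lborel) = of_real pi * f z"
    using z by auto
qed

section \<open>Square-summable sequences and spectral measures\<close>

lemma ell2_mult_summable:
  assumes "u \<in> ell2" "v \<in> ell2"
  shows "summable (\<lambda>n. cmod (u n) * cmod (v n))"
proof (rule summable_comparison_test')
  show "summable (\<lambda>n. (cmod (u n))\<^sup>2 + (cmod (v n))\<^sup>2)"
    using assms by (intro summable_add) (simp_all add: ell2_def)
  fix n
  have "2 * cmod (u n) * cmod (v n) \<le> (cmod (u n))\<^sup>2 + (cmod (v n))\<^sup>2"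
    by (rule sum_squares_bound)
  moreover have "0 \<le> cmod (u n) * cmod (v n)" by simp
  ultimately show "norm (cmod (u n) * cmod (v n)) \<le> (cmod (u n))\<^sup>2 + (cmod (v n))\<^sup>2"
    by (simp only: real_norm_def abs_of_nonneg)
qed

lemma ell2_inner_summable:
  assumes "u \<in> ell2" "v \<in> ell2"
  shows "summable (\<lambda>n. u n * cnj (v n))"
  by (rule summable_norm_cancel) (use ell2_mult_summable[OF assms] in \<open>simp add: norm_mult\<close>)

lemma ell2_add:
  assumes "u \<in> ell2" "v \<in> ell2"
  shows "(\<lambda>n. u n + v n) \<in> ell2"
  unfolding ell2_def mem_Collect_eq
proof (rule summable_comparison_test')
  show "summable (\<lambda>n. 2 * (cmod (u n))\<^sup>2 + 2 * (cmod (v n))\<^sup>2)"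
    using assms by (auto simp: ell2_def intro!: summable_add summable_mult)
  fix n
  have "(cmod (u n + v n))\<^sup>2 \<le> (cmod (u n) + cmod (v n))\<^sup>2"
    by (intro power_mono norm_triangle_ineq) auto
  also have "\<dots> \<le> 2 * (cmod (u n))\<^sup>2 + 2 * (cmod (v n))\<^sup>2"
    using sum_squares_bound[of "cmod (u n)" "cmod (v n)"] by (simp add: power2_sum)
  finally show "norm ((cmod (u n + v n))\<^sup>2) \<le> 2 * (cmod (u n))\<^sup>2 + 2 * (cmod (v n))\<^sup>2"
    by simp
qed

lemma ell2_scale: "u \<in> ell2 \<Longrightarrow> (\<lambda>n. c * u n) \<in> ell2"
  by (auto simp: ell2_def norm_mult power_mult_distrib intro: summable_mult)

lemma ell2_diff: "u \<in> ell2 \<Longrightarrow> v \<in> ell2 \<Longrightarrow> (\<lambda>n. u n - v n) \<in> ell2"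
  using ell2_add[of u "\<lambda>n. -1 * v n"] ell2_scale[of v "-1"] by simp

lemma ell2_zero: "(\<lambda>n. 0) \<in> ell2"
  by (simp add: ell2_def)

lemma ell2_sum: "(\<And>i. i < (m::nat) \<Longrightarrow> f i \<in> ell2) \<Longrightarrow> (\<lambda>n. \<Sum>i<m. f i n) \<in> ell2"
  by (induction m) (auto simp: ell2_zero intro!: ell2_add)

lemma e0_ell2: "e0 \<in> ell2"
  unfolding ell2_def mem_Collect_eq
  by (rule summable_finite[of "{0}"]) (auto simp: e0_def)

lemma ell2_inner_add_left:
  assumes "u \<in> ell2" "v \<in> ell2" "w \<in> ell2"
  shows "ell2_inner (\<lambda>n. u n + v n) w = ell2_inner u w + ell2_inner v w"
  using ell2_inner_summable[OF assms(1,3)] ell2_inner_summable[OF assms(2,3)]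
  by (simp add: ell2_inner_def ring_distribs suminf_add)

lemma ell2_inner_scale_left:
  assumes "u \<in> ell2" "w \<in> ell2"
  shows "ell2_inner (\<lambda>n. c * u n) w = c * ell2_inner u w"
  using ell2_inner_summable[OF assms] by (simp add: ell2_inner_def suminf_mult mult.assoc)

lemma ell2_inner_cnj:
  assumes "u \<in> ell2" "v \<in> ell2"
  shows "ell2_inner v u = cnj (ell2_inner u v)"
proof -
  have "(\<lambda>n. u n * cnj (v n)) sums ell2_inner u v"
    using ell2_inner_summable[OF assms] by (simp add: ell2_inner_def summable_sums)
  hence "(\<lambda>n. cnj (u n * cnj (v n))) sums cnj (ell2_inner u v)"
    by (simp only: sums_cnj)
  thus ?thesis by (simp add: ell2_inner_def mult.commute sums_iff)
qed

lemma ell2_inner_add_right: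
  assumes "u \<in> ell2" "v \<in> ell2" "w \<in> ell2"
  shows "ell2_inner w (\<lambda>n. u n + v n) = ell2_inner w u + ell2_inner w v"
  using ell2_inner_add_left[OF assms] ell2_inner_cnj[OF ell2_add[OF assms(1,2)] assms(3)]
    ell2_inner_cnj[OF assms(1,3)] ell2_inner_cnj[OF assms(2,3)] by simp

lemma ell2_inner_scale_right:
  assumes "u \<in> ell2" "w \<in> ell2"
  shows "ell2_inner w (\<lambda>n. c * u n) = cnj c * ell2_inner w u"
  using ell2_inner_scale_left[OF assms, of c] ell2_inner_cnj[OF ell2_scale[OF assms(1)] assms(2), of c]
    ell2_inner_cnj[OF assms] by simp

lemma ell2_inner_self:
  assumes "u \<in> ell2"
  shows "ell2_inner u u = complex_of_real (\<Sum>n. (cmod (u n))\<^sup>2)"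
proof -
  have "(\<lambda>n. (cmod (u n))\<^sup>2) sums (\<Sum>n. (cmod (u n))\<^sup>2)"
    using assms by (simp add: ell2_def summable_sums)
  hence "(\<lambda>n. complex_of_real ((cmod (u n))\<^sup>2)) sums complex_of_real (\<Sum>n. (cmod (u n))\<^sup>2)"
    by (simp only: sums_of_real_iff)
  thus ?thesis unfolding ell2_inner_def by (simp only: complex_norm_square sums_iff)
qed

lemma ell2_inner_bound:
  assumes "u \<in> ell2" "v \<in> ell2"
  shows "cmod (ell2_inner u v) \<le> ell2_norm u * ell2_norm v"
proof -
  have le: "(\<Sum>i<m. cmod (u i) * cmod (v i)) \<le> ell2_norm u * ell2_norm v" for m
  proof -
    have "(\<Sum>i<m. cmod (u i) * cmod (v i)) \<le> L2_set (\<lambda>i. cmod (u i)) {..<m} * L2_set (\<lambda>i. cmod (v i)) {..<m}"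
      using L2_set_mult_ineq[of "\<lambda>i. cmod (u i)" "\<lambda>i. cmod (v i)" "{..<m}"] by simp
    also have "\<dots> \<le> ell2_norm u * ell2_norm v"
      using assms unfolding L2_set_def ell2_norm_def ell2_def
      by (intro mult_mono real_sqrt_le_mono sum_le_suminf) (auto simp: sum_nonneg suminf_nonneg)
    finally show ?thesis .
  qed
  have "cmod (ell2_inner u v) \<le> (\<Sum>n. cmod (u n) * cmod (v n))"
    unfolding ell2_inner_def using summable_norm[of "\<lambda>n. u n * cnj (v n)"] ell2_mult_summable[OF assms]
    by (simp add: norm_mult)
  also have "\<dots> \<le> ell2_norm u * ell2_norm v"
    by (rule suminf_le_const[OF ell2_mult_summable[OF assms] le])
  finally show ?thesis .
qed

text \<open>Integration is additive in the measure; the sum of two measures is expressed through its values on sets.\<close>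

lemma nn_integral_measure_add:
  assumes [measurable_cong]: "sets M = sets borel" "sets N = sets borel" "sets K = sets borel"
    and eq: "\<And>B. B \<in> sets borel \<Longrightarrow> emeasure M B = emeasure N B + emeasure K B"
    and f: "f \<in> borel_measurable borel"
  shows "nn_integral M f = nn_integral N f + nn_integral K f"
  using f
proof (induction rule: borel_measurable_induct)
  case (cong f g)
  then show ?case using nn_integral_cong[of _ f g]
    by (metis UNIV_I nn_integral_cong space_borel)
next
  case (set A)
  then show ?case by (simp add: eq)
next
  case (mult u c)
  then show ?case by (simp add: nn_integral_cmult distrib_left)
next
  case (add u v)
  then show ?case by (simp add: nn_integral_add algebra_simps)
next
  case (seq U)
  have *: "nn_integral L (\<lambda>x. SUP i. U i x) = (SUP i. nn_integral L (U i))" if "sets L = sets borel" for L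
    using seq that measurable_cong_sets[OF that refl, of borel]
    by (intro nn_integral_monotone_convergence_SUP) auto
  have "(SUP i. nn_integral M (U i)) = (SUP i. nn_integral N (U i) + nn_integral K (U i))"
    using seq by simp
  also have "\<dots> = (SUP i. nn_integral N (U i)) + (SUP i. nn_integral K (U i))"
    using seq(3) by (intro ennreal_SUP_add) (auto simp: incseq_def le_fun_def intro!: nn_integral_mono)
  finally have "(SUP i. nn_integral M (U i)) = (SUP i. nn_integral N (U i)) + (SUP i. nn_integral K (U i))" .
  then show ?case
    using *[OF assms(1)] *[OF assms(2)] *[OF assms(3)] by (simp add: SUP_apply[abs_def])
qed

lemma integral_measure_add:
  fixes f :: "real \<Rightarrow> real"
  assumes [measurable_cong]: "sets M = sets borel" "sets N = sets borel" "sets K = sets borel"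
    and eq: "\<And>B. B \<in> sets borel \<Longrightarrow> emeasure M B = emeasure N B + emeasure K B"
    and i: "integrable N f" "integrable K f"
  shows "integrable M f" "integral\<^sup>L M f = integral\<^sup>L N f + integral\<^sup>L K f"
proof -
  have f[measurable]: "f \<in> borel_measurable borel"
    using i(1) by (auto dest!: borel_measurable_integrable)
  have nn: "nn_integral M g = nn_integral N g + nn_integral K g" if "g \<in> borel_measurable borel" for g
    by (rule nn_integral_measure_add[OF assms(1-4) that]) auto
  note n1 = nn[of "\<lambda>x. ennreal (f x)"] and n2 = nn[of "\<lambda>x. ennreal (- f x)"]
    and n3 = nn[of "\<lambda>x. ennreal (norm (f x))"]
  have iN: "nn_integral N (\<lambda>x. ennreal (f x)) \<noteq> \<infinity>" "nn_integral N (\<lambda>x. ennreal (- f x)) \<noteq> \<infinity>"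
    "nn_integral N (\<lambda>x. ennreal (norm (f x))) < \<infinity>"
    subgoal using i(1) by (simp add: real_integrable_def)
    subgoal using i(1) by (simp add: real_integrable_def)
    subgoal using i(1) by (simp add: integrable_iff_bounded)
    done
  have iK: "nn_integral K (\<lambda>x. ennreal (f x)) \<noteq> \<infinity>" "nn_integral K (\<lambda>x. ennreal (- f x)) \<noteq> \<infinity>"
    "nn_integral K (\<lambda>x. ennreal (norm (f x))) < \<infinity>"
    subgoal using i(2) by (simp add: real_integrable_def)
    subgoal using i(2) by (simp add: real_integrable_def)
    subgoal using i(2) by (simp add: integrable_iff_bounded)
    done
  have "f \<in> borel_measurable M" by simp
  moreover have "nn_integral M (\<lambda>x. ennreal (norm (f x))) < \<infinity>"
    using n3 iN(3) iK(3) by (simp add: ennreal_add_less_top)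
  ultimately show M: "integrable M f"
    by (simp add: integrable_iff_bounded)
  show "integral\<^sup>L M f = integral\<^sup>L N f + integral\<^sup>L K f"
    unfolding real_lebesgue_integral_def[OF M] real_lebesgue_integral_def[OF i(1)]
      real_lebesgue_integral_def[OF i(2)]
    using n1 n2 iN iK by (simp add: enn2real_plus less_top)
qed

text \<open>A projection-valued measure turns every vector \<open>u\<close> into a finite measure \<open>\<sigma> u\<close>. The complex
measures \<open>B \<mapsto> \<langle>E B u, v\<rangle>\<close> are handled as plain set functions.\<close>

locale pvm =
  fixes E :: "real set \<Rightarrow> (nat \<Rightarrow> complex) \<Rightarrow> (nat \<Rightarrow> complex)"
  assumes pvm: "projection_valued_measure E"
begin

abbreviation M :: "(nat \<Rightarrow> complex) \<Rightarrow> (nat \<Rightarrow> complex) \<Rightarrow> real set \<Rightarrow> complex" where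
  "M u v B \<equiv> ell2_inner (E B u) v"

abbreviation \<sigma> :: "(nat \<Rightarrow> complex) \<Rightarrow> real measure" where
  "\<sigma> u \<equiv> scalar_spectral_measure E u"

lemma proj: "B \<in> sets borel \<Longrightarrow> orth_projection (E B)"
  using pvm by (auto simp: projection_valued_measure_def)

lemma E_ell2: "B \<in> sets borel \<Longrightarrow> u \<in> ell2 \<Longrightarrow> E B u \<in> ell2"
  using proj by (auto simp: orth_projection_def)

lemma E_add: "B \<in> sets borel \<Longrightarrow> u \<in> ell2 \<Longrightarrow> v \<in> ell2 \<Longrightarrow> E B (\<lambda>n. u n + v n) = (\<lambda>n. E B u n + E B v n)"
  using proj by (auto simp: orth_projection_def)

lemma E_scale: "B \<in> sets borel \<Longrightarrow> u \<in> ell2 \<Longrightarrow> E B (\<lambda>n. c * u n) = (\<lambda>n. c * E B u n)"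
  using proj by (auto simp: orth_projection_def)

lemma E_Int: "B \<in> sets borel \<Longrightarrow> C \<in> sets borel \<Longrightarrow> u \<in> ell2 \<Longrightarrow> E B (E C u) = E (B \<inter> C) u"
  using pvm by (auto simp: projection_valued_measure_def)

lemma E_UNIV: "u \<in> ell2 \<Longrightarrow> E UNIV u = u"
  using pvm by (auto simp: projection_valued_measure_def)

text \<open>Multiplicativity of \<open>E\<close> in the form that is used throughout: a projection in the second
argument only shrinks the set.\<close>

lemma M_E_right:
  assumes "B \<in> sets borel" "C \<in> sets borel" "u \<in> ell2" "v \<in> ell2"
  shows "M u (E C v) B = M u v (B \<inter> C)"
proof -
  have "M u (E C v) B = ell2_inner (E C (E B u)) v"
    using assms proj[OF assms(2)] E_ell2 unfolding orth_projection_def by metis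
  thus ?thesis using assms by (simp add: E_Int Int_commute)
qed

lemma M_cnj:
  assumes "B \<in> sets borel" "u \<in> ell2" "v \<in> ell2"
  shows "M v u B = cnj (M u v B)"
proof -
  have "M v u B = ell2_inner v (E B u)"
    using assms proj[OF assms(1)] unfolding orth_projection_def by metis
  also have "\<dots> = cnj (M u v B)" using assms by (intro ell2_inner_cnj E_ell2)
  finally show ?thesis .
qed

lemma M_add_scale:
  assumes "B \<in> sets borel" "u \<in> ell2" "v \<in> ell2"
  shows "M (\<lambda>n. u n + c * v n) (\<lambda>n. u n + c * v n) B
       = M u u B + c * M v u B + cnj c * M u v B + c * cnj c * M v v B"
proof -
  note [simp] = E_ell2[OF assms(1)] ell2_scale ell2_add assms
  show ?thesis
    by (simp add: E_add E_scale ell2_inner_add_left ell2_inner_add_right ell2_inner_scale_left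
        ell2_inner_scale_right algebra_simps)
qed

lemma Re_M_add_scale:
  assumes "B \<in> sets borel" "u \<in> ell2" "v \<in> ell2"
  shows "Re (M (\<lambda>n. u n + c * v n) (\<lambda>n. u n + c * v n) B)
       = Re (M u u B) + 2 * Re (cnj c * M u v B) + (cmod c)\<^sup>2 * Re (M v v B)"
proof -
  have *: "c * cnj c = complex_of_real ((cmod c)\<^sup>2)" by (simp only: complex_norm_square)
  show ?thesis unfolding M_add_scale[OF assms] * using M_cnj[OF assms] by simp
qed

lemma M_self:
  assumes "B \<in> sets borel" "u \<in> ell2"
  shows "M u u B = ell2_inner (E B u) (E B u)"
  using M_E_right[OF assms(1,1) assms(2,2)] by simp

lemma M_self_nonneg:
  assumes "B \<in> sets borel" "u \<in> ell2"
  shows "0 \<le> Re (M u u B)" "Im (M u u B) = 0"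
  using assms E_ell2 by (auto simp: M_self ell2_inner_self ell2_def suminf_nonneg)

text \<open>Strong countable additivity implies countable additivity of the scalar set functions, by the Cauchy--Schwarz
inequality.\<close>

lemma M_sums:
  assumes F: "range F \<subseteq> sets borel" "disjoint_family (F :: nat \<Rightarrow> real set)" and u: "u \<in> ell2"
  shows "(\<lambda>i. M u u (F i)) sums M u u (\<Union>i. F i)"
proof -
  have Fi: "F i \<in> sets borel" for i using F by auto
  have FU: "(\<Union>i. F i) \<in> sets borel" using Fi by auto
  define w where "w m = (\<lambda>n. E (\<Union>i. F i) u n - (\<Sum>i<m. E (F i) u n))" for m :: nat
  have lim: "(\<lambda>m. ell2_norm (w m)) \<longlonglongrightarrow> 0"
    using pvm F u by (auto simp: projection_valued_measure_def w_def)
  have sum_in: "(\<lambda>n. \<Sum>i<m. E (F i) u n) \<in> ell2" for m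
    by (intro ell2_sum E_ell2 Fi u)
  have w: "w m \<in> ell2" for m
    unfolding w_def by (intro ell2_diff E_ell2 FU u sum_in)
  have inner_sum: "ell2_inner (\<lambda>n. \<Sum>i<m. E (F i) u n) u = (\<Sum>i<m. M u u (F i))" for m
  proof (induction m)
    case 0
    show ?case by (simp add: ell2_inner_def)
  next
    case (Suc m)
    show ?case using ell2_inner_add_left[OF sum_in E_ell2[OF Fi u] u] Suc by simp
  qed
  have "M u u (\<Union>i. F i) = ell2_inner (w m) u + (\<Sum>i<m. M u u (F i))" for m
    using ell2_inner_add_left[OF w sum_in u, of m m] by (simp add: w_def inner_sum)
  hence eq: "(\<Sum>i<m. M u u (F i)) = M u u (\<Union>i. F i) - ell2_inner (w m) u" for m
    by (simp add: algebra_simps)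
  have "(\<lambda>m. ell2_norm (w m) * ell2_norm u) \<longlonglongrightarrow> 0 * ell2_norm u"
    by (intro tendsto_mult lim tendsto_const)
  hence lim2: "(\<lambda>m. ell2_norm (w m) * ell2_norm u) \<longlonglongrightarrow> 0" by simp
  have "(\<lambda>m. ell2_inner (w m) u) \<longlonglongrightarrow> 0"
    by (rule Lim_null_comparison[OF always_eventually lim2])
      (use ell2_inner_bound[OF w u] in blast)
  hence "(\<lambda>m. M u u (\<Union>i. F i) - ell2_inner (w m) u) \<longlonglongrightarrow> M u u (\<Union>i. F i) - 0"
    by (intro tendsto_diff tendsto_const)
  thus ?thesis by (simp add: sums_def eq)
qed

lemma sets_\<sigma> [simp, measurable_cong]: "sets (\<sigma> u) = sets borel"
  unfolding scalar_spectral_measure_def using sets.sigma_sets_eq[of "borel :: real measure"] by simp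

lemma space_\<sigma> [simp]: "space (\<sigma> u) = UNIV"
  using sets_eq_imp_space_eq[OF sets_\<sigma>] by simp

lemma emeasure_\<sigma>:
  assumes u: "u \<in> ell2" and B: "B \<in> sets borel"
  shows "emeasure (\<sigma> u) B = ennreal (Re (M u u B))"
proof (rule emeasure_measure_of[OF scalar_spectral_measure_def])
  show "sets borel \<subseteq> Pow (UNIV :: real set)" by simp
  show "B \<in> sets (\<sigma> u)" using B by simp
  have "M u u {} = 0"
    using pvm u by (simp add: projection_valued_measure_def ell2_inner_def)
  thus "positive (sets (\<sigma> u)) (\<lambda>B. ennreal (Re (M u u B)))"
    by (simp add: positive_def)
  show "countably_additive (sets (\<sigma> u)) (\<lambda>B. ennreal (Re (M u u B)))"
  proof (rule countably_additiveI)
    fix F :: "nat \<Rightarrow> real set"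
    assume F: "range F \<subseteq> sets (\<sigma> u)" "disjoint_family F"
    hence "(\<lambda>i. Re (M u u (F i))) sums Re (M u u (\<Union>i. F i))"
      using M_sums[of F u] u by (auto intro: sums_Re)
    moreover have "0 \<le> Re (M u u (F i))" for i using F u by (auto intro!: M_self_nonneg)
    ultimately show "(\<Sum>i. ennreal (Re (M u u (F i)))) = ennreal (Re (M u u (\<Union>i. F i)))"
        by (intro suminf_ennreal_eq) auto
  qed
qed

lemma finite_\<sigma>: "u \<in> ell2 \<Longrightarrow> finite_measure (\<sigma> u)"
  by (rule finite_measureI) (simp add: emeasure_\<sigma>)

lemma measure_\<sigma>: "u \<in> ell2 \<Longrightarrow> B \<in> sets borel \<Longrightarrow> measure (\<sigma> u) B = Re (M u u B)"
  by (simp add: measure_def emeasure_\<sigma> M_self_nonneg)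

lemma \<sigma>_scale:
  assumes "u \<in> ell2"
  shows "\<sigma> (\<lambda>n. c * u n) = density (\<sigma> u) (\<lambda>_. ennreal ((cmod c)\<^sup>2))"
proof (rule measure_eqI)
  fix B assume "B \<in> sets (\<sigma> (\<lambda>n. c * u n))"
  hence B: "B \<in> sets borel" by simp
  have *: "c * cnj c = complex_of_real ((cmod c)\<^sup>2)" by (simp only: complex_norm_square)
  have "M (\<lambda>n. c * u n) (\<lambda>n. c * u n) B = c * cnj c * M u u B"
    using assms B E_ell2 by (simp add: E_scale ell2_inner_scale_left ell2_inner_scale_right ell2_scale)
  hence "Re (M (\<lambda>n. c * u n) (\<lambda>n. c * u n) B) = (cmod c)\<^sup>2 * Re (M u u B)"
    unfolding * by simp
  thus "emeasure (\<sigma> (\<lambda>n. c * u n)) B = emeasure (density (\<sigma> u) (\<lambda>_. ennreal ((cmod c)\<^sup>2))) B"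
    using B assms by (simp add: emeasure_\<sigma> ell2_scale emeasure_density nn_integral_cmult_indicator
        ennreal_mult M_self_nonneg)
qed simp

lemma integral_\<sigma>_scale:
  assumes "u \<in> ell2"
  shows "(\<integral>x. x \<partial>\<sigma> (\<lambda>n. c * u n)) = (cmod c)\<^sup>2 * (\<integral>x. x \<partial>\<sigma> u)"
  unfolding \<sigma>_scale[OF assms] by (subst integral_density) auto

text \<open>On the diagonal the four polarization terms are multiples of \<open>\<sigma> u\<close> with factors 4, 2, 0, 2, and
the contributions of \<open>\<i>\<close> and \<open>- \<i>\<close> cancel.\<close>

lemma spectral_form_self:
  assumes "u \<in> ell2"
  shows "spectral_form E u u = complex_of_real (\<integral>x. x \<partial>\<sigma> u)"
proof -
  have eq: "(\<lambda>n. u n + \<i> ^ k * u n) = (\<lambda>n. (1 + \<i> ^ k) * u n)" for k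
    by (simp add: algebra_simps)
  have [simp]: "(cmod (1 + \<i>))\<^sup>2 = 2" "(cmod (1 - \<i>))\<^sup>2 = 2"
    by (simp_all add: cmod_power2)
  have [simp]: "(complex_of_real (cmod (1 + \<i>)))\<^sup>2 = 2" "(complex_of_real (cmod (1 - \<i>)))\<^sup>2 = 2"
    unfolding of_real_power[symmetric] by simp_all
  have 4: "{..<4::nat} = {0,1,2,3}" by auto
  show ?thesis
    unfolding spectral_form_def eq integral_\<sigma>_scale[OF assms] 4
    by (simp add: power3_eq_cube)
qed

lemma \<sigma>_restrict:
  assumes "u \<in> ell2" "B \<in> sets borel"
  shows "\<sigma> (E B u) = density (\<sigma> u) (\<lambda>x. ennreal (indicator B x))"
proof (rule measure_eqI)
  fix C assume "C \<in> sets (\<sigma> (E B u))"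
  hence C: "C \<in> sets borel" by simp
  have "M (E B u) (E B u) C = M u u (B \<inter> C)"
    using assms C by (simp add: M_E_right E_ell2 E_Int Int_commute)
  hence "emeasure (\<sigma> (E B u)) C = emeasure (\<sigma> u) (B \<inter> C)"
    using assms C by (simp add: emeasure_\<sigma> E_ell2)
  also have "\<dots> = emeasure (density (\<sigma> u) (\<lambda>x. ennreal (indicator B x))) C"
    using assms C by (simp add: emeasure_density indicator_inter_arith[symmetric] flip: ennreal_indicator)
      (simp add: ennreal_indicator indicator_inter_arith[symmetric])
  finally show "emeasure (\<sigma> (E B u)) C = emeasure (density (\<sigma> u) (\<lambda>x. ennreal (indicator B x))) C" .
qed simp

lemma integrable_id_of_square:
  assumes "u \<in> ell2" "integrable (\<sigma> u) (\<lambda>x. x\<^sup>2)"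
  shows "integrable (\<sigma> u) (\<lambda>x. x)"
proof -
  interpret finite_measure "\<sigma> u" by (rule finite_\<sigma>[OF assms(1)])
  show ?thesis
  proof (rule Bochner_Integration.integrable_bound)
    show "integrable (\<sigma> u) (\<lambda>x. x\<^sup>2 + 1)" using assms by simp
    have "\<bar>x\<bar> \<le> x\<^sup>2 + 1" for x :: real
      using sum_squares_bound[of "\<bar>x\<bar>" 1] by simp
    thus "AE x in \<sigma> u. norm x \<le> norm (x\<^sup>2 + 1)" by simp
  qed simp
qed

end

text \<open>The spectral theorem enters only through the quadratic form \<open>\<langle>A u, u\<rangle> = \<integral> x d\<sigma> u\<close> on the domain;
polarization is then carried out on the operator side, where it needs no integrability.\<close>

locale jacobi_spectral = pvm +
  fixes b :: "nat \<Rightarrow> real"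
  assumes spectral: "is_spectral_measure_of (jacobi_domain b) (jacobi_apply b) E"
begin

abbreviation "D \<equiv> jacobi_domain b"
abbreviation "A \<equiv> jacobi_apply b"

lemma D_iff: "u \<in> D \<longleftrightarrow> u \<in> ell2 \<and> integrable (\<sigma> u) (\<lambda>x. x\<^sup>2)"
  using spectral unfolding is_spectral_measure_of_def by blast

lemma D_ell2: "u \<in> D \<Longrightarrow> u \<in> ell2" "u \<in> D \<Longrightarrow> A u \<in> ell2"
  by (simp_all add: jacobi_domain_def)

lemma A_add_scale: "A (\<lambda>n. u n + c * v n) = (\<lambda>n. A u n + c * A v n)"
  by (auto simp: jacobi_apply_def algebra_simps)

lemma D_add_scale: "u \<in> D \<Longrightarrow> v \<in> D \<Longrightarrow> (\<lambda>n. u n + c * v n) \<in> D"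
  unfolding jacobi_domain_def mem_Collect_eq A_add_scale
  by (auto intro: ell2_add[where v="\<lambda>n. c * _ n"] ell2_scale)

lemma e0_D: "e0 \<in> D"
proof -
  have "A e0 \<in> ell2"
    unfolding ell2_def mem_Collect_eq
    by (rule summable_finite[of "{0,1}"]) (auto simp: e0_def jacobi_apply_def)
  thus ?thesis by (simp add: jacobi_domain_def e0_ell2)
qed

lemma E_D: "B \<in> sets borel \<Longrightarrow> u \<in> D \<Longrightarrow> E B u \<in> D"
  unfolding D_iff
  by (auto simp: E_ell2 \<sigma>_restrict integrable_density indicator_def[abs_def] 
      intro!: integrable_mult_indicator[where 'b=real, simplified])

lemma A_self:
  assumes "u \<in> D"
  shows "ell2_inner (A u) u = complex_of_real (\<integral>x. x \<partial>\<sigma> u)"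
  using spectral assms spectral_form_self D_ell2 unfolding is_spectral_measure_of_def by metis

lemma A_expand:
  assumes "u \<in> D" "v \<in> D"
  shows "ell2_inner (A (\<lambda>n. u n + c * v n)) (\<lambda>n. u n + c * v n) =
    ell2_inner (A u) u + c * ell2_inner (A v) u + cnj c * ell2_inner (A u) v
      + c * cnj c * ell2_inner (A v) v"
proof -
  note [simp] = D_ell2[OF assms(1)] D_ell2[OF assms(2)] ell2_scale ell2_add
  show ?thesis
    unfolding A_add_scale
    by (simp add: ell2_inner_add_left ell2_inner_add_right ell2_inner_scale_left
        ell2_inner_scale_right algebra_simps)
qed

lemma A_symmetric:
  assumes "u \<in> D" "v \<in> D"
  shows "ell2_inner (A v) u = cnj (ell2_inner (A u) v)"
proof -
  have re: "Im (ell2_inner (A w) w) = 0" if "w \<in> D" for w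
    using A_self[OF that] by simp
  have "Im (c * ell2_inner (A v) u + cnj c * ell2_inner (A u) v) = 0" for c
    using arg_cong[OF A_expand[OF assms, of c], of Im] re[OF D_add_scale[OF assms, of c]]
      re[OF assms(1)] re[OF assms(2)] by (simp add: algebra_simps)
  from this[of 1] this[of \<i>] show ?thesis by (simp add: complex_eq_iff)
qed

text \<open>Apply the quadratic form to \<open>u + c E(B) u\<close>. Its spectral measure is \<open>\<sigma> u\<close> with the weight
\<open>1 + (2 Re c + |c|\<^sup>2)\<close> on \<open>B\<close>; comparing the terms linear in \<open>c\<close> for \<open>c = 1\<close> and \<open>c = \<i>\<close> isolates
\<open>\<langle>A u, E(B) u\<rangle>\<close>.\<close>

lemma inner_A_E:
  assumes u: "u \<in> D" and B: "B \<in> sets borel"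
  shows "ell2_inner (A u) (E B u) = complex_of_real (\<integral>x. indicator B x * x \<partial>\<sigma> u)"
proof -
  define I where "I = (\<integral>x. indicator B x * x \<partial>\<sigma> u)"
  have ul: "u \<in> ell2" using u D_ell2 by simp
  have EB: "E B u \<in> D" by (rule E_D[OF B u])
  have i1: "integrable (\<sigma> u) (\<lambda>x. x)"
    using u by (intro integrable_id_of_square) (auto simp: D_iff)
  have i2: "integrable (\<sigma> u) (\<lambda>x. indicator B x * x)"
    using integrable_mult_indicator[OF _ i1, of B] B by simp
  have I2: "ell2_inner (A (E B u)) (E B u) = I"
    unfolding A_self[OF EB] \<sigma>_restrict[OF ul B] I_def
    using B by (subst integral_density) auto
  have *: "(\<integral>x. x \<partial>\<sigma> (\<lambda>n. u n + c * E B u n)) = (\<integral>x. x \<partial>\<sigma> u) + (2 * Re c + (cmod c)\<^sup>2) * I" for c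
  proof -
    \<comment> \<open>The weight on \<open>B\<close> is \<open>|1 + c|\<^sup>2\<close>.\<close>
    have pos: "0 \<le> 1 + (2 * Re c + (cmod c)\<^sup>2) * indicator B x" for x
    proof -
      have "1 + (2 * Re c + (cmod c)\<^sup>2) = (cmod (1 + c))\<^sup>2"
        by (simp add: cmod_power2 power2_sum)
      thus ?thesis by (auto simp: indicator_def)
    qed
    have "\<sigma> (\<lambda>n. u n + c * E B u n)
        = density (\<sigma> u) (\<lambda>x. ennreal (1 + (2 * Re c + (cmod c)\<^sup>2) * indicator B x))"
    proof (rule measure_eqI)
      fix C assume "C \<in> sets (\<sigma> (\<lambda>n. u n + c * E B u n))"
      hence C: "C \<in> sets borel" by simp
      interpret finite_measure "\<sigma> u" by (rule finite_\<sigma>[OF ul])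
      have M1: "M u (E B u) C = M u u (C \<inter> B)" using B C ul by (simp add: M_E_right)
      have M2: "M (E B u) (E B u) C = M u u (C \<inter> B)"
        using B C ul by (simp add: M_E_right E_ell2 E_Int Int_ac)
      have "Re (M (\<lambda>n. u n + c * E B u n) (\<lambda>n. u n + c * E B u n) C)
          = measure (\<sigma> u) C + (2 * Re c + (cmod c)\<^sup>2) * measure (\<sigma> u) (C \<inter> B)"
        unfolding Re_M_add_scale[OF C ul E_ell2[OF B ul]] M1 M2
        using B C ul M_self_nonneg(2)[of "C \<inter> B" u] by (simp add: measure_\<sigma> algebra_simps)
      also have "\<dots> = (\<integral>x. indicator C x * (1 + (2 * Re c + (cmod c)\<^sup>2) * indicator B x) \<partial>\<sigma> u)"
      proof -
        have "(\<lambda>x. indicator C x * (1 + (2 * Re c + (cmod c)\<^sup>2) * indicator B x))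
           = (\<lambda>x. indicator C x + (2 * Re c + (cmod c)\<^sup>2) * indicator (C \<inter> B) x :: real)"
          by (auto simp: indicator_def)
        thus ?thesis using B C by (simp add: integrable_real_indicator less_top[symmetric])
      qed
      finally have "emeasure (\<sigma> (\<lambda>n. u n + c * E B u n)) C
         = ennreal (\<integral>x. indicator C x * (1 + (2 * Re c + (cmod c)\<^sup>2) * indicator B x) \<partial>\<sigma> u)"
        using C B ul by (simp add: emeasure_\<sigma> ell2_add ell2_scale E_ell2)
      also have "\<dots> = (\<integral>\<^sup>+x. ennreal (indicator C x * (1 + (2 * Re c + (cmod c)\<^sup>2) * indicator B x)) \<partial>\<sigma> u)"
        using pos B C
        by (intro nn_integral_eq_integral[symmetric] integrable_const_bound[where B="1 + \<bar>2 * Re c + (cmod c)\<^sup>2\<bar>"])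
           (auto intro!: borel_measurable_times borel_measurable_add simp: indicator_def)
      also have "\<dots> = emeasure (density (\<sigma> u) (\<lambda>x. ennreal (1 + (2 * Re c + (cmod c)\<^sup>2) * indicator B x))) C"
        using B C by (subst emeasure_density) (auto intro!: nn_integral_cong simp: indicator_def)
      finally show "emeasure (\<sigma> (\<lambda>n. u n + c * E B u n)) C = \<dots>" .
    qed simp
    hence "(\<integral>x. x \<partial>\<sigma> (\<lambda>n. u n + c * E B u n))
        = (\<integral>x. (1 + (2 * Re c + (cmod c)\<^sup>2) * indicator B x) * x \<partial>\<sigma> u)"
      using pos B by (simp add: integral_density)
    also have "\<dots> = (\<integral>x. x + (2 * Re c + (cmod c)\<^sup>2) * (indicator B x * x) \<partial>\<sigma> u)"
      by (simp add: algebra_simps)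
    also have "\<dots> = (\<integral>x. x \<partial>\<sigma> u) + (2 * Re c + (cmod c)\<^sup>2) * I"
      unfolding I_def using i1 i2 by simp
    finally show ?thesis .
  qed
  have **: "c * ell2_inner (A (E B u)) u + cnj c * ell2_inner (A u) (E B u) = 2 * Re c * I" for c
  proof -
    have cc: "c * cnj c = complex_of_real ((cmod c)\<^sup>2)" by (simp only: complex_norm_square)
    show ?thesis
      using A_expand[OF u EB, of c] unfolding cc A_self[OF D_add_scale[OF u EB]] I2 A_self[OF u] *
      by (simp add: algebra_simps)
  qed
  from **[of 1] **[of \<i>] show ?thesis unfolding I_def by (simp add: complex_eq_iff)
qed

text \<open>Apply the quadratic form to \<open>u + s E(B) A u\<close> and to \<open>u - s E(B) A u\<close>. Their spectral measures differ
by \<open>4 s x\<close> times \<open>\<sigma> u\<close> on \<open>B\<close>, by the previous identity, while the values of the form differ by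
\<open>4 s |E(B) A u|\<^sup>2\<close>. The set \<open>B\<close> is confined to a half line so that this difference is a positive measure.\<close>

lemma M_A_A_halfline:
  assumes u: "u \<in> D" and h: "A u \<in> D" and B: "B \<in> sets borel"
    and s: "s = 1 \<or> s = -1" "\<And>x. x \<in> B \<Longrightarrow> 0 \<le> s * x"
  shows "Re (M (A u) (A u) B) = (\<integral>x. indicator B x * x\<^sup>2 \<partial>\<sigma> u)"
proof -
  define v where "v = E B (A u)"
  have ul: "u \<in> ell2" and hl: "A u \<in> ell2" using D_ell2 u h by auto
  have v: "v \<in> D" and vl: "v \<in> ell2"
    using E_D[OF B h] E_ell2[OF B hl] by (simp_all add: v_def)
  have sq: "integrable (\<sigma> u) (\<lambda>x. x\<^sup>2)" using u D_iff by simp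
  have i1: "integrable (\<sigma> u) (\<lambda>x. x)"
    using integrable_id_of_square[OF ul sq] .
  have sq': "integrable (\<sigma> u) (\<lambda>x. indicator B x * x\<^sup>2)"
    using integrable_mult_indicator[OF _ sq, of B] B by simp
  define K where "K = density (\<sigma> u) (\<lambda>x. ennreal (4 * s * indicator B x * x))"
  have pos: "0 \<le> 4 * s * indicator B x * x" for x
    using s(2)[of x] by (auto simp: indicator_def)
  have w: "(\<lambda>n. u n + of_real c * v n) \<in> D" for c :: real
    by (rule D_add_scale[OF u v])
  have iw: "integrable (\<sigma> (\<lambda>n. u n + of_real c * v n)) (\<lambda>x. x)" for c :: real
    using w[of c] by (intro integrable_id_of_square) (auto simp: D_iff)
  have add: "emeasure (\<sigma> (\<lambda>n. u n + of_real s * v n)) C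
      = emeasure (\<sigma> (\<lambda>n. u n + of_real (-s) * v n)) C + emeasure K C" if C: "C \<in> sets borel" for C
  proof -
    have M1: "M u v C = complex_of_real (\<integral>x. indicator (B \<inter> C) x * x \<partial>\<sigma> u)"
    proof -
      have "M u v C = M u (A u) (B \<inter> C)"
        using B C ul hl unfolding v_def by (simp add: M_E_right Int_commute)
      also have "\<dots> = cnj (ell2_inner (A u) (E (B \<inter> C) u))"
        using B C ul hl by (intro ell2_inner_cnj E_ell2) auto
      finally show ?thesis using inner_A_E[OF u, of "B \<inter> C"] B C by simp
    qed
    have KC: "emeasure K C = ennreal (4 * s * (\<integral>x. indicator (B \<inter> C) x * x \<partial>\<sigma> u))"
    proof -
      have "emeasure K C = (\<integral>\<^sup>+x. ennreal (4 * s * (indicator (B \<inter> C) x * x)) \<partial>\<sigma> u)"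
        unfolding K_def using B C by (subst emeasure_density) (auto intro!: nn_integral_cong simp: indicator_def)
      also have "\<dots> = ennreal (\<integral>x. 4 * s * (indicator (B \<inter> C) x * x) \<partial>\<sigma> u)"
      proof (rule nn_integral_eq_integral)
        show "integrable (\<sigma> u) (\<lambda>x. 4 * s * (indicator (B \<inter> C) x * x))"
          using integrable_mult_indicator[OF _ i1, of "B \<inter> C"] B C by simp
        show "AE x in \<sigma> u. 0 \<le> 4 * s * (indicator (B \<inter> C) x * x)"
          using s(2) by (intro AE_I2) (simp add: indicator_def mult.commute)
      qed
      finally show ?thesis by simp
    qed
    have Kpos: "0 \<le> s * (\<integral>x. indicator (B \<inter> C) x * x \<partial>\<sigma> u)"
    proof -
      have "0 \<le> (\<integral>x. s * (indicator (B \<inter> C) x * x) \<partial>\<sigma> u)"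
        using s(2) by (intro integral_nonneg_AE AE_I2) (simp add: indicator_def)
      thus ?thesis by simp
    qed
    have R: "Re (M (\<lambda>n. u n + of_real c * v n) (\<lambda>n. u n + of_real c * v n) C)
        = Re (M u u C) + 2 * c * (\<integral>x. indicator (B \<inter> C) x * x \<partial>\<sigma> u) + c\<^sup>2 * Re (M v v C)" for c :: real
      unfolding Re_M_add_scale[OF C ul vl] M1 by simp
    have "0 \<le> Re (M (\<lambda>n. u n + of_real (-s) * v n) (\<lambda>n. u n + of_real (-s) * v n) C)"
      using w[of "-s"] D_ell2 by (intro M_self_nonneg C) auto
    hence "ennreal (Re (M (\<lambda>n. u n + of_real s * v n) (\<lambda>n. u n + of_real s * v n) C))
      = ennreal (Re (M (\<lambda>n. u n + of_real (-s) * v n) (\<lambda>n. u n + of_real (-s) * v n) C))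
        + ennreal (4 * s * (\<integral>x. indicator (B \<inter> C) x * x \<partial>\<sigma> u))"
      using Kpos unfolding R by (subst ennreal_plus[symmetric]) (auto simp: algebra_simps)
    thus ?thesis
      using emeasure_\<sigma>[OF D_ell2(1)[OF w[of s]] C] emeasure_\<sigma>[OF D_ell2(1)[OF w[of "-s"]] C] KC by simp
  qed
  have iK: "integrable K (\<lambda>x. x)" "(\<integral>x. x \<partial>K) = 4 * s * (\<integral>x. indicator B x * x\<^sup>2 \<partial>\<sigma> u)"
  proof -
    have eq: "4 * s * indicator B x * x * x = 4 * s * (indicator B x * x\<^sup>2)" for x
      by (simp add: power2_eq_square)
    show "integrable K (\<lambda>x. x)"
      unfolding K_def using B pos sq' by (subst integrable_density) (auto simp: eq)
    show "(\<integral>x. x \<partial>K) = 4 * s * (\<integral>x. indicator B x * x\<^sup>2 \<partial>\<sigma> u)"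
      unfolding K_def using B pos by (subst integral_density) (auto simp: eq)
  qed
  have int: "(\<integral>x. x \<partial>\<sigma> (\<lambda>n. u n + of_real s * v n))
      = (\<integral>x. x \<partial>\<sigma> (\<lambda>n. u n + of_real (-s) * v n)) + 4 * s * (\<integral>x. indicator B x * x\<^sup>2 \<partial>\<sigma> u)"
    using integral_measure_add(2)[OF sets_\<sigma> sets_\<sigma> _ add iw iK(1)] iK(2) by (simp add: K_def)
  have Auv: "ell2_inner (A u) v = complex_of_real (Re (M (A u) (A u) B))"
  proof -
    have "ell2_inner (A u) v = cnj (M (A u) (A u) B)"
      unfolding v_def by (rule ell2_inner_cnj[OF E_ell2[OF B hl] hl])
    thus ?thesis using M_self_nonneg(2)[OF B hl] by (simp add: complex_eq_iff)
  qed
  have AA: "(\<integral>x. x \<partial>\<sigma> (\<lambda>n. u n + of_real c * v n))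
      = Re (ell2_inner (A u) u) + 2 * c * Re (M (A u) (A u) B) + c\<^sup>2 * Re (ell2_inner (A v) v)" for c :: real
    using arg_cong[OF A_expand[OF u v, of "of_real c"], of Re]
    unfolding A_self[OF w] A_symmetric[OF u v] Auv by (simp add: power2_eq_square)
  show ?thesis using int s(1) unfolding AA by (auto simp: algebra_simps)
qed

lemma M_A_A:
  assumes u: "u \<in> D" and h: "A u \<in> D" and B: "B \<in> sets borel"
  shows "Re (M (A u) (A u) B) = (\<integral>x. indicator B x * x\<^sup>2 \<partial>\<sigma> u)"
proof -
  have hl: "A u \<in> ell2" using D_ell2 u by auto
  interpret finite_measure "\<sigma> (A u)" by (rule finite_\<sigma>[OF hl])
  have sq: "integrable (\<sigma> u) (\<lambda>x. x\<^sup>2)" using u D_iff by simp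
  have sq': "integrable (\<sigma> u) (\<lambda>x. indicator C x * x\<^sup>2)" if "C \<in> sets borel" for C
    using integrable_mult_indicator[OF _ sq, of C] that by simp
  have B1: "B \<inter> {0..} \<in> sets borel" "B \<inter> {..<0} \<in> sets borel" using B by auto
  have Bsplit: "B = (B \<inter> {0..}) \<union> (B \<inter> {..<0})" by auto
  have "Re (M (A u) (A u) B) = measure (\<sigma> (A u)) ((B \<inter> {0..}) \<union> (B \<inter> {..<0}))"
    unfolding Bsplit[symmetric] by (simp add: measure_\<sigma>[OF hl B])
  also have "\<dots> = Re (M (A u) (A u) (B \<inter> {0..})) + Re (M (A u) (A u) (B \<inter> {..<0}))"
    using B1 hl by (subst finite_measure_Union) (auto simp: measure_\<sigma>)
  also have "\<dots> = (\<integral>x. indicator (B \<inter> {0..}) x * x\<^sup>2 \<partial>\<sigma> u) + (\<integral>x. indicator (B \<inter> {..<0}) x * x\<^sup>2 \<partial>\<sigma> u)"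
    using M_A_A_halfline[OF u h B1(1), of 1] M_A_A_halfline[OF u h B1(2), of "-1"] by simp
  also have "\<dots> = (\<integral>x. indicator (B \<inter> {0..}) x * x\<^sup>2 + indicator (B \<inter> {..<0}) x * x\<^sup>2 \<partial>\<sigma> u)"
    using sq' B1 by simp
  also have "\<dots> = (\<integral>x. indicator B x * x\<^sup>2 \<partial>\<sigma> u)"
    by (intro Bochner_Integration.integral_cong) (auto simp: indicator_def)
  finally show ?thesis .
qed

text \<open>With \<open>A u = z u + e\<^sub>0\<close> the two preceding identities give \<open>\<sigma> e\<^sub>0 = |x - z|\<^sup>2 \<sigma> u\<close>, so the Poisson integral of
\<open>\<sigma> e\<^sub>0\<close> is \<open>Im z\<close> times the squared norm of \<open>u\<close>. That this number is \<open>Im (u 0)\<close> is the imaginary part of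
\<open>\<langle>A u, u\<rangle> = z \<langle>u, u\<rangle> + \<langle>e\<^sub>0, u\<rangle>\<close>, whose left side is real.\<close>

lemma poisson_integral_of_resolvent_solution:
  assumes z: "0 < Im z" and ul: "u \<in> ell2" and eq: "A u = (\<lambda>n. z * u n + e0 n)"
  shows "(\<integral>x. poisson z x \<partial>\<sigma> e0) = Im (u 0)"
proof -
  define h where "h = A u"
  have hl: "h \<in> ell2" unfolding h_def eq by (intro ell2_add ell2_scale ul e0_ell2)
  have u: "u \<in> D" using ul hl by (simp add: jacobi_domain_def h_def)
  have "(\<lambda>n. e0 n + z * u n) \<in> D" by (rule D_add_scale[OF e0_D u])
  hence h: "h \<in> D" by (simp add: h_def eq add.commute)
  have e0: "e0 = (\<lambda>n. h n + (-z) * u n)" by (simp add: h_def eq)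
  interpret finite_measure "\<sigma> u" by (rule finite_\<sigma>[OF ul])
  have sq: "integrable (\<sigma> u) (\<lambda>x. x\<^sup>2)" using u D_iff by simp
  have i1: "integrable (\<sigma> u) (\<lambda>x. x)" using integrable_id_of_square[OF ul sq] .
  define d where "d x = (x - Re z)\<^sup>2 + (Im z)\<^sup>2" for x :: real
  have [measurable]: "d \<in> borel_measurable borel" unfolding d_def by simp
  have d_pos: "0 < d x" for x using z by (simp add: d_def add_nonneg_pos)
  have dens: "\<sigma> e0 = density (\<sigma> u) (\<lambda>x. ennreal (d x))"
  proof (rule measure_eqI)
    fix B assume "B \<in> sets (\<sigma> e0)"
    hence B: "B \<in> sets borel" by simp
    note im = integrable_mult_indicator[OF _ sq, of B, simplified] integrable_mult_indicator[OF _ i1, of B, simplified]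
    have M1: "M h u B = complex_of_real (\<integral>x. indicator B x * x \<partial>\<sigma> u)"
    proof -
      have "M h u B = ell2_inner (A u) (E B u)"
        using proj[OF B] hl ul unfolding orth_projection_def h_def by metis
      thus ?thesis using inner_A_E[OF u B] by simp
    qed
    have "Re (M e0 e0 B) = (\<integral>x. indicator B x * x\<^sup>2 \<partial>\<sigma> u) - 2 * Re z * (\<integral>x. indicator B x * x \<partial>\<sigma> u)
        + (cmod z)\<^sup>2 * (\<integral>x. indicator B x \<partial>\<sigma> u)"
      unfolding e0 Re_M_add_scale[OF B hl ul] M1 using M_A_A[OF u _ B] h B ul
      by (simp add: h_def measure_\<sigma>)
    also have "\<dots> = (\<integral>x. indicator B x * x\<^sup>2 - 2 * Re z * (indicator B x * x) + (cmod z)\<^sup>2 * indicator B x \<partial>\<sigma> u)"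
      using im B by (simp add: integrable_real_indicator less_top[symmetric])
    also have "\<dots> = (\<integral>x. indicator B x * d x \<partial>\<sigma> u)"
      by (intro Bochner_Integration.integral_cong) (auto simp: d_def cmod_power2 power2_diff algebra_simps)
    finally have "emeasure (\<sigma> e0) B = ennreal (\<integral>x. indicator B x * d x \<partial>\<sigma> u)"
      using B by (simp add: emeasure_\<sigma> e0_ell2)
    also have "\<dots> = (\<integral>\<^sup>+x. ennreal (indicator B x * d x) \<partial>\<sigma> u)"
    proof (rule nn_integral_eq_integral[symmetric])
      have "integrable (\<sigma> u) (\<lambda>x. indicator B x * x\<^sup>2 - 2 * Re z * (indicator B x * x) + (cmod z)\<^sup>2 * indicator B x)"
        using im B by (simp add: integrable_real_indicator less_top[symmetric])
      thus "integrable (\<sigma> u) (\<lambda>x. indicator B x * d x)"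
        by (rule Bochner_Integration.integrable_cong[THEN iffD1, rotated -1])
          (auto simp: d_def cmod_power2 power2_diff algebra_simps)
    qed (auto intro!: mult_nonneg_nonneg less_imp_le[OF d_pos])
    also have "\<dots> = emeasure (density (\<sigma> u) (\<lambda>x. ennreal (d x))) B"
      using B by (subst emeasure_density) (auto intro!: nn_integral_cong simp: indicator_def)
    finally show "emeasure (\<sigma> e0) B = emeasure (density (\<sigma> u) (\<lambda>x. ennreal (d x))) B" .
  qed simp
  have "(\<integral>x. Im z / d x \<partial>\<sigma> e0) = (\<integral>x. d x * (Im z / d x) \<partial>\<sigma> u)"
    unfolding dens using d_pos by (subst integral_density) (auto simp: less_imp_le)
  also have "\<dots> = Im z * measure (\<sigma> u) UNIV"
    using d_pos by (simp add: less_imp_neq[symmetric])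
  also have "\<dots> = Im z * Re (ell2_inner u u)"
    using ul by (simp add: measure_\<sigma> E_UNIV)
  also have "\<dots> = Im (u 0)"
  proof -
    have "ell2_inner (A u) u = z * ell2_inner u u + ell2_inner e0 u"
      unfolding eq using ul e0_ell2 by (simp add: ell2_inner_add_left ell2_inner_scale_left ell2_scale)
    moreover have "ell2_inner e0 u = cnj (u 0)"
      unfolding ell2_inner_def by (subst suminf_finite[of "{0}"]) (auto simp: e0_def)
    moreover have "Im (ell2_inner u u) = 0" using ul by (simp add: ell2_inner_self)
    ultimately show ?thesis using arg_cong[OF A_self[OF u], of Im] by simp
  qed
  finally show ?thesis by (simp add: d_def poisson_def)
qed

end

section \<open>Orthogonal polynomials and Weyl functions\<close>

text \<open>Polynomials of the first kind. They are defined over any real normed field so that the real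
polynomials and their complex extensions share all algebraic facts.\<close>

fun opol :: "(nat \<Rightarrow> real) \<Rightarrow> nat \<Rightarrow> 'a::real_normed_field \<Rightarrow> 'a" where
  "opol b 0 x = 1"
| "opol b (Suc 0) x = x / of_real (b 0)"
| "opol b (Suc (Suc n)) x =
     (x * opol b (Suc n) x - of_real (b n) * opol b n x) / of_real (b (Suc n))"

text \<open>Polynomials of the second kind: the same recurrence, started so that \<open>J q = z q + e\<^sub>0\<close>.\<close>

fun spol :: "(nat \<Rightarrow> real) \<Rightarrow> nat \<Rightarrow> 'a::real_normed_field \<Rightarrow> 'a" where
  "spol b 0 x = 0"
| "spol b (Suc 0) x = 1 / of_real (b 0)"
| "spol b (Suc (Suc n)) x =
     (x * spol b (Suc n) x - of_real (b n) * spol b n x) / of_real (b (Suc n))"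

lemma opol_of_real: "opol b n (of_real x) = of_real (opol b n x)"
  by (induction b n x rule: opol.induct) simp_all

lemma spol_of_real: "spol b n (of_real x) = of_real (spol b n x)"
  by (induction b n x rule: spol.induct) simp_all

lemma opol_uminus: "opol b n (- x) = (- 1) ^ n * opol b n x"
  by (induction b n x rule: opol.induct) (simp_all add: field_simps)

lemma continuous_on_opol [continuous_intros]:
  "continuous_on S g \<Longrightarrow> continuous_on S (\<lambda>x. opol b n (g x))"
proof (induction b n "undefined :: 'b" rule: opol.induct)
qed (auto simp: divide_inverse intro!: continuous_intros)

lemma continuous_on_spol [continuous_intros]:
  "continuous_on S g \<Longrightarrow> continuous_on S (\<lambda>x. spol b n (g x))"
proof (induction b n "undefined :: 'b" rule: spol.induct)
qed (auto simp: divide_inverse intro!: continuous_intros)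

lemma holomorphic_on_opol [holomorphic_intros]: "opol b n holomorphic_on S"
proof (induction b n "undefined :: complex" rule: opol.induct)
qed (auto simp: divide_inverse opol.simps[abs_def] intro!: holomorphic_intros)

lemma holomorphic_on_spol [holomorphic_intros]: "spol b n holomorphic_on S"
proof (induction b n "undefined :: complex" rule: spol.induct)
qed (auto simp: divide_inverse spol.simps[abs_def] intro!: holomorphic_intros)

lemma cmod_square: "(cmod w)\<^sup>2 = Re w * Re w + Im w * Im w"
  unfolding cmod_power2 by (simp only: power2_eq_square)

locale positive_weights =
  fixes b :: "nat \<Rightarrow> real"
  assumes b_pos: "0 < b n"
begin

lemma wronskian:
  "of_real (b n) * (spol b (Suc n) x * opol b n x - spol b n x * opol b (Suc n) x) = (1 :: 'a::real_normed_field)"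
proof (induction n)
  case 0
  show ?case using b_pos[of 0] by simp
next
  case (Suc n)
  have "of_real (b (Suc n)) * (spol b (Suc (Suc n)) x * opol b (Suc n) x - spol b (Suc n) x * opol b (Suc (Suc n)) x)
      = of_real (b n) * (spol b (Suc n) x * opol b n x - spol b n x * opol b (Suc n) x)"
    using b_pos[of "Suc n"] by (simp add: field_simps)
  thus ?case using Suc by simp
qed

lemma jacobi_solution:
  "jacobi_apply b (\<lambda>n. c * spol b n z + m * opol b n z)
     = (\<lambda>n. z * (c * spol b n z + m * opol b n z) + c * e0 n)"
proof
  fix n
  show "jacobi_apply b (\<lambda>n. c * spol b n z + m * opol b n z) n
     = z * (c * spol b n z + m * opol b n z) + c * e0 n"
  proof (cases n)
    case 0
    thus ?thesis using b_pos[of 0] by (simp add: jacobi_apply_def e0_def field_simps)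
  next
    case (Suc k)
    thus ?thesis using b_pos[of "Suc k"] by (simp add: jacobi_apply_def e0_def field_simps)
  qed
qed

text \<open>Summation by parts of \<open>Im \<langle>J u, u\<rangle>\<close> over the rows up to \<open>n\<close>. The parameter \<open>c\<close> covers the homogeneous
solution (\<open>c = 0\<close>) and the resolvent equation (\<open>c = 1\<close>).\<close>

lemma green_identity:
  assumes "jacobi_apply b u = (\<lambda>n. z * u n + c * e0 n)"
  shows "Im z * (\<Sum>j\<le>n. (cmod (u j))\<^sup>2) + Im (c * cnj (u 0)) = b n * Im (u (Suc n) * cnj (u n))"
proof (induction n)
  case 0
  have "of_real (b 0) * u (Suc 0) = z * u 0 + c"
    using fun_cong[OF assms, of 0] by (simp add: jacobi_apply_def e0_def)
  hence "(of_real (b 0) * u (Suc 0)) * cnj (u 0) = (z * u 0 + c) * cnj (u 0)"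
    by (rule arg_cong)
  from arg_cong[OF this, of Im] show ?case
    by (simp add: cmod_square algebra_simps)
next
  case (Suc n)
  have "of_real (b (Suc n)) * u (Suc (Suc n)) + of_real (b n) * u n = z * u (Suc n)"
    using fun_cong[OF assms, of "Suc n"] by (simp add: jacobi_apply_def e0_def)
  hence "(of_real (b (Suc n)) * u (Suc (Suc n)) + of_real (b n) * u n) * cnj (u (Suc n))
      = (z * u (Suc n)) * cnj (u (Suc n))"
    by (rule arg_cong)
  from arg_cong[OF this, of Im] Suc show ?case
    by (simp add: cmod_square algebra_simps)
qed

definition weyl_den :: "nat \<Rightarrow> complex \<Rightarrow> complex" where
  "weyl_den n z = opol b (Suc n) z + \<i> * opol b n z"

text \<open>The value \<open>m\<close> for which \<open>u = q + m p\<close> satisfies the boundary condition \<open>u\<^sub>n\<^sub>+\<^sub>1 = - \<i> u\<^sub>n\<close>.\<close>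

definition weyl :: "nat \<Rightarrow> complex \<Rightarrow> complex" where
  "weyl n z = - (spol b (Suc n) z + \<i> * spol b n z) / weyl_den n z"

text \<open>A zero would make \<open>p\<close> itself satisfy the dissipative boundary condition, and Green's identity
would force \<open>p\<^sub>n = p\<^sub>n\<^sub>+\<^sub>1 = 0\<close>, against the Wronskian identity. Real \<open>z\<close> are included, so there are no poles on the
real line either.\<close>

lemma weyl_den_nonzero:
  assumes "0 \<le> Im z"
  shows "weyl_den n z \<noteq> 0"
proof
  assume "weyl_den n z = 0"
  hence p: "opol b (Suc n) z = - \<i> * opol b n z" by (simp add: weyl_den_def add_eq_0_iff2)
  have "Im z * (\<Sum>j\<le>n. (cmod (opol b j z))\<^sup>2) = b n * Im (opol b (Suc n) z * cnj (opol b n z))"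
    using green_identity[of "\<lambda>n. opol b n z" z 0 n] jacobi_solution[of 0 z 1] by simp
  also have "\<dots> = - b n * (cmod (opol b n z))\<^sup>2"
    unfolding p by (simp add: cmod_square algebra_simps)
  finally have "0 \<le> - b n * (cmod (opol b n z))\<^sup>2"
    using assms by (metis mult_nonneg_nonneg sum_nonneg zero_le_power2)
  hence "opol b n z = 0"
    using b_pos[of n] by (simp add: mult_le_0_iff not_less)
  thus False using wronskian[of n z] p by simp
qed

text \<open>The boundary term in Green's identity is \<open>- b\<^sub>n |u\<^sub>n|\<^sup>2 \<le> 0\<close>.\<close>

lemma weyl_solution_bound:
  assumes "0 \<le> Im z"
  shows "Im z * (\<Sum>j\<le>n. (cmod (spol b j z + weyl n z * opol b j z))\<^sup>2) \<le> Im (weyl n z)"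
proof -
  define u where "u j = spol b j z + weyl n z * opol b j z" for j
  have eq: "jacobi_apply b u = (\<lambda>n. z * u n + 1 * e0 n)"
    using jacobi_solution[of 1 z "weyl n z"] by (simp add: u_def[abs_def])
  have "weyl n z * weyl_den n z = - (spol b (Suc n) z + \<i> * spol b n z)"
    using weyl_den_nonzero[OF assms] by (simp add: weyl_def)
  hence "u (Suc n) + \<i> * u n = 0"
    by (simp add: u_def weyl_den_def algebra_simps)
  hence un: "u (Suc n) = - \<i> * u n" by (simp add: add_eq_0_iff2)
  have "Im (u (Suc n) * cnj (u n)) = - (cmod (u n))\<^sup>2"
    unfolding un by (simp add: cmod_square algebra_simps)
  hence "Im z * (\<Sum>j\<le>n. (cmod (u j))\<^sup>2) - Im (u 0) = - b n * (cmod (u n))\<^sup>2"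
    using green_identity[OF eq, of n] by simp
  moreover have "0 \<le> b n * (cmod (u n))\<^sup>2" using b_pos[of n] by simp
  ultimately have "Im z * (\<Sum>j\<le>n. (cmod (u j))\<^sup>2) \<le> Im (u 0)" by linarith
  thus ?thesis by (simp add: u_def)
qed

lemma weyl_bound:
  assumes "0 < Im z"
  shows "cmod (weyl n z) \<le> 1 / Im z"
proof -
  have "(cmod (weyl n z))\<^sup>2 \<le> (\<Sum>j\<le>n. (cmod (spol b j z + weyl n z * opol b j z))\<^sup>2)"
    using member_le_sum[of 0 "{..n}" "\<lambda>j. (cmod (spol b j z + weyl n z * opol b j z))\<^sup>2"] by simp
  hence "Im z * (cmod (weyl n z))\<^sup>2 \<le> Im (weyl n z)"
    using weyl_solution_bound[of z n] assms
    by (meson less_imp_le mult_left_mono order_trans)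
  also have "\<dots> \<le> cmod (weyl n z)" using abs_Im_le_cmod[of "weyl n z"] by linarith
  finally have "cmod (weyl n z) * (Im z * cmod (weyl n z)) \<le> cmod (weyl n z) * 1"
    by (simp add: power2_eq_square algebra_simps)
  hence "Im z * cmod (weyl n z) \<le> 1 \<or> weyl n z = 0"
    by (subst (asm) mult_le_cancel_left) auto
  thus ?thesis using assms by (auto simp: field_simps)
qed

lemma Im_weyl_real:
  "Im (weyl n (of_real x)) = 1 / (b n * ((opol b n x)\<^sup>2 + (opol b (Suc n) x)\<^sup>2))"
proof -
  define p p' q q' where "p = opol b n x" "p' = opol b (Suc n) x" "q = spol b n x" "q' = spol b (Suc n) x"
  have w: "b n * (q' * p - q * p') = 1"
    using wronskian[of n x] by (simp add: p_p'_q_q'_def)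
  have "weyl n (of_real x) = - (of_real q' + \<i> * of_real q) / (of_real p' + \<i> * of_real p)"
    by (simp only: weyl_def weyl_den_def opol_of_real spol_of_real p_p'_q_q'_def)
  hence "Im (weyl n (of_real x)) = (q' * p - q * p') / (p\<^sup>2 + p'\<^sup>2)"
    by (simp add: Im_divide add.commute)
  also have "\<dots> = (b n * (q' * p - q * p')) / (b n * (p\<^sup>2 + p'\<^sup>2))"
    using b_pos[of n] by simp
  also have "\<dots> = 1 / (b n * (p\<^sup>2 + p'\<^sup>2))" unfolding w ..
  finally show ?thesis by (simp only: p_p'_q_q'_def)
qed

text \<open>The quotients \<open>p\<^sub>n / p\<^sub>n\<^sub>+\<^sub>1\<close> satisfy a continued fraction recurrence, whence they decay at infinity by
induction.\<close>

lemma opol_at_infinity: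
  "(\<forall>\<^sub>F z in at_infinity. opol b n (z :: complex) \<noteq> 0) \<and>
   (\<forall>\<^sub>F z in at_infinity. opol b (Suc n) (z :: complex) \<noteq> 0) \<and>
   ((\<lambda>z::complex. opol b n z / opol b (Suc n) z) \<longlongrightarrow> 0) at_infinity"
proof (induction n)
  case 0
  have "((\<lambda>z::complex. of_real (b 0) * inverse z) \<longlongrightarrow> of_real (b 0) * 0) at_infinity"
    by (intro tendsto_intros tendsto_inverse_0)
  thus ?case using b_pos[of 0] eventually_not_equal_at_infinity[of "0::complex"]
    by (simp add: divide_inverse mult.commute)
next
  case (Suc n)
  define \<rho> where "\<rho> z = opol b n z / opol b (Suc n) z" for z :: complex
  define d where "d z = z - of_real (b n) * \<rho> z" for z :: complex
  have ne: "\<forall>\<^sub>F z in at_infinity. opol b (Suc n) (z :: complex) \<noteq> 0" using Suc by blast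
  have "(\<rho> \<longlongrightarrow> 0) at_infinity" using Suc by (simp add: \<rho>_def[abs_def])
  hence "((\<lambda>z. - of_real (b n) * \<rho> z) \<longlongrightarrow> - of_real (b n) * 0) at_infinity"
    by (intro tendsto_intros)
  from tendsto_add_filterlim_at_infinity[OF this filterlim_ident]
  have d: "filterlim d at_infinity at_infinity" by (simp add: d_def[abs_def])
  have eq: "\<forall>\<^sub>F z in at_infinity. opol b (Suc (Suc n)) z = opol b (Suc n) z * d z / of_real (b (Suc n))"
    using ne
  proof eventually_elim
    case (elim z)
    have "opol b (Suc n) z * d z = z * opol b (Suc n) z - of_real (b n) * opol b n z"
      using elim by (simp add: d_def \<rho>_def algebra_simps)
    thus ?case by simp
  qed
  have d_ne: "\<forall>\<^sub>F z in at_infinity. d z \<noteq> 0"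
    using filterlim_at_infinity_imp_eventually_ne[OF d] .
  have "((\<lambda>z. of_real (b (Suc n)) / d z) \<longlongrightarrow> 0) at_infinity"
    by (rule tendsto_divide_0[OF tendsto_const d])
  moreover have "\<forall>\<^sub>F z in at_infinity. of_real (b (Suc n)) / d z = opol b (Suc n) z / opol b (Suc (Suc n)) z"
    using eq ne d_ne by eventually_elim (use b_pos[of "Suc n"] in \<open>simp del: opol.simps\<close>)
  ultimately have "((\<lambda>z::complex. opol b (Suc n) z / opol b (Suc (Suc n)) z) \<longlongrightarrow> 0) at_infinity"
    by (rule Lim_transform_eventually)
  moreover have "\<forall>\<^sub>F z in at_infinity. opol b (Suc (Suc n)) (z :: complex) \<noteq> 0"
    using eq ne d_ne by eventually_elim (use b_pos[of "Suc n"] in \<open>simp del: opol.simps\<close>)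
  ultimately show ?case using ne by blast
qed

text \<open>By the Wronskian identity, \<open>q\<^sub>n\<^sub>+\<^sub>1 / p\<^sub>n\<^sub>+\<^sub>1 - q\<^sub>n / p\<^sub>n = 1 / (b\<^sub>n p\<^sub>n p\<^sub>n\<^sub>+\<^sub>1)\<close>.\<close>

lemma spol_quotient_at_infinity:
  "(\<exists>l. ((\<lambda>z::complex. 1 / opol b n z) \<longlongrightarrow> l) at_infinity) \<and>
   (\<exists>l. ((\<lambda>z::complex. spol b n z / opol b n z) \<longlongrightarrow> l) at_infinity)"
proof (induction n)
  case 0
  show ?case by (auto intro: tendsto_const)
next
  case (Suc n)
  then obtain l1 l2 where l1: "((\<lambda>z::complex. 1 / opol b n z) \<longlongrightarrow> l1) at_infinity"
    and l2: "((\<lambda>z::complex. spol b n z / opol b n z) \<longlongrightarrow> l2) at_infinity" by blast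
  note I = opol_at_infinity[of n]
  have ne: "\<forall>\<^sub>F z in at_infinity. opol b n (z :: complex) \<noteq> 0 \<and> opol b (Suc n) z \<noteq> 0"
    using I by (auto intro: eventually_conj)
  have "((\<lambda>z::complex. 1 / opol b n z * (opol b n z / opol b (Suc n) z)) \<longlongrightarrow> l1 * 0) at_infinity"
    using I by (intro tendsto_mult l1) auto
  moreover have "\<forall>\<^sub>F z::complex in at_infinity. 1 / opol b n z * (opol b n z / opol b (Suc n) z) = 1 / opol b (Suc n) z"
    using ne by eventually_elim simp
  ultimately have l3: "((\<lambda>z::complex. 1 / opol b (Suc n) z) \<longlongrightarrow> l1 * 0) at_infinity"
    by (rule Lim_transform_eventually)
  have "((\<lambda>z::complex. spol b n z / opol b n z + 1 / of_real (b n) * (1 / opol b n z * (1 / opol b (Suc n) z)))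
       \<longlongrightarrow> l2 + 1 / of_real (b n) * (l1 * (l1 * 0))) at_infinity"
    by (intro tendsto_intros l1 l2 l3)
  moreover have "\<forall>\<^sub>F z::complex in at_infinity. spol b n z / opol b n z
      + 1 / of_real (b n) * (1 / opol b n z * (1 / opol b (Suc n) z)) = spol b (Suc n) z / opol b (Suc n) z"
    using ne
  proof eventually_elim
    case (elim z)
    have "spol b (Suc n) z * opol b n z = spol b n z * opol b (Suc n) z + 1 / of_real (b n)"
      using wronskian[of n z] b_pos[of n] by (simp add: field_simps)
    hence "spol b (Suc n) z / opol b (Suc n) z
        = (spol b n z * opol b (Suc n) z + 1 / of_real (b n)) / (opol b n z * opol b (Suc n) z)"
      using elim by (simp add: field_simps)
    also have "\<dots> = spol b n z / opol b n z + 1 / of_real (b n) * (1 / opol b n z * (1 / opol b (Suc n) z))"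
      using elim by (simp add: add_divide_distrib)
    finally show ?case ..
  qed
  ultimately have "((\<lambda>z::complex. spol b (Suc n) z / opol b (Suc n) z) \<longlongrightarrow>
      l2 + 1 / of_real (b n) * (l1 * (l1 * 0))) at_infinity"
    by (rule Lim_transform_eventually)
  thus ?case using l3 by blast
qed

lemma weyl_at_infinity: "\<exists>l. (weyl n \<longlongrightarrow> l) at_infinity"
proof -
  obtain l1 l2 where l1: "((\<lambda>z::complex. spol b n z / opol b n z) \<longlongrightarrow> l1) at_infinity"
    and l2: "((\<lambda>z::complex. spol b (Suc n) z / opol b (Suc n) z) \<longlongrightarrow> l2) at_infinity"
    using spol_quotient_at_infinity by blast
  note I = opol_at_infinity[of n]
  have ne: "\<forall>\<^sub>F z in at_infinity. opol b n (z :: complex) \<noteq> 0 \<and> opol b (Suc n) z \<noteq> 0"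
    using I by (auto intro: eventually_conj)
  have "((\<lambda>z::complex. - (spol b (Suc n) z / opol b (Suc n) z
        + \<i> * (spol b n z / opol b n z * (opol b n z / opol b (Suc n) z)))
        / (1 + \<i> * (opol b n z / opol b (Suc n) z))) \<longlongrightarrow> - (l2 + \<i> * (l1 * 0)) / (1 + \<i> * 0)) at_infinity"
    using I by (intro tendsto_intros l1 l2) auto
  moreover have "\<forall>\<^sub>F z::complex in at_infinity. - (spol b (Suc n) z / opol b (Suc n) z
        + \<i> * (spol b n z / opol b n z * (opol b n z / opol b (Suc n) z)))
        / (1 + \<i> * (opol b n z / opol b (Suc n) z)) = weyl n z"
    using ne
  proof eventually_elim
    case (elim z)
    have "- (spol b (Suc n) z / opol b (Suc n) z + \<i> * (spol b n z / opol b n z * (opol b n z / opol b (Suc n) z)))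
        = - (spol b (Suc n) z + \<i> * spol b n z) / opol b (Suc n) z"
      using elim by (simp add: field_simps)
    moreover have "1 + \<i> * (opol b n z / opol b (Suc n) z) = weyl_den n z / opol b (Suc n) z"
      using elim by (simp add: weyl_den_def add_divide_distrib)
    ultimately show ?case using elim by (simp add: weyl_def)
  qed
  ultimately show ?thesis by (blast intro: Lim_transform_eventually)
qed

lemma weyl_continuous: "continuous_on {z. 0 \<le> Im z} (weyl n)"
proof -
  have "continuous_on {z. 0 \<le> Im z} (\<lambda>z. - (spol b (Suc n) z + \<i> * spol b n z) / weyl_den n z)"
    unfolding weyl_den_def
    by (intro continuous_on_divide continuous_on_minus continuous_on_add continuous_on_mult_left
        continuous_on_opol continuous_on_spol continuous_on_id)
      (use weyl_den_nonzero in \<open>simp add: weyl_den_def\<close>)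
  thus ?thesis by (simp add: weyl_def[abs_def])
qed

lemma weyl_holomorphic: "weyl n holomorphic_on {z. 0 < Im z}"
proof -
  have "(\<lambda>z. - (spol b (Suc n) z + \<i> * spol b n z) / weyl_den n z) holomorphic_on {z. 0 < Im z}"
    unfolding weyl_den_def
    by (intro holomorphic_on_divide holomorphic_on_minus holomorphic_on_add holomorphic_on_mult
        holomorphic_on_const holomorphic_on_opol holomorphic_on_spol)
      (use weyl_den_nonzero in \<open>simp add: weyl_den_def\<close>)
  thus ?thesis by (simp add: weyl_def[abs_def])
qed

text \<open>A bound that is uniform up to the real line, as the Poisson formula requires; the bound
\<open>1 / Im z\<close> is not.\<close>

lemma weyl_bounded: "\<exists>C. \<forall>z. 0 \<le> Im z \<longrightarrow> cmod (weyl n z) \<le> C"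
proof -
  obtain l where l: "(weyl n \<longlongrightarrow> l) at_infinity" using weyl_at_infinity by blast
  have "\<forall>\<^sub>F z in at_infinity. dist (weyl n z) l < 1" using l by (auto simp: tendsto_iff)
  then obtain R where R: "\<And>z. R \<le> cmod z \<Longrightarrow> dist (weyl n z) l < 1"
    by (auto simp: eventually_at_infinity)
  have "compact ({z. 0 \<le> Im z} \<inter> cball 0 R)"
    by (intro closed_Int_compact closed_halfspace_Im_ge compact_cball)
  hence "bounded (weyl n ` ({z. 0 \<le> Im z} \<inter> cball 0 R))"
    by (intro compact_imp_bounded compact_continuous_image continuous_on_subset[OF weyl_continuous]) auto
  then obtain C where "\<forall>z\<in>{z. 0 \<le> Im z} \<inter> cball 0 R. cmod (weyl n z) \<le> C"
    by (auto simp: bounded_iff)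
  hence C: "cmod (weyl n z) \<le> C" if "0 \<le> Im z" "cmod z \<le> R" for z
    using that by simp
  have "cmod (weyl n z) \<le> max C (cmod l + 1)" if "0 \<le> Im z" for z
  proof (cases "cmod z \<le> R")
    case True
    thus ?thesis using C that by (simp add: le_max_iff_disj)
  next
    case False
    hence "cmod (weyl n z - l) < 1" using R[of z] by (simp add: dist_norm)
    thus ?thesis using norm_triangle_ineq2[of "weyl n z" l] by (simp add: le_max_iff_disj)
  qed
  thus ?thesis by blast
qed

text \<open>Carmona's approximants of the spectral measure.\<close>

definition carmona_density :: "nat \<Rightarrow> real \<Rightarrow> real" where
  "carmona_density n x = 1 / (pi * (b n * ((opol b n x)\<^sup>2 + (opol b (Suc n) x)\<^sup>2)))"

theorem Im_weyl_poisson: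
  assumes z: "0 < Im z"
  shows "integrable lborel (\<lambda>t. carmona_density n t * poisson z t)"
    "Im (weyl n z) = (\<integral>t. carmona_density n t * poisson z t \<partial>lborel)"
proof -
  obtain C where C: "\<And>z. 0 \<le> Im z \<Longrightarrow> cmod (weyl n z) \<le> C" using weyl_bounded by blast
  note P = poisson_formula_half_plane[OF weyl_continuous weyl_holomorphic C z]
  have eq: "carmona_density n t * poisson z t = Im (weyl n (of_real t) * of_real (poisson z t)) / pi" for t
    by (simp add: Im_weyl_real carmona_density_def)
  show "integrable lborel (\<lambda>t. carmona_density n t * poisson z t)"
    unfolding eq using P(1) by (intro integrable_divide integrable_Im) 
  have "(\<integral>t. carmona_density n t * poisson z t \<partial>lborel)
      = Im (\<integral>t. weyl n (of_real t) * of_real (poisson z t) \<partial>lborel) / pi"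
    unfolding eq using integral_Im[OF P(1)] by simp
  thus "Im (weyl n z) = (\<integral>t. carmona_density n t * poisson z t \<partial>lborel)"
    using P(2) by simp
qed

end

locale jacobi_spectral_positive = jacobi_spectral + positive_weights

context jacobi_spectral_positive
begin

text \<open>The values \<open>m\<^sub>n(z)\<close> are bounded, so it suffices to identify the limit along convergent subsequences. A
limit \<open>m\<close> makes \<open>q + m p\<close> square-summable by the uniform bound on partial sums, and then \<open>Im m\<close> is the
Poisson integral of the spectral measure.\<close>

theorem Im_weyl_tendsto:
  assumes z: "0 < Im z"
  shows "(\<lambda>n. Im (weyl n z)) \<longlonglongrightarrow> (\<integral>x. poisson z x \<partial>\<sigma> e0)"
proof (rule ccontr)
  define L where "L = (\<integral>x. poisson z x \<partial>\<sigma> e0)"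
  assume "\<not> ?thesis"
  then obtain e where e: "e > 0" "\<not> (\<forall>\<^sub>F n in sequentially. dist (Im (weyl n z)) L < e)"
    by (auto simp: tendsto_iff L_def)
  hence "infinite {n. \<not> dist (Im (weyl n z)) L < e}"
    by (simp add: eventually_cofinite[symmetric] cofinite_eq_sequentially)
  then obtain r where r: "strict_mono (r :: nat \<Rightarrow> nat)" "\<And>n. r n \<in> {n. \<not> dist (Im (weyl n z)) L < e}"
    using infinite_enumerate by blast
  have "bounded (range (\<lambda>n. weyl (r n) z))"
    using weyl_bound[OF z] by (auto simp: bounded_iff)
  then obtain m s where s: "strict_mono (s :: nat \<Rightarrow> nat)" "((\<lambda>n. weyl (r n) z) \<circ> s) \<longlonglongrightarrow> m"
    using bounded_imp_convergent_subsequence by blast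
  define k where "k = r \<circ> s"
  have k: "strict_mono k" using r(1) s(1) by (simp add: k_def strict_mono_o)
  have m: "(\<lambda>n. weyl (k n) z) \<longlonglongrightarrow> m" using s(2) by (simp add: k_def o_def)
  define u where "u j = spol b j z + m * opol b j z" for j
  have "(\<Sum>j\<le>N. (cmod (u j))\<^sup>2) \<le> (1 / Im z) / Im z" for N
  proof (rule tendsto_upperbound)
    show "(\<lambda>n. \<Sum>j\<le>N. (cmod (spol b j z + weyl (k n) z * opol b j z))\<^sup>2) \<longlonglongrightarrow> (\<Sum>j\<le>N. (cmod (u j))\<^sup>2)"
      unfolding u_def by (intro tendsto_intros m)
    have "(\<Sum>j\<le>N. (cmod (spol b j z + weyl (k n) z * opol b j z))\<^sup>2) \<le> (1 / Im z) / Im z" if "N \<le> n" for n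
    proof -
      have "(\<Sum>j\<le>N. (cmod (spol b j z + weyl (k n) z * opol b j z))\<^sup>2)
          \<le> (\<Sum>j\<le>k n. (cmod (spol b j z + weyl (k n) z * opol b j z))\<^sup>2)"
        using that seq_suble[OF k, of n] by (intro sum_mono2) auto
      moreover have "Im z * \<dots> \<le> 1 / Im z"
        using weyl_solution_bound[of z "k n"] weyl_bound[OF z, of "k n"] abs_Im_le_cmod[of "weyl (k n) z"] z
        by linarith
      hence "(\<Sum>j\<le>k n. (cmod (spol b j z + weyl (k n) z * opol b j z))\<^sup>2) \<le> (1 / Im z) / Im z"
        using z by (subst pos_le_divide_eq) (simp_all add: mult.commute)
      ultimately show ?thesis by linarith
    qed
    thus "\<forall>\<^sub>F n in sequentially. (\<Sum>j\<le>N. (cmod (spol b j z + weyl (k n) z * opol b j z))\<^sup>2) \<le> (1 / Im z) / Im z"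
      by (auto simp: eventually_at_top_linorder)
  qed simp
  hence "u \<in> ell2"
    unfolding ell2_def mem_Collect_eq
    by (intro bounded_imp_summable[of _ "(1 / Im z) / Im z"]) auto
  moreover have "A u = (\<lambda>n. z * u n + e0 n)"
    using jacobi_solution[of 1 z m] by (simp add: u_def[abs_def])
  ultimately have "L = Im m"
    using poisson_integral_of_resolvent_solution[OF z, of u] by (simp add: L_def u_def)
  hence "(\<lambda>n. Im (weyl (k n) z)) \<longlonglongrightarrow> L" using m by (auto intro: tendsto_Im)
  hence "\<forall>\<^sub>F n in sequentially. dist (Im (weyl (k n) z)) L < e" using e by (auto simp: tendsto_iff)
  then obtain n where "dist (Im (weyl (k n) z)) L < e" by (auto simp: eventually_at_top_linorder)
  thus False using r(2)[of "s n"] by (simp add: k_def)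
qed

end

section \<open>Stieltjes inversion for convergent densities\<close>

lemma poisson_le: "0 < Im z \<Longrightarrow> poisson z t \<le> 1 / Im z"
proof -
  assume z: "0 < Im z"
  have "Im z / ((t - Re z)\<^sup>2 + (Im z)\<^sup>2) \<le> Im z / (Im z)\<^sup>2"
    using z by (intro divide_left_mono mult_pos_pos add_nonneg_pos) auto
  also have "\<dots> = 1 / Im z" using z by (simp add: power2_eq_square)
  finally show ?thesis by (simp add: poisson_def)
qed

text \<open>Fubini's theorem; the inner integral over \<open>x\<close> is elementary.\<close>

lemma integral_poisson_over_interval:
  fixes \<mu> :: "real measure"
  assumes fin: "finite_measure \<mu>" and [measurable_cong]: "sets \<mu> = sets borel"
    and ab: "a \<le> b" and y: "0 < y"
  shows "(\<integral>x. (\<integral>t. poisson (Complex x y) t \<partial>\<mu>) \<partial>density lborel (\<lambda>x. ennreal (indicator {a..b} x)))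
       = (\<integral>t. arctan ((b - t) / y) - arctan ((a - t) / y) \<partial>\<mu>)"
    "integrable (density lborel (\<lambda>x. ennreal (indicator {a..b} x))) (\<lambda>x. \<integral>t. poisson (Complex x y) t \<partial>\<mu>)"
proof -
  define L where "L = density lborel (\<lambda>x. ennreal (indicator {a..b} x))"
  have [measurable_cong]: "sets L = sets borel" by (simp add: L_def)
  have L: "finite_measure L"
    unfolding L_def
    by (rule finite_measureI) (simp add: emeasure_density ennreal_indicator emeasure_lborel_Icc_eq)
  interpret \<mu>: finite_measure \<mu> by fact
  interpret L: finite_measure L by fact
  interpret P: pair_sigma_finite L \<mu> ..
  interpret Lm: finite_measure "L \<Otimes>\<^sub>M \<mu>" by (rule finite_measure_pair_measure[OF fin L])
  have [measurable]: "(\<lambda>(x, t). poisson (Complex x y) t) \<in> borel_measurable (L \<Otimes>\<^sub>M \<mu>)"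
    unfolding poisson_def by simp
  have int: "integrable (L \<Otimes>\<^sub>M \<mu>) (\<lambda>(x, t). poisson (Complex x y) t)"
  proof (rule Lm.integrable_const_bound[where B="1 / y"])
    show "AE p in L \<Otimes>\<^sub>M \<mu>. norm (case p of (x, t) \<Rightarrow> poisson (Complex x y) t) \<le> 1 / y"
      using poisson_le[of "Complex _ y"] poisson_nonneg[of "Complex _ y"] y by (auto intro!: AE_I2)
  qed simp
  have inner: "(\<integral>x. poisson (Complex x y) t \<partial>L) = arctan ((b - t) / y) - arctan ((a - t) / y)" for t
  proof -
    have "(\<integral>x. poisson (Complex x y) t \<partial>L) = (\<integral>x. (y / ((t - x)\<^sup>2 + y\<^sup>2)) * indicator {a..b} x \<partial>lborel)"
      unfolding L_def by (subst integral_density) (auto simp: poisson_def mult.commute)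
    also have "\<dots> = arctan ((b - t) / y) - arctan ((a - t) / y)"
    proof (rule integral_FTC_Icc_real[OF ab])
      fix x
      have ne: "(t - x)\<^sup>2 + y\<^sup>2 \<noteq> 0" using y by (simp add: sum_power2_eq_zero_iff)
      have "inverse (1 + ((x - t) / y)\<^sup>2) * (1 / y) = y / ((t - x)\<^sup>2 + y\<^sup>2)"
      proof -
        have "1 + ((x - t) / y)\<^sup>2 = ((t - x)\<^sup>2 + y\<^sup>2) / y\<^sup>2"
          using y by (simp add: power_divide add_divide_distrib power2_commute)
        thus ?thesis using y by (simp add: power2_eq_square[of y])
      qed
      moreover have "((\<lambda>x. arctan ((x - t) / y)) has_real_derivative inverse (1 + ((x - t) / y)\<^sup>2) * (1 / y)) (at x)"
        using y by (auto intro!: derivative_eq_intros)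
      ultimately show "((\<lambda>x. arctan ((x - t) / y)) has_real_derivative y / ((t - x)\<^sup>2 + y\<^sup>2)) (at x)" by simp
      show "isCont (\<lambda>x. y / ((t - x)\<^sup>2 + y\<^sup>2)) x"
        using ne by (intro continuous_intros) auto
    qed
    finally show ?thesis .
  qed
  show "(\<integral>x. (\<integral>t. poisson (Complex x y) t \<partial>\<mu>) \<partial>density lborel (\<lambda>x. ennreal (indicator {a..b} x)))
       = (\<integral>t. arctan ((b - t) / y) - arctan ((a - t) / y) \<partial>\<mu>)"
    using P.Fubini_integral[OF int] by (simp add: inner flip: L_def)
  show "integrable (density lborel (\<lambda>x. ennreal (indicator {a..b} x))) (\<lambda>x. \<integral>t. poisson (Complex x y) t \<partial>\<mu>)"
    using P.integrable_fst'[OF int] by (simp flip: L_def)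
qed

lemma arctan_scaled_tendsto:
  "(\<lambda>n. arctan (c / (1 / real (Suc n)))) \<longlonglongrightarrow> sgn c * (pi / 2)"
proof -
  have pos: "(\<lambda>n. arctan (c * real (Suc n))) \<longlonglongrightarrow> pi / 2" if "c > 0" for c
    by (rule filterlim_compose[OF tendsto_arctan_at_top])
      (use that in real_asymp)
  consider "c > 0" | "c = 0" | "c < 0" by linarith
  thus ?thesis
  proof cases
    case 3
    hence "(\<lambda>n. - arctan ((- c) * real (Suc n))) \<longlonglongrightarrow> - (pi / 2)"
      by (intro tendsto_minus pos) simp
    thus ?thesis using 3 by (simp add: arctan_minus)
  qed (use pos[of c] in auto)
qed

lemma stieltjes_interval_limit:
  fixes \<mu> :: "real measure"
  assumes fin: "finite_measure \<mu>" and [measurable_cong]: "sets \<mu> = sets borel" and ab: "a < b"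
  shows "(\<lambda>n. \<integral>t. arctan ((b - t) / (1 / real (Suc n))) - arctan ((a - t) / (1 / real (Suc n))) \<partial>\<mu>)
     \<longlonglongrightarrow> pi * (measure \<mu> {a<..<b} + measure \<mu> {a} / 2 + measure \<mu> {b} / 2)"
proof -
  interpret finite_measure \<mu> by fact
  define g where "g t = pi * indicator {a<..<b} t + pi / 2 * indicator {a} t + pi / 2 * indicator {b} t" for t :: real
  have sets: "{a<..<b} \<in> sets \<mu>" "{a} \<in> sets \<mu>" "{b} \<in> sets \<mu>" by (simp_all add: assms(2))
  have [measurable]: "g \<in> borel_measurable borel" unfolding g_def by measurable
  have "(\<lambda>n. \<integral>t. arctan ((b - t) / (1 / real (Suc n))) - arctan ((a - t) / (1 / real (Suc n))) \<partial>\<mu>)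
      \<longlonglongrightarrow> (\<integral>t. g t \<partial>\<mu>)"
  proof (rule integral_dominated_convergence)
    show "integrable \<mu> (\<lambda>_. pi)" by simp
    show "AE t in \<mu>. (\<lambda>n. arctan ((b - t) / (1 / real (Suc n))) - arctan ((a - t) / (1 / real (Suc n)))) \<longlonglongrightarrow> g t"
    proof (rule AE_I2)
      fix t
      have "sgn (b - t) * (pi / 2) - sgn (a - t) * (pi / 2) = g t"
        using ab by (auto simp: g_def indicator_def sgn_if)
      thus "(\<lambda>n. arctan ((b - t) / (1 / real (Suc n))) - arctan ((a - t) / (1 / real (Suc n)))) \<longlonglongrightarrow> g t"
        using tendsto_diff[OF arctan_scaled_tendsto[of "b - t"] arctan_scaled_tendsto[of "a - t"]] by simp
    qed
    show "AE t in \<mu>. norm (arctan ((b - t) / (1 / real (Suc n))) - arctan ((a - t) / (1 / real (Suc n)))) \<le> pi" for n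
    proof (rule AE_I2)
      fix t
      show "norm (arctan ((b - t) / (1 / real (Suc n))) - arctan ((a - t) / (1 / real (Suc n)))) \<le> pi"
        using arctan_bounded[of "(b - t) / (1 / real (Suc n))"] arctan_bounded[of "(a - t) / (1 / real (Suc n))"]
        by (simp only: real_norm_def abs_le_iff) linarith
    qed
  qed simp_all
  moreover have "(\<integral>t. g t \<partial>\<mu>) = pi * (measure \<mu> {a<..<b} + measure \<mu> {a} / 2 + measure \<mu> {b} / 2)"
    unfolding g_def using sets
    by (simp add: integrable_real_indicator less_top[symmetric] algebra_simps)
  ultimately show ?thesis by simp
qed

text \<open>Integrating over \<open>x\<close> turns Poisson kernels into differences of arctangents, which tend to
\<open>\<pi>\<close> inside the interval, to \<open>\<pi> / 2\<close> at its end points and to 0 outside as \<open>y\<close> tends to 0.\<close>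

lemma stieltjes_compare:
  fixes \<sigma> \<tau> :: "real measure"
  assumes fin: "finite_measure \<sigma>" "finite_measure \<tau>" "sets \<sigma> = sets borel" "sets \<tau> = sets borel"
    and ab: "a < b"
    and close: "\<And>x y. a \<le> x \<Longrightarrow> x \<le> b \<Longrightarrow> 0 < y \<Longrightarrow> y \<le> 1 \<Longrightarrow>
      \<bar>(\<integral>t. poisson (Complex x y) t \<partial>\<sigma>) - (\<integral>t. poisson (Complex x y) t \<partial>\<tau>)\<bar> \<le> C * y"
  shows "measure \<sigma> {a<..<b} + measure \<sigma> {a} / 2 + measure \<sigma> {b} / 2
       = measure \<tau> {a<..<b} + measure \<tau> {a} / 2 + measure \<tau> {b} / 2"
proof -
  define L where "L = density lborel (\<lambda>x. ennreal (indicator {a..b} x))"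
  define \<psi> where "\<psi> \<mu> n = (\<integral>t. arctan ((b - t) / (1 / real (Suc n))) - arctan ((a - t) / (1 / real (Suc n))) \<partial>\<mu>)"
    for \<mu> :: "real measure" and n
  have mL: "measure L (space L) = b - a" "finite_measure L"
    using ab by (auto simp: L_def measure_def emeasure_density ennreal_indicator space_density intro!: finite_measureI)
  interpret L: finite_measure L by fact
  have bound: "\<bar>\<psi> \<sigma> n - \<psi> \<tau> n\<bar> \<le> C * (1 / real (Suc n)) * (b - a)" for n
  proof -
    have y: "0 < 1 / real (Suc n)" "1 / real (Suc n) \<le> 1" by auto
    note S = integral_poisson_over_interval[OF fin(1,3) less_imp_le[OF ab] y(1), folded L_def]
    note T = integral_poisson_over_interval[OF fin(2,4) less_imp_le[OF ab] y(1), folded L_def]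
    define D where "D x = (\<integral>t. poisson (Complex x (1 / real (Suc n))) t \<partial>\<sigma>)
        - (\<integral>t. poisson (Complex x (1 / real (Suc n))) t \<partial>\<tau>)" for x
    have iD: "integrable L D" unfolding D_def by (intro Bochner_Integration.integrable_diff S(2) T(2))
    have "\<psi> \<sigma> n - \<psi> \<tau> n = (\<integral>x. D x \<partial>L)"
      unfolding \<psi>_def D_def S(1)[symmetric] T(1)[symmetric] using S(2) T(2)
      by (intro Bochner_Integration.integral_diff[symmetric])
    also have "\<bar>\<dots>\<bar> \<le> (\<integral>x. \<bar>D x\<bar> \<partial>L)" by (rule integral_abs_bound)
    also have "\<dots> \<le> (\<integral>x. C * (1 / real (Suc n)) \<partial>L)"
    proof (rule integral_mono_AE)
      show "AE x in L. \<bar>D x\<bar> \<le> C * (1 / real (Suc n))"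
        unfolding L_def using close[OF _ _ y]
        by (subst AE_density) (auto simp: D_def indicator_def)
    qed (use iD in simp_all)
    also have "\<dots> = C * (1 / real (Suc n)) * (b - a)" using mL(1) by simp
    finally show ?thesis .
  qed
  have "(\<lambda>n. \<psi> \<sigma> n - \<psi> \<tau> n) \<longlonglongrightarrow> 0"
  proof (rule Lim_null_comparison)
    show "\<forall>\<^sub>F n in sequentially. norm (\<psi> \<sigma> n - \<psi> \<tau> n) \<le> C * (1 / real (Suc n)) * (b - a)"
      using bound by simp
    show "(\<lambda>n. C * (1 / real (Suc n)) * (b - a)) \<longlonglongrightarrow> 0" by real_asymp
  qed
  moreover have "(\<lambda>n. \<psi> \<sigma> n - \<psi> \<tau> n) \<longlonglongrightarrow>
      pi * (measure \<sigma> {a<..<b} + measure \<sigma> {a} / 2 + measure \<sigma> {b} / 2)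
      - pi * (measure \<tau> {a<..<b} + measure \<tau> {a} / 2 + measure \<tau> {b} / 2)"
    unfolding \<psi>_def by (intro tendsto_diff stieltjes_interval_limit fin ab)
  ultimately have "pi * (measure \<sigma> {a<..<b} + measure \<sigma> {a} / 2 + measure \<sigma> {b} / 2)
      - pi * (measure \<tau> {a<..<b} + measure \<tau> {a} / 2 + measure \<tau> {b} / 2) = 0"
    using LIMSEQ_unique by blast
  thus ?thesis by simp
qed

text \<open>The measure \<open>\<sigma>\<close> is approximated by densities \<open>wn n\<close> only in the sense of Poisson integrals, but on
\<open>{c..d}\<close> these densities converge uniformly.\<close>

locale stieltjes_approximation =
  fixes \<sigma> :: "real measure" and wn :: "nat \<Rightarrow> real \<Rightarrow> real" and w :: "real \<Rightarrow> real" and c d :: real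
  assumes fin: "finite_measure \<sigma>" and sets_\<sigma> [measurable_cong]: "sets \<sigma> = sets borel"
    and wn_meas [measurable]: "\<And>n. wn n \<in> borel_measurable borel"
    and wn_nonneg: "\<And>n t. 0 \<le> wn n t"
    and wn_int: "\<And>n z. 0 < Im z \<Longrightarrow> integrable lborel (\<lambda>t. wn n t * poisson z t)"
    and wn_le: "\<And>n z. 0 < Im z \<Longrightarrow> (\<integral>t. wn n t * poisson z t \<partial>lborel) \<le> 1 / Im z"
    and lim: "\<And>z. 0 < Im z \<Longrightarrow> (\<lambda>n. \<integral>t. wn n t * poisson z t \<partial>lborel) \<longlonglongrightarrow> (\<integral>t. poisson z t \<partial>\<sigma>)"
    and unif: "uniform_limit {c..d} wn w sequentially"
    and cont: "continuous_on {c..d} w"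
begin

definition \<tau> :: "real measure" where
  "\<tau> = density lborel (\<lambda>t. ennreal (indicator {c..d} t * w t))"

lemma w_meas [measurable]: "(\<lambda>t. indicator {c..d} t * w t) \<in> borel_measurable borel"
  using borel_measurable_continuous_on_indicator[OF _ cont] by simp

lemma w_nonneg: "0 \<le> indicator {c..d} t * w t"
proof (cases "t \<in> {c..d}")
  case True
  have "(\<lambda>n. wn n t) \<longlonglongrightarrow> w t" using tendsto_uniform_limitI[OF unif True] .
  hence "0 \<le> w t" by (rule LIMSEQ_le_const) (use wn_nonneg in auto)
  thus ?thesis by simp
qed auto

lemma w_bounded: obtains W where "0 < W" "\<And>t. indicator {c..d} t * w t \<le> W"
proof -
  have "bounded (w ` {c..d})"
    by (intro compact_imp_bounded compact_continuous_image cont) simp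
  then obtain B where "\<forall>t\<in>{c..d}. \<bar>w t\<bar> \<le> B" by (auto simp: bounded_iff)
  hence "indicator {c..d} t * w t \<le> max B 1" for t
    by (cases "t \<in> {c..d}") (auto simp: le_max_iff_disj dest!: bspec[of _ _ t] intro: order_trans[OF abs_ge_self])
  thus ?thesis using that[of "max B 1"] by simp
qed

lemma sets_\<tau> [simp, measurable_cong]: "sets \<tau> = sets borel"
  by (simp add: \<tau>_def)

lemma fin_\<tau>: "finite_measure \<tau>"
proof -
  obtain W where W: "0 < W" "\<And>t. indicator {c..d} t * w t \<le> W" using w_bounded by blast
  have "emeasure \<tau> UNIV = (\<integral>\<^sup>+t. ennreal (indicator {c..d} t * w t) \<partial>lborel)"
    by (simp add: \<tau>_def emeasure_density)
  also have "\<dots> \<le> (\<integral>\<^sup>+t. ennreal W * indicator {c..d} t \<partial>lborel)"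
  proof (rule nn_integral_mono)
    fix t
    show "ennreal (indicator {c..d} t * w t) \<le> ennreal W * indicator {c..d} t"
      using W(2)[of t] by (cases "t \<in> {c..d}") (simp_all add: ennreal_leI)
  qed
  also have "\<dots> < \<infinity>" by (simp add: nn_integral_cmult_indicator ennreal_mult_less_top emeasure_lborel_Icc_eq)
  finally show ?thesis by (intro finite_measureI) (simp add: \<tau>_def)
qed

text \<open>Near \<open>x\<close> the density may be replaced by its limit. The mass outside \<open>{c..d}\<close> is controlled by
comparing the kernel at height \<open>y\<close> with the kernel at height 1, which costs a factor of order \<open>y\<close>.\<close>

lemma poisson_close:
  assumes x: "c + \<delta> \<le> x" "x \<le> d - \<delta>" and \<delta>: "0 < \<delta>" and y: "0 < y"
  shows "\<bar>(\<integral>t. poisson (Complex x y) t \<partial>\<sigma>) - (\<integral>t. poisson (Complex x y) t \<partial>\<tau>)\<bar> \<le> (1 + 1 / \<delta>\<^sup>2) * y"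
proof -
  define P where "P = poisson (Complex x y)"
  have [measurable]: "P \<in> borel_measurable borel" by (simp add: P_def)
  have P0: "0 \<le> P t" for t unfolding P_def using y by (intro poisson_nonneg) simp
  have Pint: "integrable lborel P" "(\<integral>t. P t \<partial>lborel) = pi"
    unfolding P_def using poisson_integral[of "Complex x y"] y by simp_all
  let ?I = "indicator {c..d} :: real \<Rightarrow> real"
  have wP: "integrable lborel (\<lambda>t. wn n t * P t)" for n
    unfolding P_def using y by (intro wn_int) simp
  have inP: "integrable lborel (\<lambda>t. ?I t * (wn n t * P t))" for n
    using integrable_mult_indicator[OF _ wP, of "{c..d}"] by simp
  have tail: "\<bar>(\<integral>t. wn n t * P t \<partial>lborel) - (\<integral>t. ?I t * (wn n t * P t) \<partial>lborel)\<bar> \<le> (1 + 1 / \<delta>\<^sup>2) * y" for n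
  proof -
    have "(\<integral>t. wn n t * P t \<partial>lborel) - (\<integral>t. ?I t * (wn n t * P t) \<partial>lborel)
        = (\<integral>t. wn n t * P t - ?I t * (wn n t * P t) \<partial>lborel)"
      using wP inP by simp
    also have "\<bar>\<dots>\<bar> \<le> (\<integral>t. \<bar>wn n t * P t - ?I t * (wn n t * P t)\<bar> \<partial>lborel)"
      by (rule integral_abs_bound)
    also have "\<dots> \<le> (\<integral>t. (1 + 1 / \<delta>\<^sup>2) * y * (wn n t * poisson (Complex x 1) t) \<partial>lborel)"
    proof (rule integral_mono)
      show "integrable lborel (\<lambda>t. \<bar>wn n t * P t - ?I t * (wn n t * P t)\<bar>)"
        using wP inP by simp
      show "integrable lborel (\<lambda>t. (1 + 1 / \<delta>\<^sup>2) * y * (wn n t * poisson (Complex x 1) t))"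
        using wn_int[of "Complex x 1" n] by simp
      fix t
      show "\<bar>wn n t * P t - ?I t * (wn n t * P t)\<bar> \<le> (1 + 1 / \<delta>\<^sup>2) * y * (wn n t * poisson (Complex x 1) t)"
      proof (cases "t \<in> {c..d}")
        case True
        thus ?thesis using wn_nonneg[of n t] poisson_nonneg[of "Complex x 1" t] y by simp
      next
        case False
        hence "\<delta> \<le> \<bar>t - x\<bar>" using x by auto
        hence sq: "\<delta>\<^sup>2 \<le> (t - x)\<^sup>2" using \<delta> by (metis abs_of_pos power2_abs power_mono less_imp_le)
        have pos: "0 < (t - x)\<^sup>2" using sq \<delta> by (meson less_le_trans zero_less_power)
        have "P t \<le> y / (t - x)\<^sup>2"
          unfolding P_def poisson_def using y pos by (auto intro!: divide_left_mono add_pos_nonneg mult_pos_pos)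
        also have "\<dots> = (1 + 1 / (t - x)\<^sup>2) * y * poisson (Complex x 1) t"
        proof -
          have ne: "(t - x)\<^sup>2 + 1 \<noteq> 0" using pos by linarith
          have "(1 + 1 / (t - x)\<^sup>2) = ((t - x)\<^sup>2 + 1) / (t - x)\<^sup>2"
            using pos by (simp add: add_divide_distrib)
          thus ?thesis using ne by (simp add: poisson_def)
        qed
        also have "\<dots> \<le> (1 + 1 / \<delta>\<^sup>2) * y * poisson (Complex x 1) t"
          using sq \<delta> pos y poisson_nonneg[of "Complex x 1" t]
          by (intro mult_right_mono add_left_mono divide_left_mono) auto
        finally have "wn n t * P t \<le> wn n t * ((1 + 1 / \<delta>\<^sup>2) * y * poisson (Complex x 1) t)"
          using wn_nonneg by (intro mult_left_mono)
        thus ?thesis using False wn_nonneg[of n t] P0[of t] by (simp add: mult_ac)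
      qed
    qed
    also have "\<dots> = (1 + 1 / \<delta>\<^sup>2) * y * (\<integral>t. wn n t * poisson (Complex x 1) t \<partial>lborel)" by simp
    also have "\<dots> \<le> (1 + 1 / \<delta>\<^sup>2) * y * 1"
      using wn_le[of "Complex x 1" n] y by (intro mult_left_mono) auto
    finally show ?thesis by simp
  qed
  have inside: "(\<lambda>n. \<integral>t. ?I t * (wn n t * P t) \<partial>lborel) \<longlonglongrightarrow> (\<integral>t. P t \<partial>\<tau>)"
  proof -
    obtain W where W: "0 < W" "\<And>t. indicator {c..d} t * w t \<le> W" using w_bounded by blast
    have "\<forall>\<^sub>F n in sequentially. \<forall>t\<in>{c..d}. dist (wn n t) (w t) < 1"
      using unif unfolding uniform_limit_iff by simp
    then obtain N where "\<forall>n\<ge>N. \<forall>t\<in>{c..d}. \<bar>wn n t - w t\<bar> < 1"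
      by (auto simp: eventually_at_top_linorder dist_real_def)
    hence N: "\<bar>wn n t - w t\<bar> < 1" if "N \<le> n" "t \<in> {c..d}" for n t
      using that by blast
    have "(\<lambda>n. \<integral>t. ?I t * (wn (n + N) t * P t) \<partial>lborel) \<longlonglongrightarrow> (\<integral>t. (?I t * w t) * P t \<partial>lborel)"
    proof (rule integral_dominated_convergence)
      show "integrable lborel (\<lambda>t. (W + 1) * P t)" using Pint by simp
      show "AE t in lborel. (\<lambda>n. ?I t * (wn (n + N) t * P t)) \<longlonglongrightarrow> ?I t * w t * P t"
      proof (rule AE_I2)
        fix t
        show "(\<lambda>n. ?I t * (wn (n + N) t * P t)) \<longlonglongrightarrow> ?I t * w t * P t"
        proof (cases "t \<in> {c..d}")
          case True
          have "(\<lambda>n. wn (n + N) t) \<longlonglongrightarrow> w t"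
            using tendsto_uniform_limitI[OF unif True] by (rule LIMSEQ_ignore_initial_segment)
          hence "(\<lambda>n. ?I t * (wn (n + N) t * P t)) \<longlonglongrightarrow> ?I t * (w t * P t)"
            by (intro tendsto_intros)
          thus ?thesis by (simp add: mult.assoc)
        qed simp
      qed
      show "AE t in lborel. norm (?I t * (wn (n + N) t * P t)) \<le> (W + 1) * P t" for n
      proof (rule AE_I2)
        fix t
        show "norm (?I t * (wn (n + N) t * P t)) \<le> (W + 1) * P t"
        proof (cases "t \<in> {c..d}")
          case True
          hence "wn (n + N) t \<le> W + 1" using N[of "n + N" t] W(2)[of t] by (simp add: abs_less_iff)
          thus ?thesis using True wn_nonneg[of "n + N" t] P0[of t] by (simp add: mult_right_mono)
        qed (use W P0 in auto)
      qed
    qed simp_all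
    moreover have "(\<integral>t. (?I t * w t) * P t \<partial>lborel) = (\<integral>t. P t \<partial>\<tau>)"
      unfolding \<tau>_def using w_nonneg by (subst integral_density) auto
    ultimately show ?thesis by (simp add: LIMSEQ_offset)
  qed
  have "(\<lambda>n. \<integral>t. wn n t * P t \<partial>lborel) \<longlonglongrightarrow> (\<integral>t. P t \<partial>\<sigma>)"
    unfolding P_def using y by (intro lim) simp
  from tendsto_rabs[OF tendsto_diff[OF this inside]]
  have "(\<lambda>n. \<bar>(\<integral>t. wn n t * P t \<partial>lborel) - (\<integral>t. ?I t * (wn n t * P t) \<partial>lborel)\<bar>)
      \<longlonglongrightarrow> \<bar>(\<integral>t. P t \<partial>\<sigma>) - (\<integral>t. P t \<partial>\<tau>)\<bar>" .
  hence "\<bar>(\<integral>t. P t \<partial>\<sigma>) - (\<integral>t. P t \<partial>\<tau>)\<bar> \<le> (1 + 1 / \<delta>\<^sup>2) * y"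
    by (rule LIMSEQ_le_const2) (use tail in blast)
  thus ?thesis by (simp add: P_def)
qed

lemma interval_weights_eq:
  assumes "c < a" "a < b" "b < d"
  shows "measure \<sigma> {a<..<b} + measure \<sigma> {a} / 2 + measure \<sigma> {b} / 2 = measure \<tau> {a<..<b}"
proof -
  define \<delta> where "\<delta> = min (a - c) (d - b)"
  have \<delta>: "0 < \<delta>" using assms by (simp add: \<delta>_def)
  have atom: "measure \<tau> {x} = 0" for x
  proof -
    have "AE t in lborel. t \<noteq> x" by (rule AE_lborel_singleton)
    hence "(\<integral>\<^sup>+t. ennreal (indicator {c..d} t * w t) * indicator {x} t \<partial>lborel) = (\<integral>\<^sup>+t. 0 \<partial>(lborel :: real measure))"
      by (intro nn_integral_cong_AE) (auto simp: indicator_def)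
    thus ?thesis by (simp add: \<tau>_def measure_def emeasure_density)
  qed
  have "measure \<sigma> {a<..<b} + measure \<sigma> {a} / 2 + measure \<sigma> {b} / 2
       = measure \<tau> {a<..<b} + measure \<tau> {a} / 2 + measure \<tau> {b} / 2"
  proof (rule stieltjes_compare[OF fin fin_\<tau> sets_\<sigma> sets_\<tau> assms(2)])
    fix x y :: real
    assume "a \<le> x" "x \<le> b" "0 < y" "y \<le> 1"
    moreover have "\<delta> \<le> a - c" "\<delta> \<le> d - b" by (simp_all add: \<delta>_def)
    ultimately show "\<bar>(\<integral>t. poisson (Complex x y) t \<partial>\<sigma>) - (\<integral>t. poisson (Complex x y) t \<partial>\<tau>)\<bar> \<le> (1 + 1 / \<delta>\<^sup>2) * y"
      by (intro poisson_close \<delta>) linarith+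
  qed
  thus ?thesis by (simp add: atom)
qed

text \<open>An atom of \<open>\<sigma>\<close> would give small intervals around it more mass than the bounded density allows.\<close>

lemma no_atoms:
  assumes "c < a" "a < d"
  shows "measure \<sigma> {a} = 0"
proof (rule ccontr)
  assume ne: "measure \<sigma> {a} \<noteq> 0"
  interpret finite_measure \<sigma> by (rule fin)
  have pos: "0 < measure \<sigma> {a}" using ne measure_nonneg[of \<sigma> "{a}"] by linarith
  obtain W where W: "0 < W" "\<And>t. indicator {c..d} t * w t \<le> W" using w_bounded by blast
  \<comment> \<open>The third bound makes \<open>2 * h * W\<close> at most half of the atom.\<close>
  define h where "h = min (min ((a - c) / 2) ((d - a) / 2)) (measure \<sigma> {a} / (4 * W))"
  have h: "0 < h" "c < a - h" "a + h < d" "h \<le> measure \<sigma> {a} / (4 * W)"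
  proof -
    have "h \<le> min ((a - c) / 2) ((d - a) / 2)" unfolding h_def by (rule min.cobounded1)
    hence "h \<le> (a - c) / 2" "h \<le> (d - a) / 2" unfolding min.bounded_iff by blast+
    thus "c < a - h" "a + h < d" using assms by (simp_all add: field_simps)
  qed (use assms pos W in \<open>simp_all add: h_def\<close>)
  have "measure \<sigma> {a} \<le> measure \<sigma> {a-h<..<a+h}"
    using h by (intro finite_measure_mono) (auto simp: sets_\<sigma>)
  also have "\<dots> \<le> measure \<tau> {a-h<..<a+h}"
  proof -
    have "a - h < a + h" using h(1) by simp
    from interval_weights_eq[OF h(2) this h(3)] measure_nonneg[of \<sigma> "{a-h}"] measure_nonneg[of \<sigma> "{a+h}"]
    show ?thesis by linarith
  qed
  also have "\<dots> \<le> 2 * h * W"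
  proof -
    have "emeasure \<tau> {a-h<..<a+h} = (\<integral>\<^sup>+t. ennreal (indicator {c..d} t * w t) * indicator {a-h<..<a+h} t \<partial>lborel)"
      by (simp add: \<tau>_def emeasure_density)
    also have "\<dots> \<le> (\<integral>\<^sup>+t. ennreal W * indicator {a-h<..<a+h} t \<partial>lborel)"
      using W by (intro nn_integral_mono mult_right_mono ennreal_leI) auto
    also have "\<dots> = ennreal (2 * h * W)"
      using h W by (simp add: nn_integral_cmult_indicator ennreal_mult'[symmetric] mult_ac)
    finally show ?thesis using h W by (simp add: measure_def enn2real_leI)
  qed
  also have "\<dots> \<le> measure \<sigma> {a} / 2" using h(4) W by (simp add: field_simps)
  finally show False using pos by linarith
qed

lemma emeasure_eq_inside:
  assumes cd: "c < c'" "c' < d'" "d' < d" and B: "B \<in> sets borel" "B \<subseteq> {c'<..<d'}"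
  shows "emeasure \<sigma> B = emeasure \<tau> B"
proof -
  interpret finite_measure \<sigma> by (rule fin)
  interpret \<tau>: finite_measure \<tau> by (rule fin_\<tau>)
  let ?I = "{c'<..<d'}"
  have iv: "emeasure \<sigma> {a<..<b} = emeasure \<tau> {a<..<b}" if "c < a" "b < d" for a b
  proof (cases "a < b")
    case True
    have "measure \<sigma> {a<..<b} = measure \<tau> {a<..<b}"
      using interval_weights_eq[of a b] no_atoms[of a] no_atoms[of b] that True by simp
    thus ?thesis by (simp add: emeasure_eq_measure \<tau>.emeasure_eq_measure)
  qed simp
  have em: "emeasure (density \<mu> (indicator ?I)) X = emeasure \<mu> (?I \<inter> X)"
    if "sets \<mu> = sets borel" "X \<in> sets borel" for \<mu> :: "real measure" and X
    using that by (subst emeasure_density) (auto simp: nn_integral_indicator[symmetric] indicator_inter_arith measurable_cong_sets[OF that(1) refl] simp del: nn_integral_indicator)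
  have "density \<sigma> (indicator ?I) = density \<tau> (indicator ?I)"
  proof (rule measure_eqI_lessThan)
    fix x :: real
    have "?I \<inter> {x<..} = {max c' x<..<d'}" by auto
    thus "emeasure (density \<sigma> (indicator ?I)) {x<..} = emeasure (density \<tau> (indicator ?I)) {x<..}"
      using cd by (simp add: em sets_\<sigma> iv)
    show "emeasure (density \<sigma> (indicator ?I)) {x<..} < \<infinity>"
      by (simp add: em sets_\<sigma> less_top[symmetric])
  qed (simp_all add: sets_\<sigma>)
  hence "emeasure (density \<sigma> (indicator ?I)) B = emeasure (density \<tau> (indicator ?I)) B" by simp
  moreover have "?I \<inter> B = B" using B by auto
  ultimately show ?thesis using B by (simp add: em sets_\<sigma>)
qed

text \<open>On the inner interval \<open>\<sigma>\<close> has the density \<open>w\<close>, so the singular part vanishes there and \<open>f = w\<close> almost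
everywhere; continuity of both functions gives equality at every point.\<close>

theorem ac_density_eq:
  assumes ac: "is_ac_density \<sigma> f" and fc: "continuous_on {c..d} f" and x0: "c < x0" "x0 < d"
  shows "f x0 = w x0"
proof -
  define c' d' where "c' = (c + x0) / 2" and "d' = (d + x0) / 2"
  have cd: "c < c'" "c' < d'" "d' < d" and x0': "x0 \<in> {c'<..<d'}"
    using x0 by (auto simp: c'_def d'_def)
  let ?I = "{c'<..<d'}"
  obtain \<sigma>\<^sub>s N where f[measurable]: "f \<in> borel_measurable borel" and fn: "AE x in lborel. 0 \<le> f x"
    and s: "sets \<sigma>\<^sub>s = sets borel" and N[measurable]: "N \<in> sets borel" "emeasure lborel N = 0" "emeasure \<sigma>\<^sub>s (- N) = 0"
    and dec: "\<And>B. B \<in> sets borel \<Longrightarrow>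
       emeasure \<sigma> B = emeasure (density lborel (\<lambda>x. ennreal (f x))) B + emeasure \<sigma>\<^sub>s B"
    using ac unfolding is_ac_density_def by blast
  have s0: "emeasure \<sigma>\<^sub>s B = 0" if B: "B \<in> sets borel" "B \<subseteq> ?I" for B
  proof -
    have "emeasure \<sigma>\<^sub>s (B \<inter> N) \<le> emeasure \<sigma> (B \<inter> N)" using dec[of "B \<inter> N"] B by simp
    also have "\<dots> = emeasure \<tau> (B \<inter> N)" using B by (intro emeasure_eq_inside[OF cd]) auto
    also have "\<dots> = 0"
    proof -
      have "AE x in lborel. x \<notin> N" using N by (intro AE_I[of _ _ N]) auto
      hence "(\<integral>\<^sup>+t. ennreal (indicator {c..d} t * w t) * indicator (B \<inter> N) t \<partial>lborel) = (\<integral>\<^sup>+t. 0 \<partial>(lborel :: real measure))"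
        by (intro nn_integral_cong_AE) (auto simp: indicator_def elim: eventually_mono)
      thus ?thesis using B by (simp add: \<tau>_def emeasure_density)
    qed
    finally have z: "emeasure \<sigma>\<^sub>s (B \<inter> N) = 0" by simp
    have "emeasure \<sigma>\<^sub>s B \<le> emeasure \<sigma>\<^sub>s ((B \<inter> N) \<union> - N)"
      using B s by (intro emeasure_mono) auto
    also have "\<dots> \<le> emeasure \<sigma>\<^sub>s (B \<inter> N) + emeasure \<sigma>\<^sub>s (- N)"
      using B s by (intro emeasure_subadditive) auto
    finally show ?thesis using z N(3) by simp
  qed
  have "density lborel (\<lambda>x. ennreal (f x) * indicator ?I x)
      = density lborel (\<lambda>x. ennreal (indicator {c..d} x * w x) * indicator ?I x)"
  proof (rule measure_eqI)
    fix B assume "B \<in> sets (density lborel (\<lambda>x. ennreal (f x) * indicator ?I x))"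
    hence B: "B \<in> sets borel" by simp
    have "emeasure (density lborel (\<lambda>x. ennreal (f x) * indicator ?I x)) B
        = emeasure (density lborel (\<lambda>x. ennreal (f x))) (?I \<inter> B)"
      using B by (simp add: emeasure_density indicator_inter_arith mult.assoc)
    also have "\<dots> = emeasure \<sigma> (?I \<inter> B)" using dec[of "?I \<inter> B"] s0[of "?I \<inter> B"] B by simp
    also have "\<dots> = emeasure \<tau> (?I \<inter> B)" using B by (intro emeasure_eq_inside[OF cd]) auto
    also have "\<dots> = emeasure (density lborel (\<lambda>x. ennreal (indicator {c..d} x * w x) * indicator ?I x)) B"
      using B by (simp add: \<tau>_def emeasure_density indicator_inter_arith mult.assoc)
    finally show "emeasure (density lborel (\<lambda>x. ennreal (f x) * indicator ?I x)) B = \<dots>" .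
  qed simp
  hence "AE x in lborel. ennreal (f x) * indicator ?I x = ennreal (indicator {c..d} x * w x) * indicator ?I x"
    by (intro sigma_finite_measure.density_unique[OF sigma_finite_lborel]) auto
  hence ae: "AE x in lborel. x \<in> ?I \<longrightarrow> f x = w x"
    using fn
  proof eventually_elim
    case (elim x)
    show ?case
    proof
      assume x: "x \<in> ?I"
      hence "x \<in> {c..d}" using cd by auto
      thus "f x = w x" using elim x w_nonneg[of x] by simp
    qed
  qed
  define C where "C = {x \<in> {c'..d'}. f x - w x = 0}"
  have "continuous_on {c'..d'} (\<lambda>x. f x - w x)"
    using cd by (intro continuous_intros continuous_on_subset[OF fc] continuous_on_subset[OF cont]) auto
  hence "closed C"
    unfolding C_def using continuous_closed_preimage_constant[of "{c'..d'}" "\<lambda>x. f x - w x" 0] by simp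
  moreover have "AE x in lebesgue. x \<in> ?I \<longrightarrow> x \<in> C"
    using AE_completion[OF ae] by eventually_elim (auto simp: C_def)
  ultimately have "x0 \<in> C"
    using mem_closed_if_AE_lebesgue_open[of ?I C x0] x0' by auto
  thus ?thesis by (simp add: C_def)
qed

end

section \<open>Energy of a discrete Hamiltonian system\<close>

text \<open>For constant \<open>g\<close> this map conserves the quadratic form \<open>s\<^sup>2 / g + g t\<^sup>2 - (x / g) s t\<close>. Everything below
quantifies the effect of a slowly growing concave \<open>g\<close>.\<close>

locale discrete_hamiltonian =
  fixes g :: "nat \<Rightarrow> real" and x :: real and s t :: "nat \<Rightarrow> real"
  assumes x_pos: "0 < x"
    and g_pos: "\<And>k. 1 \<le> k \<Longrightarrow> 0 < g k"
    and g_mono: "\<And>k. 1 \<le> k \<Longrightarrow> g k \<le> g (Suc k)"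
    and g_concave: "\<And>k. 1 \<le> k \<Longrightarrow> g (Suc (Suc k)) - g (Suc k) \<le> g (Suc k) - g k"
    and s_Suc: "\<And>k. 1 \<le> k \<Longrightarrow> s (Suc k) = s k - x * t k"
    and t_Suc: "\<And>k. 1 \<le> k \<Longrightarrow> t (Suc k) = t k + x * s (Suc k) / (g (Suc k))\<^sup>2"
begin

definition H :: "nat \<Rightarrow> real" where "H k = (s k)\<^sup>2 / g k + g k * (t k)\<^sup>2"

definition d :: "nat \<Rightarrow> real" where "d k = g (Suc k) - g k"

definition r :: "nat \<Rightarrow> real" where "r k = d k / g k"

text \<open>The term \<open>- x / g\<close> makes the form invariant when \<open>g\<close> is constant. The term \<open>d / x\<close> compensates the first-order
change \<open>d (t\<^sup>2 - s\<^sup>2 / g\<^sup>2)\<close> of the energy, which oscillates and is not absolutely summable.\<close>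

definition \<kappa> :: "nat \<Rightarrow> real" where "\<kappa> k = d k / x - x / g k"

definition F :: "nat \<Rightarrow> real" where "F k = H k + \<kappa> k * s k * t k"

text \<open>Chosen so that its decrements bound the relative change of the corrected energy in one step.\<close>

definition \<eta> :: "nat \<Rightarrow> real" where "\<eta> k = (d k / x + x / g k) / 2 + r k"

lemma d_nonneg: "1 \<le> k \<Longrightarrow> 0 \<le> d k"
  using g_mono by (simp add: d_def)

lemma d_antimono: "1 \<le> k \<Longrightarrow> d (Suc k) \<le> d k"
  using g_concave by (simp add: d_def)

lemma r_antimono: "1 \<le> k \<Longrightarrow> r (Suc k) \<le> r k"
  unfolding r_def using g_pos[of k] g_mono[of k] d_nonneg[of "Suc k"] d_antimono[of k]
  by (intro frac_le) auto

lemma inverse_g_antimono: "1 \<le> k \<Longrightarrow> x / g (Suc k) \<le> x / g k"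
  using g_pos[of k] g_mono[of k] x_pos by (intro divide_left_mono) auto

lemma \<eta>_nonneg: "1 \<le> k \<Longrightarrow> 0 \<le> \<eta> k"
  using g_pos[of k] d_nonneg[of k] x_pos by (auto simp: \<eta>_def r_def intro!: add_nonneg_nonneg)

lemma \<eta>_diff:
  "\<eta> k - \<eta> (Suc k) = ((d k - d (Suc k)) / x + (x / g k - x / g (Suc k))) / 2 + (r k - r (Suc k))"
  by (simp add: \<eta>_def diff_divide_distrib add_divide_distrib)

lemma \<eta>_antimono:
  assumes "1 \<le> k"
  shows "\<eta> (Suc k) \<le> \<eta> k"
proof -
  have "0 \<le> (d k - d (Suc k)) / x" using d_antimono[OF assms] x_pos by simp
  hence "0 \<le> ((d k - d (Suc k)) / x + (x / g k - x / g (Suc k))) / 2 + (r k - r (Suc k))"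
    using r_antimono[OF assms] inverse_g_antimono[OF assms] d_antimono[OF assms] x_pos
    by (intro add_nonneg_nonneg divide_nonneg_nonneg) auto
  thus ?thesis by (simp flip: \<eta>_diff)
qed

lemma H_nonneg: "1 \<le> k \<Longrightarrow> 0 \<le> H k"
  using g_pos[of k] by (simp add: H_def)

lemma st_le_H:
  assumes "1 \<le> k"
  shows "2 * \<bar>s k * t k\<bar> \<le> H k"
proof -
  have g: "0 < g k" using g_pos assms by simp
  have "0 \<le> (\<bar>s k\<bar> / sqrt (g k) - sqrt (g k) * \<bar>t k\<bar>)\<^sup>2" by simp
  also have "\<dots> = H k - 2 * \<bar>s k * t k\<bar>"
    using g by (simp add: power2_diff power_divide power_mult_distrib H_def abs_mult)
  finally show ?thesis by simp
qed

lemma F_close: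
  assumes "1 \<le> k"
  shows "\<bar>F k - H k\<bar> \<le> \<eta> k * H k"
proof -
  have g: "0 < g k" using g_pos assms by simp
  have "\<bar>F k - H k\<bar> = \<bar>\<kappa> k\<bar> * \<bar>s k * t k\<bar>" by (simp add: F_def abs_mult)
  also have "\<dots> \<le> (d k / x + x / g k) * (H k / 2)"
  proof (rule mult_mono)
    show "\<bar>\<kappa> k\<bar> \<le> d k / x + x / g k"
      using d_nonneg[OF assms] x_pos g by (simp add: \<kappa>_def abs_le_iff)
    show "\<bar>s k * t k\<bar> \<le> H k / 2" using st_le_H[OF assms] by simp
    show "0 \<le> d k / x + x / g k" using d_nonneg[OF assms] x_pos g by simp
  qed simp
  also have "\<dots> \<le> \<eta> k * H k"
  proof -
    have "0 \<le> r k * H k" using d_nonneg[OF assms] g H_nonneg[OF assms] by (simp add: r_def)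
    moreover have "\<eta> k * H k = (d k / x + x / g k) * (H k / 2) + r k * H k"
      unfolding \<eta>_def by (simp only: distrib_right times_divide_eq_left times_divide_eq_right)
    ultimately show ?thesis by linarith
  qed
  finally show ?thesis .
qed

text \<open>An exact identity. The choice of \<open>\<kappa>\<close> annihilates the coefficient of \<open>t\<^sup>2\<close>, and what remains consists of
decrements of monotone sequences only, so that the total variation is bounded by telescoping.\<close>

lemma F_step:
  assumes k: "1 \<le> k"
  shows "F (Suc k) - F k = - ((s (Suc k))\<^sup>2 / g (Suc k)) * (r k - r (Suc k))
     - t k * s (Suc k) * ((d k - d (Suc k)) / x + (x / g k - x / g (Suc k)))"
proof -
  define a b c where "a = g k" and "b = g (Suc k)" and "c = g (Suc (Suc k))"
  define S T where "S = s (Suc k)" and "T = t k"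
  have pos: "a \<noteq> 0" "b \<noteq> 0" "x \<noteq> 0"
    using g_pos[of k] g_pos[of "Suc k"] k x_pos by (auto simp: a_def b_def)
  have s: "s k = S + x * T" using s_Suc[OF k] by (simp add: S_def T_def)
  have t: "t (Suc k) = T + x * S / b\<^sup>2" using t_Suc[OF k] by (simp add: S_def T_def b_def)
  have Fk: "F k = S\<^sup>2 / a + T * S * (2 * x / a + \<kappa> k) + T\<^sup>2 * (x\<^sup>2 / a + a + \<kappa> k * x)"
    unfolding F_def H_def s using pos by (simp add: T_def[symmetric] a_def[symmetric] field_simps power2_eq_square)
  have Fk': "F (Suc k) = S\<^sup>2 / b + b * T\<^sup>2 + 2 * x * T * S / b + x\<^sup>2 * S\<^sup>2 / b ^ 3 + \<kappa> (Suc k) * (T * S + x * S\<^sup>2 / b\<^sup>2)"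
    unfolding F_def H_def t using pos
    by (simp add: S_def[symmetric] b_def[symmetric] field_simps power2_eq_square power3_eq_cube)
  have \<kappa>: "\<kappa> k = (b - a) / x - x / a" "\<kappa> (Suc k) = (c - b) / x - x / b"
    by (simp_all add: \<kappa>_def d_def a_def b_def c_def)
  have dr: "d k = b - a" "d (Suc k) = c - b" "r k = (b - a) / a" "r (Suc k) = (c - b) / b"
    by (simp_all add: d_def r_def a_def b_def c_def)
  show ?thesis
    unfolding Fk Fk' \<kappa> dr a_def[symmetric] b_def[symmetric] S_def[symmetric] T_def[symmetric]
    using pos by (simp add: field_simps power2_eq_square power3_eq_cube)
qed

lemma \<eta>_bounds:
  assumes "1 \<le> k" "\<eta> k \<le> 1 / 8"
  shows "x / g k \<le> 1 / 4"
proof -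
  have "0 \<le> d k / x" "0 \<le> r k"
    using g_pos[of k] d_nonneg[of k] x_pos assms(1) by (simp_all add: r_def)
  moreover have "B \<le> 1 / 4" if "e = (A + B) / 2 + C" "0 \<le> A" "0 \<le> C" "e \<le> 1 / 8" for A B C e :: real
    using that by argo
  ultimately show ?thesis using \<eta>_def[of k] assms(2) by blast
qed

lemma F_bounds:
  assumes "1 \<le> k" "\<eta> k \<le> 1 / 8"
  shows "(1 - \<eta> k) * H k \<le> F k" "F k \<le> (1 + \<eta> k) * H k" "H k \<le> 2 * F k"
proof -
  show 1: "(1 - \<eta> k) * H k \<le> F k" and "F k \<le> (1 + \<eta> k) * H k"
    using F_close[OF assms(1)] by (auto simp: abs_le_iff algebra_simps)
  have "1 / 2 * H k \<le> (1 - \<eta> k) * H k"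
    using assms H_nonneg[of k] by (intro mult_right_mono) auto
  thus "H k \<le> 2 * F k" using 1 by linarith
qed

lemma F_step_bound:
  assumes k: "1 \<le> k" and \<eta>: "\<eta> k \<le> 1 / 8"
  shows "\<bar>F (Suc k) - F k\<bar> \<le> 4 * (\<eta> k - \<eta> (Suc k)) * F (Suc k)"
proof -
  have \<eta>': "\<eta> (Suc k) \<le> 1 / 8" using \<eta>_antimono[OF k] \<eta> by linarith
  have g: "0 < g (Suc k)" using g_pos[of "Suc k"] by simp
  define e1 e2 where "e1 = r k - r (Suc k)" and "e2 = (d k - d (Suc k)) / x + (x / g k - x / g (Suc k))"
  have e: "0 \<le> e1" "0 \<le> e2"
    using r_antimono[OF k] d_antimono[OF k] inverse_g_antimono[OF k] x_pos by (auto simp: e1_def e2_def)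
  have s2: "(s (Suc k))\<^sup>2 / g (Suc k) \<le> H (Suc k)" using g by (simp add: H_def)
  \<comment> \<open>Expressing \<open>t k\<close> through \<open>t (Suc k)\<close> makes both factors refer to the same index.\<close>
  have ts: "\<bar>t k * s (Suc k)\<bar> \<le> H (Suc k)"
  proof -
    have "t k * s (Suc k) = s (Suc k) * t (Suc k) - x / g (Suc k) * ((s (Suc k))\<^sup>2 / g (Suc k))"
      using t_Suc[OF k] g by (simp add: power2_eq_square algebra_simps)
    hence "\<bar>t k * s (Suc k)\<bar> \<le> \<bar>s (Suc k) * t (Suc k)\<bar> + \<bar>x / g (Suc k) * ((s (Suc k))\<^sup>2 / g (Suc k))\<bar>"
      by linarith
    also have "\<bar>x / g (Suc k) * ((s (Suc k))\<^sup>2 / g (Suc k))\<bar> = x / g (Suc k) * ((s (Suc k))\<^sup>2 / g (Suc k))"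
      using x_pos g by simp
    also have "\<dots> \<le> 1 / 4 * H (Suc k)"
      using \<eta>_bounds[OF _ \<eta>'] s2 g x_pos by (intro mult_mono) auto
    finally show ?thesis using st_le_H[of "Suc k"] H_nonneg[of "Suc k"] by linarith
  qed
  have "\<bar>F (Suc k) - F k\<bar> \<le> (s (Suc k))\<^sup>2 / g (Suc k) * e1 + \<bar>t k * s (Suc k)\<bar> * e2"
  proof -
    have "F (Suc k) - F k = - ((s (Suc k))\<^sup>2 / g (Suc k) * e1) - t k * s (Suc k) * e2"
      using F_step[OF k] by (simp add: e1_def e2_def)
    moreover have "\<bar>(s (Suc k))\<^sup>2 / g (Suc k) * e1\<bar> = (s (Suc k))\<^sup>2 / g (Suc k) * e1"
      using e g by simp
    moreover have "\<bar>t k * s (Suc k) * e2\<bar> = \<bar>t k * s (Suc k)\<bar> * e2" using e by (simp add: abs_mult)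
    ultimately show ?thesis by linarith
  qed
  also have "\<dots> \<le> H (Suc k) * e1 + H (Suc k) * e2"
    using s2 ts e by (intro add_mono mult_right_mono)
  also have "\<dots> \<le> 2 * H (Suc k) * (\<eta> k - \<eta> (Suc k))"
  proof -
    have "\<eta> k - \<eta> (Suc k) = e2 / 2 + e1" unfolding \<eta>_diff e1_def e2_def ..
    thus ?thesis using mult_nonneg_nonneg[OF H_nonneg[of "Suc k"] e(1)] by (simp add: algebra_simps)
  qed
  also have "\<dots> \<le> 2 * (2 * F (Suc k)) * (\<eta> k - \<eta> (Suc k))"
    using F_bounds(3)[OF _ \<eta>'] \<eta>_antimono[OF k] by (intro mult_right_mono mult_left_mono) auto
  finally show ?thesis by (simp add: algebra_simps)
qed

context
  fixes K :: nat
  assumes K: "1 \<le> K" "\<eta> K \<le> 1 / 8" and \<eta>_lim: "\<eta> \<longlonglongrightarrow> 0"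
    and H_pos: "\<And>k. K \<le> k \<Longrightarrow> 0 < H k"
begin

lemma \<eta>_le: "K \<le> k \<Longrightarrow> \<eta> k \<le> 1 / 8"
proof (induction rule: dec_induct)
  case (step n)
  thus ?case using \<eta>_antimono[of n] K by simp
qed (use K in simp)

lemma F_pos: "K \<le> k \<Longrightarrow> 0 < F k"
  using F_bounds(3)[of k] \<eta>_le[of k] H_pos[of k] K by simp

lemma F_exp_mono:
  assumes "K \<le> k"
  shows "F (Suc k) * exp (8 * \<eta> (Suc k)) \<le> F k * exp (8 * \<eta> k)"
    "F k * exp (- 8 * \<eta> k) \<le> F (Suc k) * exp (- 8 * \<eta> (Suc k))"
proof -
  define \<Delta> where "\<Delta> = \<eta> k - \<eta> (Suc k)"
  have k: "1 \<le> k" using assms K by simp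
  have \<Delta>: "0 \<le> \<Delta>" "4 * \<Delta> \<le> 1 / 2"
    using \<eta>_antimono[OF k] \<eta>_le[OF assms] \<eta>_nonneg[of "Suc k"] by (auto simp: \<Delta>_def)
  have F: "0 < F (Suc k)" using F_pos assms by simp
  have "\<bar>F (Suc k) - F k\<bar> \<le> 4 * \<Delta> * F (Suc k)"
    using F_step_bound[OF k \<eta>_le[OF assms]] by (simp add: \<Delta>_def)
  hence *: "F (Suc k) * (1 - 4 * \<Delta>) \<le> F k" "F k \<le> F (Suc k) * (1 + 4 * \<Delta>)"
    by (auto simp: abs_le_iff algebra_simps)
  \<comment> \<open>This needs \<open>4 * \<Delta> \<le> 1 / 2\<close>, the reason for the threshold \<open>1 / 8\<close> on \<open>\<eta>\<close>.\<close>
  have "exp (- (8 * \<Delta>)) \<le> 1 - 4 * \<Delta>"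
  proof -
    have "1 + 8 * \<Delta> \<le> exp (8 * \<Delta>)" by (rule exp_ge_add_one_self)
    hence "exp (- (8 * \<Delta>)) \<le> 1 / (1 + 8 * \<Delta>)"
      using \<Delta> by (simp add: exp_minus field_simps)
    also have "\<dots> \<le> 1 - 4 * \<Delta>"
    proof -
      have "1 \<le> (1 - 4 * \<Delta>) * (1 + 8 * \<Delta>)"
        using mult_nonneg_nonneg[of \<Delta> "1/2 - 4 * \<Delta>"] \<Delta> by (simp add: algebra_simps)
      thus ?thesis using \<Delta> by (simp add: field_simps)
    qed
    finally show ?thesis .
  qed
  hence "F (Suc k) * exp (- (8 * \<Delta>)) \<le> F (Suc k) * (1 - 4 * \<Delta>)" using F by simp
  hence "F (Suc k) * exp (- (8 * \<Delta>)) * exp (8 * \<eta> k) \<le> F k * exp (8 * \<eta> k)"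
    using * by (intro mult_right_mono) auto
  moreover have "exp (- (8 * \<Delta>)) * exp (8 * \<eta> k) = exp (8 * \<eta> (Suc k))"
    by (simp add: \<Delta>_def flip: exp_add)
  ultimately show "F (Suc k) * exp (8 * \<eta> (Suc k)) \<le> F k * exp (8 * \<eta> k)" by (simp add: mult.assoc)
  have "1 + 4 * \<Delta> \<le> exp (8 * \<Delta>)" using exp_ge_add_one_self[of "8 * \<Delta>"] \<Delta> by linarith
  hence "F (Suc k) * (1 + 4 * \<Delta>) \<le> F (Suc k) * exp (8 * \<Delta>)" using F by simp
  hence "F k * exp (- 8 * \<eta> k) \<le> F (Suc k) * exp (8 * \<Delta>) * exp (- 8 * \<eta> k)"
    using * by (intro mult_right_mono) auto
  moreover have "exp (8 * \<Delta>) * exp (- 8 * \<eta> k) = exp (- 8 * \<eta> (Suc k))"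
    by (simp add: \<Delta>_def flip: exp_add)
  ultimately show "F k * exp (- 8 * \<eta> k) \<le> F (Suc k) * exp (- 8 * \<eta> (Suc k))" by (simp only: mult.assoc)
qed

lemma H_exp_bounds:
  assumes "K \<le> k"
  shows "H k \<le> F k * exp (2 * \<eta> k)" "F k \<le> H k * exp (2 * \<eta> k)"
proof -
  have k: "1 \<le> k" using assms K by simp
  note \<eta> = \<eta>_nonneg[OF k] \<eta>_le[OF assms]
  have H: "0 < H k" using H_pos assms .
  have "H k = (1 - \<eta> k) * H k * (1 / (1 - \<eta> k))" using \<eta> by simp
  also have "\<dots> \<le> F k * exp (2 * \<eta> k)"
  proof (rule mult_mono)
    have "1 \<le> (1 - \<eta> k) * (1 + 2 * \<eta> k)"
      using mult_nonneg_nonneg[of "\<eta> k" "1 - 2 * \<eta> k"] \<eta> by (simp add: algebra_simps)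
    hence "1 / (1 - \<eta> k) \<le> 1 + 2 * \<eta> k" using \<eta> by (simp add: field_simps)
    also have "\<dots> \<le> exp (2 * \<eta> k)" by (rule exp_ge_add_one_self)
    finally show "1 / (1 - \<eta> k) \<le> exp (2 * \<eta> k)" .
    show "0 \<le> F k" using F_pos[OF assms] by simp
  qed (use F_bounds(1)[OF k \<eta>(2)] \<eta> in auto)
  finally show "H k \<le> F k * exp (2 * \<eta> k)" .
  have "F k \<le> H k * (1 + \<eta> k)" using F_bounds(2)[OF k \<eta>(2)] by (simp add: mult.commute)
  also have "\<dots> \<le> H k * exp (2 * \<eta> k)"
  proof (rule mult_left_mono)
    show "1 + \<eta> k \<le> exp (2 * \<eta> k)" using exp_ge_add_one_self[of "2 * \<eta> k"] \<eta> by linarith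
  qed (use H in simp)
  finally show "F k \<le> H k * exp (2 * \<eta> k)" .
qed

text \<open>The corrected energy times \<open>exp (8 \<eta> k)\<close> decreases, and times \<open>exp (- 8 \<eta> k)\<close> it increases. Hence it
converges and stays within these factors of its limit. The uncorrected energy differs from it by a factor at most \<open>exp (2 \<eta> k)\<close>.\<close>

theorem energy_limit:
  obtains G where "0 < G" "H \<longlonglongrightarrow> G"
    "\<And>k. K \<le> k \<Longrightarrow> G \<le> H k * exp (10 * \<eta> k) \<and> H k \<le> G * exp (10 * \<eta> k)"
proof -
  define U where "U k = F (K + k) * exp (8 * \<eta> (K + k))" for k
  have "decseq U" by (intro decseq_SucI) (simp add: U_def F_exp_mono)
  moreover have "0 \<le> U k" for k using F_pos[of "K + k"] by (simp add: U_def)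
  ultimately obtain G where G: "U \<longlonglongrightarrow> G" "\<And>k. G \<le> U k"
    using decseq_convergent[of U 0] by blast
  have \<eta>0: "(\<lambda>k. \<eta> (K + k)) \<longlonglongrightarrow> 0"
    using LIMSEQ_ignore_initial_segment[OF \<eta>_lim, of K] by (simp add: add.commute)
  have "(\<lambda>k. U k * exp (- 8 * \<eta> (K + k))) \<longlonglongrightarrow> G * exp (- 8 * 0)"
    by (intro tendsto_intros G \<eta>0)
  moreover have "U k * exp (- 8 * \<eta> (K + k)) = F (K + k)" for k
    by (simp add: U_def mult.assoc flip: exp_add)
  ultimately have Flim: "(\<lambda>k. F (K + k)) \<longlonglongrightarrow> G" by simp
  have up: "G \<le> F k * exp (8 * \<eta> k)" if "K \<le> k" for k
    using G(2)[of "k - K"] that by (simp add: U_def)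
  have inc: "incseq (\<lambda>k. F (K + k) * exp (- 8 * \<eta> (K + k)))"
    using F_exp_mono(2) by (intro incseq_SucI) simp
  have lim2: "(\<lambda>k. F (K + k) * exp (- 8 * \<eta> (K + k))) \<longlonglongrightarrow> G * exp (- 8 * 0)"
    by (intro tendsto_intros Flim \<eta>0)
  have lo: "F k * exp (- 8 * \<eta> k) \<le> G" if "K \<le> k" for k
    using incseq_le[OF inc lim2, of "k - K"] that by simp
  have Gpos: "0 < G"
    using lo[of K] F_pos[of K] by (smt (verit) exp_gt_zero mult_pos_pos order_refl)
  have bounds: "G \<le> H k * exp (10 * \<eta> k) \<and> H k \<le> G * exp (10 * \<eta> k)" if "K \<le> k" for k
  proof
    have "G \<le> H k * exp (2 * \<eta> k) * exp (8 * \<eta> k)"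
      using up[OF that] H_exp_bounds(2)[OF that] by (meson exp_ge_zero mult_right_mono order_trans)
    thus "G \<le> H k * exp (10 * \<eta> k)" by (simp add: mult.assoc flip: exp_add)
    have "F k * exp (- 8 * \<eta> k) * exp (8 * \<eta> k) \<le> G * exp (8 * \<eta> k)"
      using lo[OF that] by (intro mult_right_mono) auto
    hence "F k \<le> G * exp (8 * \<eta> k)" by (simp add: mult.assoc flip: exp_add)
    hence "F k * exp (2 * \<eta> k) \<le> G * exp (8 * \<eta> k) * exp (2 * \<eta> k)"
      by (intro mult_right_mono) auto
    thus "H k \<le> G * exp (10 * \<eta> k)"
      using H_exp_bounds(1)[OF that] by (simp add: mult.assoc flip: exp_add)
  qed
  have "(\<lambda>k. H (K + k)) \<longlonglongrightarrow> G"
  proof (rule tendsto_sandwich[where f="\<lambda>k. G * exp (- 10 * \<eta> (K + k))" and h="\<lambda>k. G * exp (10 * \<eta> (K + k))"])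
    show "(\<lambda>k. G * exp (10 * \<eta> (K + k))) \<longlonglongrightarrow> G"
      by (rule tendsto_eq_intros \<eta>0 refl | simp)+
    show "(\<lambda>k. G * exp (- 10 * \<eta> (K + k))) \<longlonglongrightarrow> G"
      by (rule tendsto_eq_intros \<eta>0 refl | simp)+
    show "\<forall>\<^sub>F k in sequentially. H (K + k) \<le> G * exp (10 * \<eta> (K + k))" using bounds by simp
    have "G * exp (- 10 * \<eta> (K + k)) \<le> H (K + k)" for k
    proof -
      have "G * exp (- 10 * \<eta> (K + k)) \<le> H (K + k) * exp (10 * \<eta> (K + k)) * exp (- 10 * \<eta> (K + k))"
        using bounds[of "K + k"] by (intro mult_right_mono) auto
      thus ?thesis by (simp add: mult.assoc flip: exp_add)
    qed
    thus "\<forall>\<^sub>F k in sequentially. G * exp (- 10 * \<eta> (K + k)) \<le> H (K + k)" by simp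
  qed
  hence "H \<longlonglongrightarrow> G" using LIMSEQ_offset[of H K G] by (simp add: add.commute)
  thus ?thesis using that Gpos bounds by blast
qed

end

end

section \<open>Expansion in powers of the spectral parameter\<close>

lemma stolz_cesaro:
  fixes a b :: "nat \<Rightarrow> real"
  assumes mono: "\<And>n. b n < b (Suc n)" and top: "filterlim b at_top sequentially"
    and lim: "(\<lambda>n. (a (Suc n) - a n) / (b (Suc n) - b n)) \<longlonglongrightarrow> L"
  shows "(\<lambda>n. a n / b n) \<longlonglongrightarrow> L"
proof -
  define c where "c n = a n - L * b n" for n
  have "(\<lambda>n. c n / b n) \<longlonglongrightarrow> 0"
  proof (rule LIMSEQ_I)
    fix e :: real assume e: "0 < e"
    hence "\<forall>\<^sub>F n in sequentially. dist ((a (Suc n) - a n) / (b (Suc n) - b n)) L < e / 4"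
      by (intro tendstoD[OF lim]) simp
    then obtain N where N: "\<And>n. N \<le> n \<Longrightarrow> \<bar>(a (Suc n) - a n) / (b (Suc n) - b n) - L\<bar> < e / 4"
      by (auto simp: eventually_at_top_linorder dist_real_def)
    have step: "\<bar>c (Suc n) - c n\<bar> \<le> e / 4 * (b (Suc n) - b n)" if "N \<le> n" for n
    proof -
      have pos: "0 < b (Suc n) - b n" using mono[of n] by simp
      have "c (Suc n) - c n = (a (Suc n) - a n) - L * (b (Suc n) - b n)"
        by (simp add: c_def algebra_simps)
      also have "\<dots> = ((a (Suc n) - a n) / (b (Suc n) - b n) - L) * (b (Suc n) - b n)"
        using pos by (subst left_diff_distrib) simp
      finally have "\<bar>c (Suc n) - c n\<bar> = \<bar>(a (Suc n) - a n) / (b (Suc n) - b n) - L\<bar> * (b (Suc n) - b n)"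
        using pos by (simp add: abs_mult)
      also have "\<dots> \<le> e / 4 * (b (Suc n) - b n)"
        using N[OF that] pos by (intro mult_right_mono) auto
      finally show ?thesis .
    qed
    have total: "\<bar>c n - c N\<bar> \<le> e / 4 * (b n - b N)" if "N \<le> n" for n
      using that
    proof (induction rule: dec_induct)
      case (step n)
      have "\<bar>c (Suc n) - c N\<bar> \<le> \<bar>c (Suc n) - c n\<bar> + \<bar>c n - c N\<bar>" by linarith
      also have "\<dots> \<le> e / 4 * (b (Suc n) - b n) + e / 4 * (b n - b N)"
        using step.IH \<open>N \<le> n\<close> \<open>\<And>n. N \<le> n \<Longrightarrow> \<bar>c (Suc n) - c n\<bar> \<le> e / 4 * (b (Suc n) - b n)\<close>
        by (intro add_mono) auto
      also have "\<dots> = e / 4 * (b (Suc n) - b N)" by (simp flip: distrib_left)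
      finally show ?case .
    qed simp
    have "\<forall>\<^sub>F n in sequentially. 4 * (\<bar>c N\<bar> + e * \<bar>b N\<bar> + 1) / e < b n"
      using top by (auto simp: filterlim_at_top_dense)
    moreover have "\<forall>\<^sub>F n in sequentially. 1 < b n"
      using top by (auto simp: filterlim_at_top_dense)
    ultimately have "\<forall>\<^sub>F n in sequentially. norm (c n / b n - 0) < e"
      using eventually_ge_at_top[of N]
    proof eventually_elim
      case (elim n)
      have "4 * (\<bar>c N\<bar> + e * \<bar>b N\<bar> + 1) < e * b n"
        using elim(1) e by (simp add: pos_divide_less_eq mult.commute)
      moreover have "- (e * b N) \<le> e * \<bar>b N\<bar>"
        using e by (simp add: abs_if)
      moreover have "4 * \<bar>c n - c N\<bar> \<le> e * b n - e * b N"
        using total[OF elim(3)] by (simp add: algebra_simps)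
      moreover have "0 \<le> e * \<bar>b N\<bar>" using e by simp
      moreover have "\<bar>c n\<bar> \<le> \<bar>c N\<bar> + \<bar>c n - c N\<bar>" "0 \<le> \<bar>c N\<bar>" by auto
      moreover have "A < p" if "4 * (B + q + 1) < p" "- r \<le> q" "4 * C \<le> p - r" "0 \<le> q" "A \<le> B + C" "0 \<le> B"
        for A B C p q r :: real using that by argo
      ultimately have "\<bar>c n\<bar> < e * b n" by blast
      thus ?case using elim(2) by (simp add: abs_divide pos_divide_less_eq)
    qed
    thus "\<exists>no. \<forall>n\<ge>no. norm (c n / b n - 0) < e" by (simp add: eventually_at_top_linorder)
  qed
  hence "(\<lambda>n. L + c n / b n) \<longlonglongrightarrow> L + 0" by (intro tendsto_intros)
  moreover have "\<forall>\<^sub>F n in sequentially. L + c n / b n = a n / b n"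
  proof -
    have "\<forall>\<^sub>F n in sequentially. 0 < b n" using top by (auto simp: filterlim_at_top_dense)
    thus ?thesis by eventually_elim (simp add: c_def field_simps)
  qed
  ultimately show ?thesis using Lim_transform_eventually by fastforce
qed

text \<open>Stolz--Cesaro with the comparison sequence \<open>k\<^sup>\<beta>\<close>.\<close>

lemma sum_powr_asymptotics:
  fixes u :: "nat \<Rightarrow> real"
  assumes \<beta>: "0 < \<beta>" and lim: "(\<lambda>j. u (Suc j) / real (Suc j) powr (\<beta> - 1)) \<longlonglongrightarrow> l"
  shows "(\<lambda>k. (\<Sum>j=1..k. u j) / real k powr \<beta>) \<longlonglongrightarrow> l / \<beta>"
proof (rule stolz_cesaro)
  show "real n powr \<beta> < real (Suc n) powr \<beta>" for n
    using \<beta> by (intro powr_less_mono2) auto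
  show "filterlim (\<lambda>k. real k powr \<beta>) at_top sequentially"
    using \<beta> by real_asymp
  have "(\<lambda>k::nat. (real (Suc k) powr \<beta> - real k powr \<beta>) / real (Suc k) powr (\<beta> - 1)) \<longlonglongrightarrow> \<beta>"
    using \<beta> by real_asymp
  hence "(\<lambda>k. u (Suc k) / real (Suc k) powr (\<beta> - 1)
        / ((real (Suc k) powr \<beta> - real k powr \<beta>) / real (Suc k) powr (\<beta> - 1))) \<longlonglongrightarrow> l / \<beta>"
    using \<beta> by (intro tendsto_divide lim) auto
  thus "(\<lambda>k. ((\<Sum>j=1..Suc k. u j) - (\<Sum>j=1..k. u j)) / (real (Suc k) powr \<beta> - real k powr \<beta>)) \<longlonglongrightarrow> l / \<beta>"
    by simp
qed

lemma powr_pred_bound: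
  assumes "0 < \<theta>" "\<theta> < 1" "1 \<le> (j::nat)"
  shows "\<theta> * real j powr (\<theta> - 1) \<le> real j powr \<theta> - (real j - 1) powr \<theta>"
proof (cases "j = 1")
  case False
  hence j: "1 < real j" using assms by simp
  have "\<exists>z. real j - 1 < z \<and> z < real j \<and> real j powr \<theta> - (real j - 1) powr \<theta>
      = (real j - (real j - 1)) * (\<theta> * z powr (\<theta> - 1))"
    using j by (intro MVT2) (auto intro!: derivative_eq_intros)
  then obtain z where z: "real j - 1 < z" "z < real j"
    "real j powr \<theta> - (real j - 1) powr \<theta> = \<theta> * z powr (\<theta> - 1)" by auto
  have "real j powr (\<theta> - 1) \<le> z powr (\<theta> - 1)"
    using z j assms by (intro powr_mono2') auto
  thus ?thesis using z assms by simp
qed (use assms in simp)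

text \<open>The first two terms of the binomial expansion.\<close>

lemma power_Suc_step:
  fixes W \<Delta> :: real
  assumes "0 \<le> W" "0 \<le> \<Delta>"
  shows "W ^ Suc m + real (Suc m) * \<Delta> * W ^ m \<le> (W + \<Delta>) ^ Suc m"
proof (induction m)
  case (Suc m)
  have "W ^ Suc (Suc m) + real (Suc (Suc m)) * \<Delta> * W ^ Suc m
      \<le> (W + \<Delta>) * (W ^ Suc m + real (Suc m) * \<Delta> * W ^ m)"
    using assms by (simp add: algebra_simps)
  also have "\<dots> \<le> (W + \<Delta>) * (W + \<Delta>) ^ Suc m"
    using assms by (intro mult_left_mono Suc) auto
  finally show ?case by simp
qed simp

locale weight_exponent =
  fixes b0 \<alpha> :: real
  assumes b0: "0 < b0" and \<alpha>: "1 / 2 < \<alpha>" "\<alpha> < 1"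
begin

definition \<theta> :: real where "\<theta> = 2 - 2 * \<alpha>"

lemma \<theta>: "0 < \<theta>" "\<theta> < 1"
  using \<alpha> by (simp_all add: \<theta>_def)

definition \<omega> :: "nat \<Rightarrow> real" where "\<omega> j = real j powr (- 2 * \<alpha>)"

text \<open>Up to sign, the coefficient of \<open>x\<^bsup>2 m + 1\<^esup>\<close> in \<open>t\<^sub>k\<close>, obtained by solving the recurrences order by order in \<open>x\<close>.\<close>

fun series_coeff :: "nat \<Rightarrow> nat \<Rightarrow> real" where
  "series_coeff 0 k = 1 / b0 + b0 * (\<Sum>j=1..k. \<omega> j)"
| "series_coeff (Suc m) k = (\<Sum>j=1..k. \<omega> j * (\<Sum>i<j. series_coeff m i))"

definition leading_coeff :: real where "leading_coeff = 1 / b0 + b0 * (\<Sum>j. \<omega> (Suc j))"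

text \<open>The limit of \<open>series_coeff m k / k\<^bsup>m \<theta>\<^esup>\<close>: each order contributes the two sums of powers
with exponents \<open>m \<theta>\<close> and \<open>(m + 1) \<theta> - 1\<close>.\<close>

fun coeff_limit :: "nat \<Rightarrow> real" where
  "coeff_limit 0 = leading_coeff"
| "coeff_limit (Suc m) = coeff_limit m / (1 + real m * \<theta>) / (real (Suc m) * \<theta>)"

lemma \<omega>_nonneg: "0 \<le> \<omega> j"
  by (simp add: \<omega>_def)

lemma \<omega>_summable: "summable (\<lambda>j. \<omega> (Suc j))"
proof -
  have "summable (\<lambda>j. real j powr (- 2 * \<alpha>))"
    using \<alpha> by (subst summable_real_powr_iff) auto
  thus ?thesis unfolding \<omega>_def by (subst summable_Suc_iff)
qed

lemma sum_\<omega>: "(\<Sum>j=1..k. \<omega> j) = (\<Sum>j<k. \<omega> (Suc j))"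
  by (rule sum.reindex_bij_witness[of _ Suc "\<lambda>j. j - 1"]) auto

lemma series_coeff_nonneg: "0 \<le> series_coeff m k"
  using b0 by (induction m k rule: series_coeff.induct) (auto intro!: add_nonneg_nonneg mult_nonneg_nonneg sum_nonneg \<omega>_nonneg)

lemma series_coeff_mono: "k \<le> l \<Longrightarrow> series_coeff m k \<le> series_coeff m l"
proof (cases m)
  case 0
  assume "k \<le> l"
  thus ?thesis using 0 b0 by (auto intro!: mult_left_mono sum_mono2 \<omega>_nonneg)
next
  case (Suc n)
  assume "k \<le> l"
  thus ?thesis using Suc by (auto intro!: sum_mono2 mult_nonneg_nonneg sum_nonneg \<omega>_nonneg series_coeff_nonneg)
qed

lemma leading_coeff_pos: "0 < leading_coeff"
  unfolding leading_coeff_def using b0 \<omega>_nonneg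
  by (intro add_pos_nonneg mult_nonneg_nonneg suminf_nonneg \<omega>_summable) auto

lemma series_coeff_0_le: "series_coeff 0 k \<le> leading_coeff"
  unfolding leading_coeff_def series_coeff.simps sum_\<omega> using b0 \<omega>_nonneg
  by (intro add_mono mult_left_mono sum_le_suminf \<omega>_summable) auto

definition W :: "nat \<Rightarrow> real" where "W k = (\<Sum>j=1..k. real j powr (\<theta> - 1))"

lemma W_nonneg: "0 \<le> W k"
  by (simp add: W_def sum_nonneg)

lemma W_Suc: "W (Suc k) = W k + real (Suc k) powr (\<theta> - 1)"
  by (simp add: W_def)

lemma W_le: "W k \<le> real k powr \<theta> / \<theta>"
proof (induction k)
  case 0
  show ?case by (simp add: W_def)
next
  case (Suc k)
  have "\<theta> * real (Suc k) powr (\<theta> - 1) \<le> real (Suc k) powr \<theta> - real k powr \<theta>"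
    using powr_pred_bound[OF \<theta>, of "Suc k"] by simp
  hence "real (Suc k) powr (\<theta> - 1) \<le> (real (Suc k) powr \<theta> - real k powr \<theta>) / \<theta>"
    using \<theta> by (simp add: pos_le_divide_eq mult.commute)
  thus ?case using Suc by (simp add: W_Suc diff_divide_distrib)
qed

lemma \<omega>_mult: "1 \<le> j \<Longrightarrow> \<omega> j * real j = real j powr (\<theta> - 1)"
proof -
  assume j: "1 \<le> j"
  have "\<omega> j * real j = real j powr (1 + - 2 * \<alpha>)"
    using powr_mult_base[of "real j" "- 2 * \<alpha>"] by (simp add: \<omega>_def mult.commute)
  thus ?thesis by (simp add: \<theta>_def)
qed

lemma sum_series_coeff_le: "(\<Sum>i<Suc j. series_coeff m i) \<le> real (Suc j) * series_coeff m j"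
  using sum_bounded_above[of "{..<Suc j}" "series_coeff m" "series_coeff m j"] series_coeff_mono by simp

text \<open>The iterated sums are dominated by those of an exponential series: since
\<open>\<omega> j * (\<Sum>i<j. a i) \<le> j\<^bsup>\<theta> - 1\<^esup> * a (j - 1)\<close> for nondecreasing \<open>a\<close>, passing to the next order is at most
one integration against the increments of \<open>W\<close>.\<close>

lemma series_coeff_bound_W: "series_coeff m k \<le> leading_coeff * W k ^ m / fact m"
proof (induction m arbitrary: k)
  case 0
  show ?case using series_coeff_0_le by simp
next
  case (Suc m)
  show ?case
  proof (induction k)
    case 0
    show ?case by (simp add: W_def)
  next
    case (Suc k)
    have "\<omega> (Suc k) * (\<Sum>i<Suc k. series_coeff m i) \<le> \<omega> (Suc k) * (real (Suc k) * series_coeff m k)"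
      by (intro mult_left_mono sum_series_coeff_le \<omega>_nonneg)
    also have "\<dots> = real (Suc k) powr (\<theta> - 1) * series_coeff m k"
      using \<omega>_mult[of "Suc k"] by (simp flip: mult.assoc)
    also have "\<dots> \<le> real (Suc k) powr (\<theta> - 1) * (leading_coeff * W k ^ m / fact m)"
      by (intro mult_left_mono Suc.prems \<open>\<And>k. series_coeff m k \<le> leading_coeff * W k ^ m / fact m\<close>) auto
    finally have "series_coeff (Suc m) (Suc k) \<le> leading_coeff * W k ^ Suc m / fact (Suc m)
        + real (Suc k) powr (\<theta> - 1) * (leading_coeff * W k ^ m / fact m)"
      using Suc.IH by simp
    also have "\<dots> = leading_coeff / fact (Suc m) * (W k ^ Suc m + real (Suc m) * real (Suc k) powr (\<theta> - 1) * W k ^ m)"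
    proof -
      have f: "leading_coeff / fact (Suc m) * real (Suc m) = leading_coeff / fact m"
        by (simp add: fact_Suc del: of_nat_Suc)
      have "leading_coeff / fact (Suc m) * (W k ^ Suc m + real (Suc m) * real (Suc k) powr (\<theta> - 1) * W k ^ m)
          = leading_coeff * W k ^ Suc m / fact (Suc m)
            + leading_coeff / fact (Suc m) * real (Suc m) * (real (Suc k) powr (\<theta> - 1) * W k ^ m)"
        by (simp add: distrib_left mult_ac del: of_nat_Suc fact_Suc power_Suc)
      thus ?thesis unfolding f by (simp add: mult_ac del: of_nat_Suc fact_Suc power_Suc)
    qed
    also have "\<dots> \<le> leading_coeff / fact (Suc m) * W (Suc k) ^ Suc m"
      unfolding W_Suc using leading_coeff_pos by (intro mult_left_mono power_Suc_step W_nonneg) auto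
    finally show ?case by simp
  qed
qed

lemma series_coeff_bound: "series_coeff m k \<le> leading_coeff * (real k powr \<theta> / \<theta>) ^ m / fact m"
proof -
  have "leading_coeff * W k ^ m / fact m \<le> leading_coeff * (real k powr \<theta> / \<theta>) ^ m / fact m"
    using leading_coeff_pos W_nonneg W_le by (intro divide_right_mono mult_left_mono power_mono) auto
  thus ?thesis using series_coeff_bound_W order_trans by blast
qed

lemma ratio_powr_tendsto: "(\<lambda>j. (real j / real (Suc j)) powr \<gamma>) \<longlonglongrightarrow> 1"
proof -
  have "(\<lambda>j. real j / real (Suc j)) \<longlonglongrightarrow> 1" by real_asymp
  hence "(\<lambda>j. (real j / real (Suc j)) powr \<gamma>) \<longlonglongrightarrow> 1 powr \<gamma>"
    by (intro tendsto_powr tendsto_const) auto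
  thus ?thesis by simp
qed

text \<open>The odd step of the asymptotics, which is also needed on its own for the expansion of \<open>s\<^sub>k\<close>.\<close>

lemma sum_series_coeff_asymptotics:
  assumes "(\<lambda>k. series_coeff m k / real k powr (real m * \<theta>)) \<longlonglongrightarrow> coeff_limit m"
  shows "(\<lambda>k. (\<Sum>i<k. series_coeff m i) / real k powr (1 + real m * \<theta>)) \<longlonglongrightarrow> coeff_limit m / (1 + real m * \<theta>)"
proof -
  have "(\<lambda>j. series_coeff m j / real j powr (real m * \<theta>) * (real j / real (Suc j)) powr (real m * \<theta>)) \<longlonglongrightarrow> coeff_limit m * 1"
    by (intro tendsto_mult assms ratio_powr_tendsto)
  moreover have "\<forall>\<^sub>F j in sequentially. series_coeff m j / real j powr (real m * \<theta>) * (real j / real (Suc j)) powr (real m * \<theta>)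
      = series_coeff m (Suc j - 1) / real (Suc j) powr (1 + real m * \<theta> - 1)"
    using eventually_gt_at_top[of 0] by eventually_elim (simp add: powr_divide)
  ultimately have "(\<lambda>j. series_coeff m (Suc j - 1) / real (Suc j) powr (1 + real m * \<theta> - 1)) \<longlonglongrightarrow> coeff_limit m"
    using Lim_transform_eventually by fastforce
  from sum_powr_asymptotics[where u="\<lambda>j. series_coeff m (j - 1)", OF _ this]
  have "(\<lambda>k. (\<Sum>j=1..k. series_coeff m (j - 1)) / real k powr (1 + real m * \<theta>)) \<longlonglongrightarrow> coeff_limit m / (1 + real m * \<theta>)"
    using \<theta> by (simp add: add_pos_nonneg)
  moreover have "(\<Sum>j=1..k. series_coeff m (j - 1)) = (\<Sum>i<k. series_coeff m i)" for k
    by (rule sum.reindex_bij_witness[of _ Suc "\<lambda>j. j - 1"]) auto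
  ultimately show ?thesis by simp
qed

lemma series_coeff_asymptotics: "(\<lambda>k. series_coeff m k / real k powr (real m * \<theta>)) \<longlonglongrightarrow> coeff_limit m"
proof (induction m)
  case 0
  have "(\<lambda>k. \<Sum>j<k. \<omega> (Suc j)) \<longlonglongrightarrow> (\<Sum>j. \<omega> (Suc j))"
    by (rule summable_LIMSEQ[OF \<omega>_summable])
  hence "(\<lambda>k. series_coeff 0 k) \<longlonglongrightarrow> leading_coeff"
    unfolding leading_coeff_def series_coeff.simps sum_\<omega> by (intro tendsto_intros)
  moreover have "\<forall>\<^sub>F k in sequentially. series_coeff 0 k = series_coeff 0 k / real k powr (real 0 * \<theta>)"
    using eventually_gt_at_top[of 0] by eventually_elim simp
  ultimately show ?case unfolding coeff_limit.simps by (rule Lim_transform_eventually)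
next
  case (Suc m)
  have "(\<lambda>k. (\<Sum>i<Suc k. series_coeff m i) / real (Suc k) powr (1 + real m * \<theta>)) \<longlonglongrightarrow> coeff_limit m / (1 + real m * \<theta>)"
    using sum_series_coeff_asymptotics[OF Suc] by (rule LIMSEQ_Suc)
  moreover have "(\<Sum>i<Suc k. series_coeff m i) / real (Suc k) powr (1 + real m * \<theta>)
      = (\<omega> (Suc k) * (\<Sum>i<Suc k. series_coeff m i)) / real (Suc k) powr (real (Suc m) * \<theta> - 1)" for k
  proof -
    have "real (Suc k) powr (real (Suc m) * \<theta> - 1) = \<omega> (Suc k) * real (Suc k) powr (1 + real m * \<theta>)"
      unfolding \<omega>_def powr_add[symmetric] by (simp add: \<theta>_def algebra_simps)
    moreover have "\<omega> (Suc k) \<noteq> 0" by (simp add: \<omega>_def)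
    ultimately show ?thesis by simp
  qed
  ultimately have "(\<lambda>k. (\<omega> (Suc k) * (\<Sum>i<Suc k. series_coeff m i)) / real (Suc k) powr (real (Suc m) * \<theta> - 1))
      \<longlonglongrightarrow> coeff_limit m / (1 + real m * \<theta>)" by simp
  from sum_powr_asymptotics[where u="\<lambda>j. \<omega> j * (\<Sum>i<j. series_coeff m i)", OF _ this]
  show ?case using \<theta> by simp
qed

text \<open>The power series of \<open>t\<^sub>k / x\<close>.\<close>

definition T :: "real \<Rightarrow> nat \<Rightarrow> real" where
  "T x k = (\<Sum>m. (- (x\<^sup>2)) ^ m * series_coeff m k)"

definition sx :: "real \<Rightarrow> nat \<Rightarrow> real" where
  "sx x k = b0 - x\<^sup>2 * (\<Sum>i<k. T x i)"

definition tx :: "real \<Rightarrow> nat \<Rightarrow> real" where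
  "tx x k = x * T x k"

lemma exp_summable: "summable (\<lambda>m. (y::real) ^ m / fact m)"
  using summable_exp[of y] by (simp add: field_simps)

lemma T_summable: "summable (\<lambda>m. (- (x\<^sup>2)) ^ m * series_coeff m k)"
proof (rule summable_comparison_test')
  show "summable (\<lambda>m. leading_coeff * ((x\<^sup>2 * (real k powr \<theta> / \<theta>)) ^ m / fact m))"
    by (intro summable_mult exp_summable)
  fix m
  have "norm ((- (x\<^sup>2)) ^ m * series_coeff m k) = (x\<^sup>2) ^ m * series_coeff m k"
    using series_coeff_nonneg[of m k] by (simp add: abs_mult power_abs)
  also have "\<dots> \<le> (x\<^sup>2) ^ m * (leading_coeff * (real k powr \<theta> / \<theta>) ^ m / fact m)"
    by (intro mult_left_mono series_coeff_bound) auto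
  also have "\<dots> = leading_coeff * ((x\<^sup>2 * (real k powr \<theta> / \<theta>)) ^ m / fact m)"
    by (simp only: power_mult_distrib) (simp add: mult_ac)
  finally show "norm ((- (x\<^sup>2)) ^ m * series_coeff m k) \<le> leading_coeff * ((x\<^sup>2 * (real k powr \<theta> / \<theta>)) ^ m / fact m)" .
qed

lemma T_sums: "(\<lambda>m. (- (x\<^sup>2)) ^ m * series_coeff m k) sums T x k"
  unfolding T_def by (rule summable_sums[OF T_summable])

lemma sum_T_sums: "(\<lambda>m. (- (x\<^sup>2)) ^ m * (\<Sum>i<k. series_coeff m i)) sums (\<Sum>i<k. T x i)"
proof -
  have "(\<lambda>m. \<Sum>i<k. (- (x\<^sup>2)) ^ m * series_coeff m i) sums (\<Sum>i<k. T x i)"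
    by (intro sums_sum T_sums)
  thus ?thesis by (simp add: sum_distrib_left)
qed

lemma sx_0: "sx x 0 = b0"
  by (simp add: sx_def)

lemma tx_0: "tx x 0 = x / b0"
proof -
  have "series_coeff (Suc m) 0 = 0" for m by simp
  hence "(\<lambda>m. (- (x\<^sup>2)) ^ m * series_coeff m 0) sums (\<Sum>m\<in>{0}. (- (x\<^sup>2)) ^ m * series_coeff m 0)"
    by (intro sums_finite) (auto simp: gr0_conv_Suc)
  hence "T x 0 = 1 / b0" using sums_unique2[OF T_sums[of x 0]] by simp
  thus ?thesis by (simp add: tx_def)
qed

lemma sx_Suc: "sx x (Suc k) = sx x k - x * tx x k"
  by (simp add: sx_def tx_def algebra_simps power2_eq_square)

text \<open>The recurrence holds because it holds for the coefficient of every power of \<open>x\<close>.\<close>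

lemma tx_Suc: "tx x (Suc k) = tx x k + x * sx x (Suc k) / (real (Suc k) powr \<alpha>)\<^sup>2"
proof -
  have \<omega>: "\<omega> (Suc k) = 1 / (real (Suc k) powr \<alpha>)\<^sup>2"
  proof -
    have "(real (Suc k) powr \<alpha>)\<^sup>2 = real (Suc k) powr (2 * \<alpha>)"
      unfolding power2_eq_square powr_add[symmetric] by simp
    thus ?thesis unfolding \<omega>_def by (simp add: powr_minus_divide)
  qed
  have tail: "(\<lambda>m. (- (x\<^sup>2)) ^ Suc m * series_coeff (Suc m) l) sums (T x l - series_coeff 0 l)" for l
    using T_sums[of x l] sums_Suc_iff[of "\<lambda>m. (- (x\<^sup>2)) ^ m * series_coeff m l" "T x l - series_coeff 0 l"]
    by (simp del: series_coeff.simps power_Suc)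
  have "(\<lambda>m. (- (x\<^sup>2)) ^ Suc m * series_coeff (Suc m) (Suc k) - (- (x\<^sup>2)) ^ Suc m * series_coeff (Suc m) k) sums
      ((T x (Suc k) - series_coeff 0 (Suc k)) - (T x k - series_coeff 0 k))"
    by (intro sums_diff tail)
  moreover have "(- (x\<^sup>2)) ^ Suc m * series_coeff (Suc m) (Suc k) - (- (x\<^sup>2)) ^ Suc m * series_coeff (Suc m) k
      = - (x\<^sup>2) * \<omega> (Suc k) * ((- (x\<^sup>2)) ^ m * (\<Sum>i<Suc k. series_coeff m i))" for m
    by (simp add: algebra_simps)
  ultimately have "(\<lambda>m. - (x\<^sup>2) * \<omega> (Suc k) * ((- (x\<^sup>2)) ^ m * (\<Sum>i<Suc k. series_coeff m i))) sums
      ((T x (Suc k) - series_coeff 0 (Suc k)) - (T x k - series_coeff 0 k))" by simp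
  moreover have "(\<lambda>m. - (x\<^sup>2) * \<omega> (Suc k) * ((- (x\<^sup>2)) ^ m * (\<Sum>i<Suc k. series_coeff m i))) sums
      (- (x\<^sup>2) * \<omega> (Suc k) * (\<Sum>i<Suc k. T x i))"
    by (intro sums_mult sum_T_sums)
  ultimately have "(T x (Suc k) - series_coeff 0 (Suc k)) - (T x k - series_coeff 0 k) = - (x\<^sup>2) * \<omega> (Suc k) * (\<Sum>i<Suc k. T x i)"
    by (rule sums_unique2)
  moreover have "series_coeff 0 (Suc k) - series_coeff 0 k = b0 * \<omega> (Suc k)" by (simp add: algebra_simps)
  ultimately have "T x (Suc k) = T x k + \<omega> (Suc k) * (b0 - x\<^sup>2 * (\<Sum>i<Suc k. T x i))"
    by (simp add: algebra_simps)
  hence "T x (Suc k) = T x k + sx x (Suc k) / (real (Suc k) powr \<alpha>)\<^sup>2"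
    by (simp add: sx_def \<omega>)
  hence "x * T x (Suc k) = x * (T x k + sx x (Suc k) / (real (Suc k) powr \<alpha>)\<^sup>2)" by (rule arg_cong)
  thus ?thesis by (simp add: tx_def distrib_left)
qed

text \<open>The index at which \<open>x\<^sup>2 k\<^sup>\<theta>\<close> is close to \<open>V\<close>.\<close>

definition rescaled_index :: "real \<Rightarrow> real \<Rightarrow> nat" where
  "rescaled_index V x = nat \<lfloor>(V / x\<^sup>2) powr (1 / \<theta>)\<rfloor>"

abbreviation scaled_index :: "real \<Rightarrow> real \<Rightarrow> real" where
  "scaled_index V x \<equiv> x\<^sup>2 * real (rescaled_index V x) powr \<theta>"

text \<open>With \<open>V = \<tau>\<^sup>\<theta>\<close>, the function \<open>S = \<tau> * Sstar V\<close> solves the limiting differential equation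
\<open>S'' = - \<tau>\<^bsup>- 2 \<alpha>\<^esup> S\<close> with \<open>S 0 = 0\<close>, and \<open>Tstar V\<close> is its derivative.\<close>

definition Tstar :: "real \<Rightarrow> real" where "Tstar V = (\<Sum>m. (- V) ^ m * coeff_limit m)"

definition Sstar :: "real \<Rightarrow> real" where "Sstar V = (\<Sum>m. (- V) ^ m * (coeff_limit m / (1 + real m * \<theta>)))"

context
  fixes V :: real
  assumes V: "0 < V"
begin

lemma scale_at_top: "filterlim (\<lambda>x. (V / x\<^sup>2) powr (1 / \<theta>)) at_top (at_right 0)"
  using V \<theta> by real_asymp

lemma rescaled_index_ratio: "((\<lambda>x. real (rescaled_index V x) / (V / x\<^sup>2) powr (1 / \<theta>)) \<longlongrightarrow> 1) (at_right 0)"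
proof -
  have "((\<lambda>y. real (nat \<lfloor>y\<rfloor>) / y) \<longlongrightarrow> 1) at_top" by real_asymp
  from filterlim_compose[OF this scale_at_top] show ?thesis by (simp add: rescaled_index_def)
qed

lemma rescaled_index_at_top: "filterlim (rescaled_index V) at_top (at_right 0)"
proof -
  have "filterlim (\<lambda>y::real. nat \<lfloor>y\<rfloor>) at_top at_top" by real_asymp
  from filterlim_compose[OF this scale_at_top] show ?thesis by (simp add: rescaled_index_def[abs_def])
qed

lemma rescaled_index_pos: "\<forall>\<^sub>F x in at_right 0. 0 < x \<and> 1 \<le> rescaled_index V x"
  using rescaled_index_at_top by (intro eventually_conj eventually_at_right_less) (simp add: filterlim_at_top)

lemma v_tendsto: "((\<lambda>x. scaled_index V x) \<longlongrightarrow> V) (at_right 0)"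
proof -
  have "((\<lambda>x. V * (real (rescaled_index V x) / (V / x\<^sup>2) powr (1 / \<theta>)) powr \<theta>) \<longlongrightarrow> V * 1 powr \<theta>) (at_right 0)"
    by (intro tendsto_intros rescaled_index_ratio) auto
  moreover have "\<forall>\<^sub>F x in at_right 0. V * (real (rescaled_index V x) / (V / x\<^sup>2) powr (1 / \<theta>)) powr \<theta> = scaled_index V x"
    using rescaled_index_pos
  proof eventually_elim
    case (elim x)
    have "((V / x\<^sup>2) powr (1 / \<theta>)) powr \<theta> = V / x\<^sup>2"
      using V \<theta> elim by (simp add: powr_powr)
    moreover define y where "y = (V / x\<^sup>2) powr (1 / \<theta>)"
    ultimately have y: "y powr \<theta> = V / x\<^sup>2" by simp
    have "V * (real (rescaled_index V x) / y) powr \<theta> = V * (real (rescaled_index V x) powr \<theta> / (V / x\<^sup>2))"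
    proof -
      have "0 \<le> y" by (simp add: y_def)
      thus ?thesis by (simp add: powr_divide y)
    qed
    thus ?case unfolding y_def[symmetric] using V elim by simp
  qed
  ultimately show ?thesis using Lim_transform_eventually by fastforce
qed

lemma powr_nat_mult:
  assumes "1 \<le> (k::nat)"
  shows "real k powr (real m * \<theta>) = (real k powr \<theta>) ^ m"
proof -
  have "real k powr (real m * \<theta>) = (real k powr \<theta>) powr real m"
    by (simp add: powr_powr mult.commute)
  thus ?thesis using assms by (simp add: powr_realpow)
qed

lemma series_coeff_rescaled_le:
  assumes "1 \<le> k"
  shows "series_coeff m k / real k powr (real m * \<theta>) \<le> leading_coeff / \<theta> ^ m / fact m"
proof -
  have "real k powr (real m * \<theta>) = (real k powr \<theta>) ^ m"
    by (rule powr_nat_mult[OF assms])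
  moreover have "series_coeff m k / (real k powr \<theta>) ^ m \<le> leading_coeff * (real k powr \<theta> / \<theta>) ^ m / fact m / (real k powr \<theta>) ^ m"
    by (intro divide_right_mono series_coeff_bound) auto
  moreover have "leading_coeff * (real k powr \<theta> / \<theta>) ^ m / fact m / (real k powr \<theta>) ^ m = leading_coeff / \<theta> ^ m / fact m"
    using assms by (simp add: power_divide)
  ultimately show ?thesis by simp
qed

text \<open>The factorial bound on the coefficients dominates the series uniformly in \<open>x\<close>, since
\<open>x\<^sup>2 k\<^sup>\<theta> < V + 1\<close> eventually.\<close>

lemma tannery_rescaled:
  fixes a :: "nat \<Rightarrow> nat \<Rightarrow> real"
  assumes lim: "\<And>m. a m \<longlonglongrightarrow> l m"
    and bound: "\<And>m k. 1 \<le> k \<Longrightarrow> \<bar>a m k\<bar> \<le> leading_coeff / \<theta> ^ m / fact m"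
  shows "((\<lambda>x. \<Sum>m. (- (scaled_index V x)) ^ m * a m (rescaled_index V x)) \<longlongrightarrow> (\<Sum>m. (- V) ^ m * l m)) (at_right 0)"
proof -
  define M where "M m = leading_coeff * ((((V + 1) / \<theta>) ^ m) / fact m)" for m
  have "((\<lambda>x. (- (scaled_index V x)) ^ m * a m (rescaled_index V x)) \<longlongrightarrow> (- V) ^ m * l m) (at_right 0)" for m
    by (intro tendsto_intros v_tendsto filterlim_compose[OF lim rescaled_index_at_top])
  moreover have "\<forall>\<^sub>F (m, x) in at_top \<times>\<^sub>F at_right 0.
      norm ((- (scaled_index V x)) ^ m * a m (rescaled_index V x)) \<le> M m"
  proof -
    have "\<forall>\<^sub>F x in at_right 0. scaled_index V x < V + 1"
      using v_tendsto by (rule order_tendstoD) simp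
    hence "\<forall>\<^sub>F x in at_right 0. \<forall>m. norm ((- (scaled_index V x)) ^ m * a m (rescaled_index V x)) \<le> M m"
      using rescaled_index_pos
    proof eventually_elim
      case (elim x)
      show ?case
      proof
        fix m
        have "norm ((- (scaled_index V x)) ^ m * a m (rescaled_index V x))
            = (scaled_index V x) ^ m * \<bar>a m (rescaled_index V x)\<bar>"
          by (simp add: abs_mult power_abs)
        also have "\<dots> \<le> (V + 1) ^ m * (leading_coeff / \<theta> ^ m / fact m)"
          using elim V by (intro mult_mono power_mono bound) auto
        also have "\<dots> = M m" by (simp add: M_def power_divide)
        finally show "norm ((- (scaled_index V x)) ^ m * a m (rescaled_index V x)) \<le> M m" .
      qed
    qed
    from eventually_prodI[OF always_eventually[of "\<lambda>_::nat. True"] this] show ?thesis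
      by (rule eventually_mono) auto
  qed
  moreover have "summable M" unfolding M_def by (intro summable_mult exp_summable)
  ultimately show ?thesis
    using tannerys_theorem[of "\<lambda>m x. (- (scaled_index V x)) ^ m * a m (rescaled_index V x)"
        "\<lambda>m. (- V) ^ m * l m" "at_right 0" M] by simp
qed

lemma T_tendsto: "((\<lambda>x. T x (rescaled_index V x)) \<longlongrightarrow> Tstar V) (at_right 0)"
proof -
  have "((\<lambda>x. \<Sum>m. (- (scaled_index V x)) ^ m * (series_coeff m (rescaled_index V x) / real (rescaled_index V x) powr (real m * \<theta>)))
      \<longlongrightarrow> Tstar V) (at_right 0)"
    unfolding Tstar_def
  proof (rule tannery_rescaled)
    show "(\<lambda>k. series_coeff m k / real k powr (real m * \<theta>)) \<longlonglongrightarrow> coeff_limit m" for m by (rule series_coeff_asymptotics)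
    show "\<bar>series_coeff m k / real k powr (real m * \<theta>)\<bar> \<le> leading_coeff / \<theta> ^ m / fact m" if "1 \<le> k" for m k
      using series_coeff_rescaled_le[OF that] series_coeff_nonneg[of m k] by simp
  qed
  moreover have "\<forall>\<^sub>F x in at_right 0. (\<Sum>m. (- (scaled_index V x)) ^ m * (series_coeff m (rescaled_index V x) / real (rescaled_index V x) powr (real m * \<theta>))) = T x (rescaled_index V x)"
    using rescaled_index_pos
  proof eventually_elim
    case (elim x)
    have "(- (scaled_index V x)) ^ m * (series_coeff m (rescaled_index V x) / real (rescaled_index V x) powr (real m * \<theta>)) = (- (x\<^sup>2)) ^ m * series_coeff m (rescaled_index V x)" for m
    proof -
      have "real (rescaled_index V x) powr (real m * \<theta>) = (real (rescaled_index V x) powr \<theta>) ^ m"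
        using elim by (intro powr_nat_mult) simp
      moreover have "(- (scaled_index V x)) ^ m = (- (x\<^sup>2)) ^ m * (real (rescaled_index V x) powr \<theta>) ^ m"
        by (simp flip: power_mult_distrib)
      ultimately show ?thesis using elim by simp
    qed
    thus ?case by (simp add: T_def)
  qed
  ultimately show ?thesis by (rule Lim_transform_eventually)
qed

lemma S_tendsto: "((\<lambda>x. (\<Sum>i<rescaled_index V x. T x i) / real (rescaled_index V x)) \<longlongrightarrow> Sstar V) (at_right 0)"
proof -
  have "((\<lambda>x. \<Sum>m. (- (scaled_index V x)) ^ m * ((\<Sum>i<rescaled_index V x. series_coeff m i) / real (rescaled_index V x) powr (1 + real m * \<theta>)))
      \<longlongrightarrow> Sstar V) (at_right 0)"
    unfolding Sstar_def
  proof (rule tannery_rescaled)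
    show "(\<lambda>k. (\<Sum>i<k. series_coeff m i) / real k powr (1 + real m * \<theta>)) \<longlonglongrightarrow> coeff_limit m / (1 + real m * \<theta>)" for m
      by (intro sum_series_coeff_asymptotics series_coeff_asymptotics)
    show "\<bar>(\<Sum>i<k. series_coeff m i) / real k powr (1 + real m * \<theta>)\<bar> \<le> leading_coeff / \<theta> ^ m / fact m" if k: "1 \<le> k" for m k
    proof -
      have "(\<Sum>i<k. series_coeff m i) \<le> real k * series_coeff m k"
        using sum_bounded_above[of "{..<k}" "series_coeff m" "series_coeff m k"] series_coeff_mono by simp
      hence "(\<Sum>i<k. series_coeff m i) / real k powr (1 + real m * \<theta>) \<le> real k * series_coeff m k / real k powr (1 + real m * \<theta>)"
        by (intro divide_right_mono) auto
      also have "\<dots> = series_coeff m k / real k powr (real m * \<theta>)" using k by (simp add: powr_add)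
      finally show ?thesis using series_coeff_rescaled_le[OF k, of m] by (simp add: sum_nonneg series_coeff_nonneg)
    qed
  qed
  moreover have "\<forall>\<^sub>F x in at_right 0. (\<Sum>m. (- (scaled_index V x)) ^ m * ((\<Sum>i<rescaled_index V x. series_coeff m i) / real (rescaled_index V x) powr (1 + real m * \<theta>)))
      = (\<Sum>i<rescaled_index V x. T x i) / real (rescaled_index V x)"
    using rescaled_index_pos
  proof eventually_elim
    case (elim x)
    have eq: "(- (scaled_index V x)) ^ m * ((\<Sum>i<rescaled_index V x. series_coeff m i) / real (rescaled_index V x) powr (1 + real m * \<theta>))
        = (- (x\<^sup>2)) ^ m * (\<Sum>i<rescaled_index V x. series_coeff m i) / real (rescaled_index V x)" for m
    proof -
      have "real (rescaled_index V x) powr (1 + real m * \<theta>) = real (rescaled_index V x) * (real (rescaled_index V x) powr \<theta>) ^ m"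
        using elim by (simp add: powr_add powr_nat_mult)
      moreover have "(- (scaled_index V x)) ^ m = (- (x\<^sup>2)) ^ m * (real (rescaled_index V x) powr \<theta>) ^ m"
        by (simp flip: power_mult_distrib)
      ultimately show ?thesis using elim by simp
    qed
    have "(\<lambda>m. (- (x\<^sup>2)) ^ m * (\<Sum>i<rescaled_index V x. series_coeff m i) / real (rescaled_index V x)) sums ((\<Sum>i<rescaled_index V x. T x i) / real (rescaled_index V x))"
      by (intro sums_divide sum_T_sums)
    thus ?case unfolding eq by (simp add: sums_iff)
  qed
  ultimately show ?thesis by (rule Lim_transform_eventually)
qed

end

end

section \<open>The limit energy near zero\<close>

text \<open>The hypothesis says that \<open>ln \<circ> N\<close> is a Cauchy filter; completeness provides a limit without
knowing the constants \<open>h\<close>.\<close>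

lemma tendsto_of_exp_sandwich:
  fixes N :: "'a \<Rightarrow> real"
  assumes F: "F \<noteq> bot"
    and sandwich: "\<And>\<epsilon>. 0 < \<epsilon> \<Longrightarrow> \<exists>h>0. \<forall>\<^sub>F x in F. h * exp (- \<epsilon>) \<le> N x \<and> N x \<le> h * exp \<epsilon>"
  shows "\<exists>n>0. (N \<longlongrightarrow> n) F"
proof -
  have close: "\<exists>h>0. \<forall>\<^sub>F x in F. 0 < N x \<and> dist (ln (N x)) (ln h) \<le> \<epsilon>" if \<epsilon>: "0 < \<epsilon>" for \<epsilon>
  proof -
    obtain h where h: "h > 0" "\<forall>\<^sub>F x in F. h * exp (- \<epsilon>) \<le> N x \<and> N x \<le> h * exp \<epsilon>"
      using sandwich[OF \<epsilon>] by blast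
    from h(2) have "\<forall>\<^sub>F x in F. 0 < N x \<and> dist (ln (N x)) (ln h) \<le> \<epsilon>"
    proof eventually_elim
      case (elim x)
      have pos: "0 < N x" using elim h(1) by (smt (verit) exp_gt_zero mult_pos_pos)
      have "ln (h * exp (- \<epsilon>)) \<le> ln (N x)" "ln (N x) \<le> ln (h * exp \<epsilon>)"
        using elim pos h(1) by (simp_all add: ln_le_cancel_iff)
      hence "ln h - \<epsilon> \<le> ln (N x)" "ln (N x) \<le> ln h + \<epsilon>"
        using h(1) by (simp_all add: ln_mult)
      thus ?case using pos by (simp add: dist_real_def abs_le_iff)
    qed
    thus ?thesis using h(1) by blast
  qed
  have "cauchy_filter (filtermap (\<lambda>x. ln (N x)) F)"
    unfolding cauchy_filter_metric_filtermap
  proof (intro allI impI)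
    fix e :: real assume e: "0 < e"
    obtain h where h: "\<forall>\<^sub>F x in F. 0 < N x \<and> dist (ln (N x)) (ln h) \<le> e / 3"
      using close[of "e / 3"] e by auto
    have "dist a b < e" if "dist a (ln h) \<le> e / 3" "dist b (ln h) \<le> e / 3" for a b
      using dist_triangle2[of a b "ln h"] that e by linarith
    thus "\<exists>P. eventually P F \<and> (\<forall>x y. P x \<and> P y \<longrightarrow> dist (ln (N x)) (ln (N y)) < e)"
      using h by (intro exI[of _ "\<lambda>x. 0 < N x \<and> dist (ln (N x)) (ln h) \<le> e / 3"]) auto
  qed
  then obtain c where "filtermap (\<lambda>x. ln (N x)) F \<le> nhds c"
    using cauchy_filter_complete_converges[of "filtermap (\<lambda>x. ln (N x)) F" UNIV] F
    by (auto simp: complete_UNIV filtermap_bot_iff)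
  hence "((\<lambda>x. ln (N x)) \<longlongrightarrow> c) F" by (simp add: filterlim_def)
  hence "((\<lambda>x. exp (ln (N x))) \<longlongrightarrow> exp c) F" by (intro tendsto_intros)
  moreover have "\<forall>\<^sub>F x in F. exp (ln (N x)) = N x"
  proof -
    obtain h where "\<forall>\<^sub>F x in F. 0 < N x \<and> dist (ln (N x)) (ln h) \<le> 1" using close[of 1] by auto
    thus ?thesis by eventually_elim simp
  qed
  ultimately have "(N \<longlongrightarrow> exp c) F" by (rule Lim_transform_eventually)
  thus ?thesis by (intro exI[of _ "exp c"]) simp
qed

context weight_exponent
begin

abbreviation g :: "nat \<Rightarrow> real" where "g k \<equiv> real k powr \<alpha>"

lemma g_increment:
  assumes "1 \<le> k"
  obtains z where "real k < z" "z < real (Suc k)" "g (Suc k) - g k = \<alpha> * z powr (\<alpha> - 1)"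
proof -
  have "\<exists>z. real k < z \<and> z < real (Suc k) \<and> g (Suc k) - g k = (real (Suc k) - real k) * (\<alpha> * z powr (\<alpha> - 1))"
    using assms by (intro MVT2) (auto intro!: derivative_eq_intros)
  thus ?thesis using that by auto
qed

lemma g_increment_le:
  assumes "1 \<le> k"
  shows "g (Suc k) - g k \<le> real k powr (\<alpha> - 1)"
proof -
  obtain z where z: "real k < z" "g (Suc k) - g k = \<alpha> * z powr (\<alpha> - 1)"
    using g_increment[OF assms] by blast
  have "z powr (\<alpha> - 1) \<le> real k powr (\<alpha> - 1)"
    using z assms \<alpha> by (intro powr_mono2') auto
  moreover have "\<alpha> * z powr (\<alpha> - 1) \<le> 1 * z powr (\<alpha> - 1)"
    using \<alpha> by (intro mult_right_mono) auto
  ultimately show ?thesis unfolding z(2) by linarith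
qed

lemma hamiltonian:
  assumes "0 < x"
  shows "discrete_hamiltonian g x (sx x) (tx x)"
proof
  show "0 < g k" if "1 \<le> k" for k using that by simp
  show "g k \<le> g (Suc k)" if "1 \<le> k" for k using \<alpha> by (intro powr_mono2) auto
  show "g (Suc (Suc k)) - g (Suc k) \<le> g (Suc k) - g k" if k: "1 \<le> k" for k
  proof -
    obtain z where z: "real k < z" "z < real (Suc k)" "g (Suc k) - g k = \<alpha> * z powr (\<alpha> - 1)"
      using g_increment[OF k] by blast
    obtain z' where z': "real (Suc k) < z'" "g (Suc (Suc k)) - g (Suc k) = \<alpha> * z' powr (\<alpha> - 1)"
      using g_increment[of "Suc k"] by auto
    have "z' powr (\<alpha> - 1) \<le> z powr (\<alpha> - 1)"
      using z z' \<alpha> k by (intro powr_mono2') auto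
    thus ?thesis unfolding z(3) z'(2) using \<alpha> by (intro mult_left_mono) auto
  qed
qed (use assms sx_Suc tx_Suc in auto)

text \<open>The recurrence can be run backwards, and the initial value \<open>sx x 0 = b0\<close> is not zero.\<close>

lemma sx_tx_nonzero: "sx x k \<noteq> 0 \<or> tx x k \<noteq> 0"
proof (induction k)
  case 0
  show ?case using b0 by (simp add: sx_0)
next
  case (Suc k)
  show ?case
  proof (rule ccontr)
    assume "\<not> ?thesis"
    hence z: "sx x (Suc k) = 0" "tx x (Suc k) = 0" by auto
    hence "tx x k = 0" using tx_Suc[of x k] by simp
    moreover have "sx x k = 0" using sx_Suc[of x k] z \<open>tx x k = 0\<close> by simp
    ultimately show False using Suc by simp
  qed
qed

definition energy :: "real \<Rightarrow> nat \<Rightarrow> real" where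
  "energy x k = (sx x k)\<^sup>2 / g k + g k * (tx x k)\<^sup>2"

text \<open>The sequence \<open>\<eta>\<close> of the Hamiltonian system for \<open>g k = k\<^sup>\<alpha>\<close>, with its dependence on \<open>x\<close> made explicit.\<close>

definition defect :: "real \<Rightarrow> nat \<Rightarrow> real" where
  "defect x k = ((g (Suc k) - g k) / x + x / g k) / 2 + (g (Suc k) - g k) / g k"

definition limit_energy :: "real \<Rightarrow> real" where "limit_energy x = lim (energy x)"

lemma energy_pos: "1 \<le> k \<Longrightarrow> 0 < energy x k"
proof -
  assume "1 \<le> k"
  hence g: "0 < g k" by simp
  show ?thesis
  proof (cases "sx x k = 0")
    case True
    hence "0 < g k * (tx x k)\<^sup>2" using sx_tx_nonzero[of x k] g by simp
    thus ?thesis using True by (simp add: energy_def)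
  next
    case False
    hence "0 < (sx x k)\<^sup>2 / g k" using g by simp
    moreover have "0 \<le> g k * (tx x k)\<^sup>2" using g by simp
    ultimately show ?thesis unfolding energy_def by (rule add_pos_nonneg)
  qed
qed

text \<open>A bound that is uniform for \<open>x\<close> in \<open>{l..u}\<close>.\<close>

definition defect_bound :: "real \<Rightarrow> real \<Rightarrow> nat \<Rightarrow> real" where
  "defect_bound l u k = (real k powr (\<alpha> - 1) / l + u / g k) / 2 + 1 / real k"

lemma defect_le:
  assumes "0 < l" "l \<le> x" "x \<le> u" "1 \<le> k"
  shows "defect x k \<le> defect_bound l u k"
proof -
  have d: "0 \<le> g (Suc k) - g k" using \<alpha> by (simp add: powr_mono2)
  have "(g (Suc k) - g k) / x \<le> real k powr (\<alpha> - 1) / l"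
    using g_increment_le[OF assms(4)] d assms by (intro frac_le) auto
  moreover have "x / g k \<le> u / g k" using assms by (intro divide_right_mono) auto
  moreover have "(g (Suc k) - g k) / g k \<le> 1 / real k"
  proof -
    have "(g (Suc k) - g k) / g k \<le> real k powr (\<alpha> - 1) / g k"
      using g_increment_le[OF assms(4)] by (intro divide_right_mono) auto
    also have "\<dots> = 1 / real k" using assms(4) by (simp add: powr_diff)
    finally show ?thesis .
  qed
  moreover have "(A + B) / 2 + C \<le> (A' + B') / 2 + C'" if "A \<le> A'" "B \<le> B'" "C \<le> C'"
    for A B C A' B' C' :: real using that by argo
  ultimately show ?thesis unfolding defect_def defect_bound_def by blast
qed

lemma defect_bound_tendsto:
  assumes "0 < l"
  shows "defect_bound l u \<longlonglongrightarrow> 0"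
proof -
  have "(\<lambda>k. real k powr (\<alpha> - 1)) \<longlonglongrightarrow> 0" using \<alpha> by real_asymp
  moreover have "(\<lambda>k. inverse (g k)) \<longlonglongrightarrow> 0" using \<alpha> by real_asymp
  moreover have "(\<lambda>k. 1 / real k) \<longlonglongrightarrow> 0" by real_asymp
  ultimately have "(\<lambda>k. (real k powr (\<alpha> - 1) / l + u * inverse (g k)) / 2 + 1 / real k) \<longlonglongrightarrow> (0 / l + u * 0) / 2 + 0"
    using assms by (intro tendsto_intros) auto
  moreover have "defect_bound l u = (\<lambda>k. (real k powr (\<alpha> - 1) / l + u * inverse (g k)) / 2 + 1 / real k)"
    by (intro ext) (simp only: defect_bound_def divide_inverse[of u])
  ultimately show ?thesis by simp
qed

lemma defect_nonneg:
  assumes "0 < x" "1 \<le> k"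
  shows "0 \<le> defect x k"
  using discrete_hamiltonian.\<eta>_nonneg[OF hamiltonian[OF assms(1)] assms(2)]
  by (simp add: defect_def discrete_hamiltonian.\<eta>_def[OF hamiltonian[OF assms(1)]]
      discrete_hamiltonian.d_def[OF hamiltonian[OF assms(1)]]
      discrete_hamiltonian.r_def[OF hamiltonian[OF assms(1)]])

lemma energy_bounds:
  assumes x: "0 < x" and K: "1 \<le> K" "defect x K \<le> 1 / 8"
  shows "0 < limit_energy x" "energy x \<longlonglongrightarrow> limit_energy x"
    "\<And>k. K \<le> k \<Longrightarrow> limit_energy x \<le> energy x k * exp (10 * defect x k)"
    "\<And>k. K \<le> k \<Longrightarrow> energy x k \<le> limit_energy x * exp (10 * defect x k)"
proof -
  interpret dh: discrete_hamiltonian g x "sx x" "tx x" by (rule hamiltonian[OF x])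
  have H: "dh.H = energy x" by (simp add: fun_eq_iff dh.H_def energy_def)
  have \<eta>: "dh.\<eta> = defect x" by (simp add: fun_eq_iff dh.\<eta>_def dh.d_def dh.r_def defect_def)
  have lim: "defect x \<longlonglongrightarrow> 0"
  proof (rule tendsto_sandwich[OF _ _ tendsto_const defect_bound_tendsto[OF x, of x]])
    show "\<forall>\<^sub>F k in sequentially. 0 \<le> defect x k"
      using eventually_ge_at_top[of 1] by eventually_elim (rule defect_nonneg[OF x])
    show "\<forall>\<^sub>F k in sequentially. defect x k \<le> defect_bound x x k"
      using eventually_ge_at_top[of 1] by eventually_elim (rule defect_le[OF x order_refl order_refl])
  qed
  have Hp: "0 < dh.H k" if "K \<le> k" for k unfolding H using that K(1) by (intro energy_pos) simp
  have K2: "dh.\<eta> K \<le> 1 / 8" and lim2: "dh.\<eta> \<longlonglongrightarrow> 0" unfolding \<eta> by (rule K(2), rule lim)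
  obtain G where G: "0 < G" "energy x \<longlonglongrightarrow> G"
    "\<And>k. K \<le> k \<Longrightarrow> G \<le> energy x k * exp (10 * defect x k) \<and> energy x k \<le> G * exp (10 * defect x k)"
    using dh.energy_limit[OF K(1) K2 lim2 Hp] unfolding H \<eta> by blast
  moreover have "limit_energy x = G" using G(2) by (simp add: limit_energy_def limI)
  ultimately show "0 < limit_energy x" "energy x \<longlonglongrightarrow> limit_energy x"
    "\<And>k. K \<le> k \<Longrightarrow> limit_energy x \<le> energy x k * exp (10 * defect x k)"
    "\<And>k. K \<le> k \<Longrightarrow> energy x k \<le> limit_energy x * exp (10 * defect x k)" by auto
qed

definition density_exponent :: real where "density_exponent = (3 * \<alpha> - 2) / (1 - \<alpha>)"

definition rescaled_energy :: "real \<Rightarrow> real" where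
  "rescaled_energy V = V powr ((3 * \<alpha> - 2) / \<theta>) * (V\<^sup>2 * (Sstar V)\<^sup>2 + V * (Tstar V)\<^sup>2)"

text \<open>With \<open>s = - x\<^sup>2 k S\<close> and \<open>t = x T\<close> all powers of \<open>k\<close> and \<open>x\<close> combine into powers of
\<open>v = x\<^sup>2 k\<^sup>\<theta>\<close>; this is where the exponent of the theorem comes from.\<close>

lemma energy_rescaled:
  assumes x: "0 < x" and k: "1 \<le> k"
  defines "v \<equiv> x\<^sup>2 * real k powr \<theta>"
  shows "x powr density_exponent * energy x k = v powr ((3 * \<alpha> - 2) / \<theta>) *
     (v\<^sup>2 * ((\<Sum>i<k. T x i) / real k - b0 * (real k powr (\<theta> - 1) / v))\<^sup>2 + v * (T x k)\<^sup>2)"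
proof -
  define S where "S = (\<Sum>i<k. T x i) / real k - b0 * (real k powr (\<theta> - 1) / v)"
  define y where "y = real k"
  have y: "0 < y" using k by (simp add: y_def)
  have v: "0 < v" using x k by (simp add: v_def)
  have "b0 * (y powr (\<theta> - 1) / v) = b0 / (x\<^sup>2 * y)"
    using x y by (simp add: v_def y_def[symmetric] powr_diff)
  hence "sx x k = - (x\<^sup>2 * y * S)"
    using x y by (simp add: sx_def S_def y_def[symmetric] field_simps)
  hence H: "energy x k = x ^ 4 * (y\<^sup>2 / y powr \<alpha>) * S\<^sup>2 + x\<^sup>2 * y powr \<alpha> * (T x k)\<^sup>2"
    by (simp add: energy_def tx_def y_def power_mult_distrib power4_eq_xxxx power2_eq_square)
  have e: "v powr ((3 * \<alpha> - 2) / \<theta>) = x powr density_exponent * y powr (3 * \<alpha> - 2)"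
  proof -
    have "x\<^sup>2 = x powr 2" using x by simp
    hence "v powr ((3 * \<alpha> - 2) / \<theta>) = (x powr 2) powr ((3 * \<alpha> - 2) / \<theta>) * (y powr \<theta>) powr ((3 * \<alpha> - 2) / \<theta>)"
      by (simp add: v_def y_def powr_mult)
    moreover have "2 * ((3 * \<alpha> - 2) / \<theta>) = density_exponent"
      using \<theta> \<alpha> by (simp add: density_exponent_def \<theta>_def field_simps)
    ultimately show ?thesis using \<theta> by (simp add: powr_powr)
  qed
  have 1: "y powr (3 * \<alpha> - 2) * (y powr \<theta>)\<^sup>2 = y\<^sup>2 / y powr \<alpha>"
  proof -
    have "y powr (3 * \<alpha> - 2) * (y powr \<theta>)\<^sup>2 = y powr (3 * \<alpha> - 2 + (\<theta> + \<theta>))"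
      by (simp only: power2_eq_square powr_add)
    also have "3 * \<alpha> - 2 + (\<theta> + \<theta>) = 2 - \<alpha>" by (simp add: \<theta>_def)
    also have "y powr (2 - \<alpha>) = y\<^sup>2 / y powr \<alpha>" using y by (simp add: powr_diff)
    finally show ?thesis .
  qed
  have 2: "y powr (3 * \<alpha> - 2) * y powr \<theta> = y powr \<alpha>"
    by (simp add: \<theta>_def flip: powr_add)
  have "v powr ((3 * \<alpha> - 2) / \<theta>) * (v\<^sup>2 * S\<^sup>2 + v * (T x k)\<^sup>2)
      = x powr density_exponent * (x ^ 4 * (y powr (3 * \<alpha> - 2) * (y powr \<theta>)\<^sup>2) * S\<^sup>2 + x\<^sup>2 * (y powr (3 * \<alpha> - 2) * y powr \<theta>) * (T x k)\<^sup>2)"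
    unfolding e by (simp add: v_def y_def[symmetric] power_mult_distrib algebra_simps)
  also have "\<dots> = x powr density_exponent * energy x k" unfolding 1 2 H ..
  finally show ?thesis by (simp add: S_def)
qed

lemma energy_rescaled_tendsto:
  assumes V: "0 < V"
  shows "((\<lambda>x. x powr density_exponent * energy x (rescaled_index V x)) \<longlongrightarrow> rescaled_energy V) (at_right 0)"
proof -
  \<comment> \<open>Since \<open>\<theta> < 1\<close>, the initial value \<open>b0\<close> of \<open>s\<close> is negligible at this scale.\<close>
  have small: "((\<lambda>x. real (rescaled_index V x) powr (\<theta> - 1)) \<longlongrightarrow> 0) (at_right 0)"
  proof -
    have "(\<lambda>k::nat. real k powr (\<theta> - 1)) \<longlonglongrightarrow> 0" using \<theta> by real_asymp
    from filterlim_compose[OF this rescaled_index_at_top[OF V]] show ?thesis .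
  qed
  have "((\<lambda>x. (scaled_index V x) powr ((3 * \<alpha> - 2) / \<theta>) *
     ((scaled_index V x)\<^sup>2 * ((\<Sum>i<rescaled_index V x. T x i) / real (rescaled_index V x)
        - b0 * (real (rescaled_index V x) powr (\<theta> - 1) / (scaled_index V x)))\<^sup>2
      + (scaled_index V x) * (T x (rescaled_index V x))\<^sup>2)) \<longlongrightarrow>
     V powr ((3 * \<alpha> - 2) / \<theta>) * (V\<^sup>2 * (Sstar V - b0 * (0 / V))\<^sup>2 + V * (Tstar V)\<^sup>2)) (at_right 0)"
    using V by (intro tendsto_intros v_tendsto S_tendsto T_tendsto small) auto
  moreover have "\<forall>\<^sub>F x in at_right 0. (scaled_index V x) powr ((3 * \<alpha> - 2) / \<theta>) *
     ((scaled_index V x)\<^sup>2 * ((\<Sum>i<rescaled_index V x. T x i) / real (rescaled_index V x)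
        - b0 * (real (rescaled_index V x) powr (\<theta> - 1) / (scaled_index V x)))\<^sup>2
      + (scaled_index V x) * (T x (rescaled_index V x))\<^sup>2) = x powr density_exponent * energy x (rescaled_index V x)"
    using rescaled_index_pos[OF V] by eventually_elim (simp only: energy_rescaled)
  ultimately show ?thesis unfolding rescaled_energy_def by (simp add: Lim_transform_eventually)
qed

text \<open>The dominant term is \<open>k\<^bsup>\<alpha> - 1\<^esup> / x\<close>, which equals \<open>v\<^bsup>- 1 / 2\<^esup>\<close> and carries the factor \<open>1 / 2\<close>; the other
terms tend to 0.\<close>

lemma defect_small:
  assumes V: "0 < V"
  shows "\<forall>\<^sub>F x in at_right 0. defect x (rescaled_index V x) \<le> 1 / sqrt V"
proof -
  have c: "((\<lambda>x. F (rescaled_index V x)) \<longlongrightarrow> 0) (at_right 0)" if "F \<longlonglongrightarrow> 0" for F :: "nat \<Rightarrow> real"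
    by (rule filterlim_compose[OF that rescaled_index_at_top[OF V]])
  have "(\<lambda>k. inverse (g k)) \<longlonglongrightarrow> 0" using \<alpha> by real_asymp
  note c1 = c[OF this]
  have "(\<lambda>k. 1 / real k) \<longlonglongrightarrow> 0" by real_asymp
  note c2 = c[OF this]
  have "((\<lambda>x. (1 / sqrt (scaled_index V x) + x * inverse (g (rescaled_index V x))) / 2 + 1 / real (rescaled_index V x))
     \<longlongrightarrow> (1 / sqrt V + 0 * 0) / 2 + 0) (at_right 0)"
    using V by (intro tendsto_intros v_tendsto c1 c2) auto
  moreover have "(1 / sqrt V + 0 * 0) / 2 + 0 < 1 / sqrt V" using V by (simp add: field_simps)
  ultimately have "\<forall>\<^sub>F x in at_right 0. (1 / sqrt (scaled_index V x) + x * inverse (g (rescaled_index V x))) / 2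
      + 1 / real (rescaled_index V x) < 1 / sqrt V"
    by (rule order_tendstoD(2))
  thus ?thesis using rescaled_index_pos[OF V]
  proof eventually_elim
    case (elim x)
    have "sqrt (scaled_index V x) = x * real (rescaled_index V x) powr (1 - \<alpha>)"
    proof (rule real_sqrt_unique)
      have "(real (rescaled_index V x) powr (1 - \<alpha>))\<^sup>2 = real (rescaled_index V x) powr \<theta>"
        unfolding power2_eq_square powr_add[symmetric] by (simp add: \<theta>_def)
      thus "(x * real (rescaled_index V x) powr (1 - \<alpha>))\<^sup>2 = scaled_index V x"
        by (simp add: power_mult_distrib)
    qed (use elim in simp)
    hence "real (rescaled_index V x) powr (\<alpha> - 1) / x = 1 / sqrt (scaled_index V x)"
      using powr_minus_divide[of "real (rescaled_index V x)" "1 - \<alpha>"] by simp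
    hence "defect_bound x x (rescaled_index V x) = (1 / sqrt (scaled_index V x) + x * inverse (g (rescaled_index V x))) / 2 + 1 / real (rescaled_index V x)"
      by (simp only: defect_bound_def divide_inverse[of x "g (rescaled_index V x)"])
    thus ?case using elim defect_le[of x x x "rescaled_index V x"] by linarith
  qed
qed

lemma coeff_limit_bounds: "0 \<le> coeff_limit m" "coeff_limit m \<le> leading_coeff / \<theta> ^ m / fact m"
proof -
  show "0 \<le> coeff_limit m"
    by (rule LIMSEQ_le_const[OF series_coeff_asymptotics]) (auto intro!: series_coeff_nonneg divide_nonneg_nonneg)
  show "coeff_limit m \<le> leading_coeff / \<theta> ^ m / fact m"
    by (rule LIMSEQ_le_const2[OF series_coeff_asymptotics]) (use series_coeff_rescaled_le[of 1] in auto)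
qed

text \<open>\<open>Tstar\<close> is the restriction of an entire function whose value at 0 is the positive number
\<open>leading_coeff\<close>, so it cannot vanish on a half line. The radius 100 and the window around 65 are
arbitrary.\<close>

lemma Tstar_not_eventually_zero: "\<exists>V\<ge>64. Tstar V \<noteq> 0"
proof (rule ccontr)
  assume "\<not> ?thesis"
  hence zero: "Tstar V = 0" if "64 \<le> V" for V using that by blast
  define a where "a m = complex_of_real ((- 1) ^ m * coeff_limit m)" for m
  have abs: "summable (\<lambda>m. norm (a m * z ^ m))" for z
  proof (rule summable_comparison_test')
    show "summable (\<lambda>m. leading_coeff * ((cmod z / \<theta>) ^ m / fact m))"
      by (intro summable_mult exp_summable)
    fix m
    have "norm (a m * z ^ m) = coeff_limit m * cmod z ^ m"
      using coeff_limit_bounds(1)[of m] by (simp add: a_def norm_mult norm_power)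
    also have "\<dots> \<le> leading_coeff / \<theta> ^ m / fact m * cmod z ^ m"
      by (intro mult_right_mono coeff_limit_bounds) auto
    also have "\<dots> = leading_coeff * ((cmod z / \<theta>) ^ m / fact m)" by (simp add: power_divide)
    finally show "norm (norm (a m * z ^ m)) \<le> leading_coeff * ((cmod z / \<theta>) ^ m / fact m)" by simp
  qed
  define f where "f z = (\<Sum>m. a m * z ^ m)" for z
  have sums: "(\<lambda>m. a m * z ^ m) sums f z" for z
    unfolding f_def by (rule summable_sums[OF summable_norm_cancel[OF abs]])
  have "f holomorphic_on ball 0 100"
    using power_series_holomorphic[of 0 100 a f] sums by simp
  moreover have "f (of_real V) = of_real (Tstar V)" for V
  proof -
    have "(\<lambda>m. complex_of_real ((- V) ^ m * coeff_limit m)) sums f (of_real V)"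
    proof -
      have "(- V) ^ m = (- 1) ^ m * V ^ m" for m by (simp flip: power_mult_distrib)
      thus ?thesis using sums[of "of_real V"] by (simp add: a_def mult_ac)
    qed
    moreover from sums_summable[OF this] have "summable (\<lambda>m. (- V) ^ m * coeff_limit m)"
      by (simp only: summable_complex_of_real)
    hence "(\<lambda>m. complex_of_real ((- V) ^ m * coeff_limit m)) sums of_real (Tstar V)"
      unfolding Tstar_def by (intro sums_of_real summable_sums)
    ultimately show ?thesis by (rule sums_unique2)
  qed
  moreover have "complex_of_real 65 islimpt (complex_of_real ` {64..<66})"
    unfolding islimpt_approachable
  proof (intro allI impI)
    fix e :: real assume "0 < e"
    define y where "y = 65 + min (e / 2) (1 / 2)"
    have y: "65 < y" "y < 66" "\<bar>y - 65\<bar> < e"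
      using \<open>0 < e\<close> by (simp_all add: y_def min_def)
    have "complex_of_real y \<in> complex_of_real ` {64..<66}"
      using y by (intro imageI) simp
    moreover have "complex_of_real y \<noteq> complex_of_real 65"
      unfolding of_real_eq_iff using y by simp
    moreover have "dist (complex_of_real y) (complex_of_real 65) < e"
      using y(3) by (simp only: dist_of_real dist_real_def)
    ultimately show "\<exists>x'\<in>complex_of_real ` {64..<66}. x' \<noteq> complex_of_real 65 \<and> dist x' (complex_of_real 65) < e"
      by blast
  qed
  ultimately have "f 0 = 0"
    using zero by (intro analytic_continuation[of f "ball 0 100" "complex_of_real ` {64..<66}" "complex_of_real 65" 0])
      (auto simp: norm_of_real simp del: of_real_numeral)
  moreover have "f 0 = a 0"
    using sums[of 0] sums_unique2 powser_sums_zero[of a] by blast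
  ultimately show False using leading_coeff_pos by (simp add: a_def)
qed

lemma rescaled_energy_nonneg: "0 < V \<Longrightarrow> 0 \<le> rescaled_energy V"
  by (simp add: rescaled_energy_def)

text \<open>For \<open>V \<ge> 64\<close> the defect at scale \<open>V\<close> is at most \<open>1 / 8\<close>, so \<open>N\<close> is within \<open>exp (10 / sqrt V)\<close> of the rescaled
energy at scale \<open>V\<close>. If \<open>rescaled_energy\<close> vanished at one such \<open>V\<close>, then \<open>N\<close> would tend to 0 and
\<open>rescaled_energy\<close> would vanish at all of them. Otherwise \<open>N\<close> is eventually pinched between
\<open>rescaled_energy V * exp (\<plusminus> \<epsilon>)\<close>, where \<open>\<epsilon>\<close> is small for large \<open>V\<close>.\<close>

theorem limit_energy_asymptotics: "\<exists>n>0. ((\<lambda>x. x powr density_exponent * limit_energy x) \<longlongrightarrow> n) (at_right 0)"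
proof -
  define N where "N x = x powr density_exponent * limit_energy x" for x
  have compare: "\<forall>\<^sub>F x in at_right 0. 0 < N x \<and> N x \<le> x powr density_exponent * energy x (rescaled_index V x) * exp (10 / sqrt V)
      \<and> x powr density_exponent * energy x (rescaled_index V x) \<le> N x * exp (10 / sqrt V)" if V: "64 \<le> V" for V
  proof -
    have V0: "0 < V" using V by simp
    have "sqrt 64 \<le> sqrt V" using V by (rule real_sqrt_le_mono)
    moreover have "sqrt 64 = (8::real)" by (rule real_sqrt_unique) auto
    ultimately have V8: "1 / sqrt V \<le> 1 / 8" using V0 by (intro divide_left_mono) auto
    from defect_small[OF V0] rescaled_index_pos[OF V0] show ?thesis
    proof eventually_elim
      case (elim x)
      have x: "0 < x" and k: "1 \<le> rescaled_index V x" using elim by auto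
      have \<eta>: "defect x (rescaled_index V x) \<le> 1 / 8" using elim V8 by linarith
      note E = energy_bounds[OF x k \<eta>]
      have ex: "exp (10 * defect x (rescaled_index V x)) \<le> exp (10 / sqrt V)" using elim by simp
      have "limit_energy x \<le> energy x (rescaled_index V x) * exp (10 / sqrt V)"
        using E(3)[OF order_refl] mult_left_mono[OF ex less_imp_le[OF energy_pos[OF k, of x]]] by linarith
      moreover have "energy x (rescaled_index V x) \<le> limit_energy x * exp (10 / sqrt V)"
        using E(4)[OF order_refl] mult_left_mono[OF ex less_imp_le[OF E(1)]] by linarith
      ultimately show ?case using E(1) x
        by (auto simp: N_def mult.assoc intro!: mult_left_mono)
    qed
  qed
  have pos: "0 < rescaled_energy V" if V: "64 \<le> V" for V
  proof (rule ccontr)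
    assume "\<not> 0 < rescaled_energy V"
    hence h0: "rescaled_energy V = 0" using rescaled_energy_nonneg[of V] V by linarith
    have "(N \<longlongrightarrow> 0) (at_right 0)"
    proof (rule tendsto_sandwich[where f="\<lambda>_. 0" and h="\<lambda>x. x powr density_exponent * energy x (rescaled_index V x) * exp (10 / sqrt V)"])
      show "((\<lambda>x. x powr density_exponent * energy x (rescaled_index V x) * exp (10 / sqrt V)) \<longlongrightarrow> 0) (at_right 0)"
        using tendsto_mult_right[OF energy_rescaled_tendsto[of V], of "exp (10 / sqrt V)"] V h0 by simp
      show "\<forall>\<^sub>F x in at_right 0. 0 \<le> N x" using compare[OF V] by eventually_elim simp
      show "\<forall>\<^sub>F x in at_right 0. N x \<le> x powr density_exponent * energy x (rescaled_index V x) * exp (10 / sqrt V)"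
        using compare[OF V] by eventually_elim simp
    qed simp
    have "Tstar U = 0" if U: "64 \<le> U" for U
    proof -
      have "rescaled_energy U \<le> 0"
      proof (rule tendsto_le[where f="\<lambda>x. N x * exp (10 / sqrt U)" and g="\<lambda>x. x powr density_exponent * energy x (rescaled_index U x)"])
        show "((\<lambda>x. x powr density_exponent * energy x (rescaled_index U x)) \<longlongrightarrow> rescaled_energy U) (at_right 0)"
          using U by (intro energy_rescaled_tendsto) simp
        show "((\<lambda>x. N x * exp (10 / sqrt U)) \<longlongrightarrow> 0) (at_right 0)"
          using tendsto_mult_right[OF \<open>(N \<longlongrightarrow> 0) (at_right 0)\<close>, of "exp (10 / sqrt U)"] by simp
        show "\<forall>\<^sub>F x in at_right 0. x powr density_exponent * energy x (rescaled_index U x) \<le> N x * exp (10 / sqrt U)"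
          using compare[OF U] by eventually_elim simp
      qed simp
      moreover have "0 < U powr ((3 * \<alpha> - 2) / \<theta>)" using U by simp
      ultimately have "U\<^sup>2 * (Sstar U)\<^sup>2 + U * (Tstar U)\<^sup>2 \<le> 0"
        unfolding rescaled_energy_def by (simp add: mult_le_0_iff)
      moreover have "0 \<le> U\<^sup>2 * (Sstar U)\<^sup>2" by simp
      ultimately have "U * (Tstar U)\<^sup>2 \<le> 0" by linarith
      thus ?thesis using U by (simp add: mult_le_0_iff)
    qed
    thus False using Tstar_not_eventually_zero by blast
  qed
  have "\<exists>n>0. (N \<longlongrightarrow> n) (at_right 0)"
  proof (rule tendsto_of_exp_sandwich)
    fix \<epsilon> :: real assume \<epsilon>: "0 < \<epsilon>"
    \<comment> \<open>Then \<open>10 / sqrt V \<le> \<epsilon> / 2\<close>; the other half of \<open>\<epsilon>\<close> absorbs the distance of the rescaled energy from its limit.\<close>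
    define V where "V = max 64 ((20 / \<epsilon>)\<^sup>2)"
    have V: "64 \<le> V" by (simp add: V_def)
    have "sqrt ((20 / \<epsilon>)\<^sup>2) \<le> sqrt V" by (intro real_sqrt_le_mono) (simp add: V_def)
    hence "20 / \<epsilon> \<le> sqrt V" using \<epsilon> by simp
    hence V\<epsilon>: "10 / sqrt V \<le> \<epsilon> / 2" using \<epsilon> V by (simp add: field_simps)
    have h: "0 < rescaled_energy V" by (rule pos[OF V])
    have lim: "((\<lambda>x. x powr density_exponent * energy x (rescaled_index V x)) \<longlongrightarrow> rescaled_energy V) (at_right 0)"
      using V by (intro energy_rescaled_tendsto) simp
    have "rescaled_energy V * exp (- (\<epsilon> / 2)) < rescaled_energy V" "rescaled_energy V < rescaled_energy V * exp (\<epsilon> / 2)" using h \<epsilon> by simp_all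
    from order_tendstoD(1)[OF lim this(1)] order_tendstoD(2)[OF lim this(2)] compare[OF V]
    have "\<forall>\<^sub>F x in at_right 0. rescaled_energy V * exp (- \<epsilon>) \<le> N x \<and> N x \<le> rescaled_energy V * exp \<epsilon>"
    proof eventually_elim
      case (elim x)
      define a where "a = x powr density_exponent * energy x (rescaled_index V x)"
      have ex: "exp (10 / sqrt V) \<le> exp (\<epsilon> / 2)" using V\<epsilon> by simp
      have a0: "0 \<le> a" using elim(1) h unfolding a_def by (smt (verit) exp_gt_zero mult_pos_pos)
      have "N x \<le> a * exp (\<epsilon> / 2)"
        using elim(3) mult_left_mono[OF ex a0] by (simp add: a_def)
      also have "\<dots> \<le> rescaled_energy V * exp (\<epsilon> / 2) * exp (\<epsilon> / 2)"
        using elim(2) by (intro mult_right_mono) (auto simp: a_def)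
      finally have 1: "N x \<le> rescaled_energy V * exp \<epsilon>" by (simp add: mult.assoc flip: exp_add)
      have "rescaled_energy V * exp (- (\<epsilon> / 2)) \<le> N x * exp (\<epsilon> / 2)"
      proof -
        have "rescaled_energy V * exp (- (\<epsilon> / 2)) \<le> a" using elim(1) by (simp add: a_def)
        also have "\<dots> \<le> N x * exp (10 / sqrt V)" using elim(3) by (simp add: a_def)
        also have "\<dots> \<le> N x * exp (\<epsilon> / 2)" using elim(3) by (intro mult_left_mono ex) simp
        finally show ?thesis .
      qed
      hence "rescaled_energy V * exp (- (\<epsilon> / 2)) * exp (- (\<epsilon> / 2)) \<le> N x * exp (\<epsilon> / 2) * exp (- (\<epsilon> / 2))"
        by (intro mult_right_mono) auto
      hence "rescaled_energy V * exp (- \<epsilon>) \<le> N x" by (simp add: mult.assoc flip: exp_add)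
      thus ?case using 1 by simp
    qed
    thus "\<exists>h>0. \<forall>\<^sub>F x in at_right 0. h * exp (- \<epsilon>) \<le> N x \<and> N x \<le> h * exp \<epsilon>"
      using h by blast
  qed simp
  thus ?thesis by (simp add: N_def[abs_def])
qed

end

section \<open>The spectral density\<close>

context positive_weights
begin

lemma carmona_density_pos: "0 < carmona_density n x"
proof -
  have "opol b n x \<noteq> 0 \<or> opol b (Suc n) x \<noteq> 0" using wronskian[of n x] by auto
  hence "0 < (opol b n x)\<^sup>2 + (opol b (Suc n) x)\<^sup>2" by (simp add: sum_power2_gt_zero_iff)
  thus ?thesis using b_pos[of n] by (simp add: carmona_density_def)
qed

lemma carmona_density_continuous: "continuous_on S (carmona_density n)"
proof -
  have "pi * (b n * ((opol b n x)\<^sup>2 + (opol b (Suc n) x)\<^sup>2)) \<noteq> 0" for x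
    using carmona_density_pos[of n x] by (auto simp: carmona_density_def)
  thus ?thesis unfolding carmona_density_def[abs_def]
    by (intro continuous_on_divide continuous_on_mult continuous_on_add continuous_on_power
        continuous_on_const continuous_on_opol continuous_on_id) auto
qed

lemma carmona_density_even: "carmona_density n (- x) = carmona_density n x"
  by (simp add: carmona_density_def opol_uminus power_mult_distrib del: opol.simps flip: power_mult)

end

context weight_exponent
begin

abbreviation "wt \<equiv> weights b0 \<alpha>"

lemma wt_odd: "wt (Suc (2 * k)) = g (Suc k)"
  by (simp add: weights_def)

lemma wt_even: "wt (2 * Suc k) = g (Suc k)"
  by (simp add: weights_def)

lemma wt_pos: "positive_weights wt"
proof
  fix n
  show "0 < wt n" using b0 by (auto simp: weights_def)
qed

interpretation pw: positive_weights wt by (rule wt_pos)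

text \<open>The signs turn the second-order recurrence of the polynomials into a first difference. The factor
\<open>wt (2 * k)\<close> rather than \<open>g k\<close> makes the identity valid at \<open>k = 0\<close>, where it is \<open>b0\<close>.\<close>

lemma sx_tx_opol:
  "sx x k = (- 1) ^ k * wt (2 * k) * opol wt (2 * k) x \<and>
   tx x k = (- 1) ^ k * opol wt (Suc (2 * k)) x"
proof (induction k)
  case 0
  show ?case by (simp add: sx_0 tx_0 weights_def)
next
  case (Suc k)
  have g: "0 < g (Suc k)" by simp
  have p1: "g (Suc k) * opol wt (2 * Suc k) x = x * opol wt (Suc (2 * k)) x - wt (2 * k) * opol wt (2 * k) x"
    using g wt_odd[of k] by (simp add: field_simps)
  have s: "sx x (Suc k) = (- 1) ^ Suc k * (g (Suc k) * opol wt (2 * Suc k) x)"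
    unfolding sx_Suc p1 using Suc by (simp add: algebra_simps)
  have p2: "g (Suc k) * opol wt (Suc (2 * Suc k)) x = x * opol wt (2 * Suc k) x - g (Suc k) * opol wt (Suc (2 * k)) x"
    using g wt_odd[of k] wt_even[of k] by (simp add: field_simps)
  have "tx x (Suc k) = (- 1) ^ k * opol wt (Suc (2 * k)) x + x * ((- 1) ^ Suc k * (g (Suc k) * opol wt (2 * Suc k) x)) / (g (Suc k))\<^sup>2"
    unfolding tx_Suc s using Suc by simp
  also have "\<dots> = (- 1) ^ Suc k * ((x * opol wt (2 * Suc k) x - g (Suc k) * opol wt (Suc (2 * k)) x) / g (Suc k))"
    using g by (simp add: field_simps power2_eq_square del: opol.simps)
  also have "\<dots> = (- 1) ^ Suc k * opol wt (Suc (2 * Suc k)) x"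
    unfolding p2[symmetric] using g by (simp del: opol.simps)
  finally show ?case using s wt_even[of k] by simp
qed

lemma carmona_density_energy:
  assumes "1 \<le> k"
  shows "pw.carmona_density (2 * k) x = 1 / (pi * energy \<bar>x\<bar> k)"
proof -
  obtain j where k: "k = Suc j" using assms by (cases k) auto
  have g: "0 < g k" using assms by simp
  have w: "wt (2 * k) = g k" using wt_even[of j] k by simp
  have "pw.carmona_density (2 * k) x = pw.carmona_density (2 * k) \<bar>x\<bar>"
    using pw.carmona_density_even[of "2 * k" x] by (simp add: abs_if)
  moreover have "(sx \<bar>x\<bar> k)\<^sup>2 / g k = g k * (opol wt (2 * k) \<bar>x\<bar>)\<^sup>2"
    using sx_tx_opol[of "\<bar>x\<bar>" k] g w by (simp add: power_mult_distrib power2_eq_square flip: power_mult)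
  moreover have "(tx \<bar>x\<bar> k)\<^sup>2 = (opol wt (Suc (2 * k)) \<bar>x\<bar>)\<^sup>2"
    using sx_tx_opol[of "\<bar>x\<bar>" k] by (simp add: power_mult_distrib flip: power_mult)
  ultimately show ?thesis
    by (simp only: pw.carmona_density_def energy_def w distrib_left)
qed

definition limit_density :: "real \<Rightarrow> real" where "limit_density x = 1 / (pi * limit_energy \<bar>x\<bar>)"

text \<open>Convergence of the energy is uniform in \<open>x\<close> on compact sets away from 0, with relative error given
by \<open>defect_bound\<close>; the limit is bounded by comparison with a single approximant.\<close>

lemma carmona_uniform_limit:
  assumes l: "0 < l" and S: "\<And>x. c \<le> x \<Longrightarrow> x \<le> d \<Longrightarrow> l \<le> \<bar>x\<bar> \<and> \<bar>x\<bar> \<le> u"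
  shows "uniform_limit {c..d} (\<lambda>k. pw.carmona_density (2 * k)) limit_density sequentially"
    "continuous_on {c..d} limit_density"
proof -
  have "\<forall>\<^sub>F k in sequentially. defect_bound l u k < 1 / 8"
    by (rule order_tendstoD(2)[OF defect_bound_tendsto[OF l]]) simp
  then obtain K0 where K0: "\<And>k. K0 \<le> k \<Longrightarrow> defect_bound l u k < 1 / 8"
    by (auto simp: eventually_at_top_linorder)
  define K where "K = max 1 K0"
  have close: "pw.carmona_density (2 * k) x \<le> limit_density x * exp (10 * defect_bound l u k)
      \<and> limit_density x \<le> pw.carmona_density (2 * k) x * exp (10 * defect_bound l u k) \<and> 0 < limit_density x \<and> 0 \<le> defect_bound l u k"
    if x: "x \<in> {c..d}" and k: "K \<le> k" for x k
  proof -
    have k1: "1 \<le> k" and kb: "defect_bound l u k < 1 / 8" using k K0[of k] by (auto simp: K_def)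
    have xl: "l \<le> \<bar>x\<bar>" "\<bar>x\<bar> \<le> u" using S[of x] x by auto
    have x0: "0 < \<bar>x\<bar>" using xl l by linarith
    have \<eta>: "defect \<bar>x\<bar> k \<le> defect_bound l u k" by (rule defect_le[OF l xl k1])
    have "defect \<bar>x\<bar> k \<le> 1 / 8" using \<eta> kb by linarith
    note E = energy_bounds[OF x0 k1 this]
    have H: "0 < energy \<bar>x\<bar> k" by (rule energy_pos[OF k1])
    have ex: "exp (10 * defect \<bar>x\<bar> k) \<le> exp (10 * defect_bound l u k)" using \<eta> by simp
    have 1: "limit_energy \<bar>x\<bar> \<le> energy \<bar>x\<bar> k * exp (10 * defect_bound l u k)"
      using E(3)[OF order_refl] mult_left_mono[OF ex less_imp_le[OF H]] by linarith
    have 2: "energy \<bar>x\<bar> k \<le> limit_energy \<bar>x\<bar> * exp (10 * defect_bound l u k)"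
      using E(4)[OF order_refl] mult_left_mono[OF ex less_imp_le[OF E(1)]] by linarith
    have "0 \<le> defect_bound l u k" using \<eta> defect_nonneg[OF x0 k1] by linarith
    moreover have inv: "1 / (pi * y) \<le> 1 / (pi * y') * e" if "0 < y" "0 < y'" "y' \<le> y * e" for y y' e :: real
      using that by (simp add: field_simps)
    moreover have "0 < limit_density x" using E(1) by (simp add: limit_density_def)
    ultimately show ?thesis
      using inv[OF H E(1) 1] inv[OF E(1) H 2] unfolding carmona_density_energy[OF k1] limit_density_def by blast
  qed
  have "bounded (pw.carmona_density (2 * K) ` {c..d})"
    by (intro compact_imp_bounded compact_continuous_image pw.carmona_density_continuous) simp
  then obtain B where "\<forall>x\<in>{c..d}. \<bar>pw.carmona_density (2 * K) x\<bar> \<le> B"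
    by (auto simp: bounded_iff)
  hence B: "\<bar>pw.carmona_density (2 * K) x\<bar> \<le> B" if "x \<in> {c..d}" for x using that by blast
  define W where "W = \<bar>B\<bar> * exp (10 * defect_bound l u K)"
  have W: "limit_density x \<le> W" if x: "x \<in> {c..d}" for x
  proof -
    have "limit_density x \<le> pw.carmona_density (2 * K) x * exp (10 * defect_bound l u K)"
      using close[OF x order_refl] by simp
    also have "\<dots> \<le> W" unfolding W_def using B[OF x] by (intro mult_right_mono) auto
    finally show ?thesis .
  qed
  define \<rho> where "\<rho> k = W * exp (10 * defect_bound l u k) * (exp (10 * defect_bound l u k) - 1)" for k
  have \<rho>: "\<rho> \<longlonglongrightarrow> 0"
  proof -
    have "\<rho> \<longlonglongrightarrow> W * exp (10 * 0) * (exp (10 * 0) - 1)"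
      unfolding \<rho>_def by (intro tendsto_intros defect_bound_tendsto l)
    thus ?thesis by simp
  qed
  have dist: "\<bar>pw.carmona_density (2 * k) x - limit_density x\<bar> \<le> \<rho> k" if x: "x \<in> {c..d}" and k: "K \<le> k" for x k
  proof -
    define a w e where "a = pw.carmona_density (2 * k) x" and "w = limit_density x" and "e = exp (10 * defect_bound l u k)"
    have c: "a \<le> w * e" "w \<le> a * e" "0 < w" and e: "1 \<le> e"
      using close[OF x k] by (auto simp: a_def w_def e_def)
    have wW: "w \<le> W" using W[OF x] by (simp add: w_def)
    have "a - w \<le> w * (e - 1)" using c by (simp add: algebra_simps)
    also have "\<dots> \<le> W * e * (e - 1)"
      using wW c e mult_mono[of w W 1 e] by (intro mult_right_mono) auto
    finally have 1: "a - w \<le> W * e * (e - 1)" .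
    have "w - a \<le> a * (e - 1)" using c by (simp add: algebra_simps)
    also have "\<dots> \<le> W * e * (e - 1)"
    proof (rule mult_right_mono)
      have "w * e \<le> W * e" using wW e by (intro mult_right_mono) auto
      thus "a \<le> W * e" using c(1) by (rule order_trans[rotated])
    qed (use e in simp)
    finally show ?thesis using 1 by (simp add: abs_le_iff \<rho>_def a_def w_def e_def)
  qed
  show unif: "uniform_limit {c..d} (\<lambda>k. pw.carmona_density (2 * k)) limit_density sequentially"
    unfolding uniform_limit_iff
  proof (intro allI impI)
    fix e :: real assume "0 < e"
    hence "\<forall>\<^sub>F k in sequentially. \<rho> k < e" by (intro order_tendstoD(2)[OF \<rho>])
    thus "\<forall>\<^sub>F k in sequentially. \<forall>x\<in>{c..d}. dist (pw.carmona_density (2 * k) x) (limit_density x) < e"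
      using eventually_ge_at_top[of K]
    proof eventually_elim
      case (elim k)
      show ?case
        unfolding dist_real_def using le_less_trans[OF dist[OF _ elim(2)] elim(1)] by blast
    qed
  qed
  show "continuous_on {c..d} limit_density"
    by (rule uniform_limit_theorem[OF _ unif]) (simp_all add: pw.carmona_density_continuous)
qed

text \<open>Only even indices are used, so that the approximating densities are \<open>1 / (\<pi> energy)\<close>.\<close>

theorem spectral_density_eq:
  assumes spec: "is_spectral_density_of_jacobi wt f"
    and f: "continuous_on (- {0}) f" and x0: "x0 \<noteq> 0"
  shows "f x0 = limit_density x0"
proof -
  obtain E where E: "is_spectral_measure_of (jacobi_domain wt) (jacobi_apply wt) E"
    and ac: "is_ac_density (scalar_spectral_measure E e0) f"
    using spec unfolding is_spectral_density_of_jacobi_def by blast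
  interpret js: jacobi_spectral_positive E wt
  proof
    show "projection_valued_measure E" using E by (simp add: is_spectral_measure_of_def)
    show "is_spectral_measure_of (jacobi_domain wt) (jacobi_apply wt) E" by (rule E)
  qed
  \<comment> \<open>An interval around \<open>x0\<close> on which \<open>\<bar>x\<bar>\<close> is bounded away from 0.\<close>
  define c d where "c = x0 - \<bar>x0\<bar> / 2" and "d = x0 + \<bar>x0\<bar> / 2"
  have range: "\<bar>x0\<bar> / 2 \<le> \<bar>x\<bar> \<and> \<bar>x\<bar> \<le> 2 * \<bar>x0\<bar>" if "c \<le> x" "x \<le> d" for x
    using that by (auto simp: c_def d_def abs_if split: if_splits)
  have l: "0 < \<bar>x0\<bar> / 2" using x0 by simp
  interpret sa: stieltjes_approximation "scalar_spectral_measure E e0" "\<lambda>k. pw.carmona_density (2 * k)" limit_density c d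
  proof (rule stieltjes_approximation.intro)
    show "finite_measure (scalar_spectral_measure E e0)" by (rule js.finite_\<sigma>[OF e0_ell2])
    show "sets (scalar_spectral_measure E e0) = sets borel" by simp
    show "pw.carmona_density (2 * n) \<in> borel_measurable borel" for n
      by (intro borel_measurable_continuous_onI pw.carmona_density_continuous)
    show "0 \<le> pw.carmona_density (2 * n) t" for n t
      using pw.carmona_density_pos less_imp_le by blast
    show "integrable lborel (\<lambda>t. pw.carmona_density (2 * n) t * poisson z t)" if "0 < Im z" for n z
      by (rule pw.Im_weyl_poisson(1)[OF that])
    show "(\<integral>t. pw.carmona_density (2 * n) t * poisson z t \<partial>lborel) \<le> 1 / Im z" if "0 < Im z" for n z
      using pw.Im_weyl_poisson(2)[OF that, of "2 * n"] pw.weyl_bound[OF that, of "2 * n"]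
        abs_Im_le_cmod[of "pw.weyl (2 * n) z"] by linarith
    show "(\<lambda>n. \<integral>t. pw.carmona_density (2 * n) t * poisson z t \<partial>lborel)
        \<longlonglongrightarrow> (\<integral>t. poisson z t \<partial>scalar_spectral_measure E e0)" if "0 < Im z" for z
    proof -
      have "filterlim (\<lambda>n::nat. 2 * n) at_top sequentially"
        by (rule filterlim_subseq) (simp add: strict_mono_def)
      from filterlim_compose[OF js.Im_weyl_tendsto[OF that] this]
      show ?thesis by (simp add: pw.Im_weyl_poisson(2)[OF that])
    qed
    show "uniform_limit {c..d} (\<lambda>k. pw.carmona_density (2 * k)) limit_density sequentially"
      by (rule carmona_uniform_limit(1)[OF l range])
    show "continuous_on {c..d} limit_density" by (rule carmona_uniform_limit(2)[OF l range])
  qed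
  have "continuous_on {c..d} f"
    using range l by (intro continuous_on_subset[OF f]) force
  moreover have "c < x0" "x0 < d" using x0 by (simp_all add: c_def d_def)
  ultimately show ?thesis by (rule sa.ac_density_eq[OF ac])
qed

end

theorem theorem3p2:
  fixes b0 \<alpha> :: real and f :: "real \<Rightarrow> real"
  assumes "b0 > 0" and "1 / 2 < \<alpha>" and "\<alpha> < 1"
    and "is_spectral_density_of_jacobi (weights b0 \<alpha>) f"
    and "continuous_on (- {0}) f"
  shows "\<exists>f0::real. f0 \<noteq> 0 \<and>
    ((\<lambda>x. f x * \<bar>x\<bar> powr (- ((3 * \<alpha> - 2) / (1 - \<alpha>)))) \<longlongrightarrow> f0) (at 0)"
proof -
  interpret we: weight_exponent b0 \<alpha> by unfold_locales (use assms in auto)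
  obtain n where n: "0 < n" "((\<lambda>x. x powr we.density_exponent * we.limit_energy x) \<longlongrightarrow> n) (at_right 0)"
    using we.limit_energy_asymptotics by blast
  have "filterlim (\<lambda>x::real. \<bar>x\<bar>) (at_right 0) (at 0)"
    unfolding filterlim_at by (auto simp: eventually_at_filter intro!: tendsto_eq_intros)
  from filterlim_compose[OF n(2) this]
  have "((\<lambda>x. \<bar>x\<bar> powr we.density_exponent * we.limit_energy \<bar>x\<bar>) \<longlongrightarrow> n) (at 0)" .
  hence "((\<lambda>x. 1 / (pi * (\<bar>x\<bar> powr we.density_exponent * we.limit_energy \<bar>x\<bar>))) \<longlongrightarrow> 1 / (pi * n)) (at 0)"
    using n(1) by (intro tendsto_intros) auto
  moreover have "\<forall>\<^sub>F x in at 0. 1 / (pi * (\<bar>x\<bar> powr we.density_exponent * we.limit_energy \<bar>x\<bar>))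
      = f x * \<bar>x\<bar> powr (- ((3 * \<alpha> - 2) / (1 - \<alpha>)))"
    unfolding eventually_at_filter
  proof (intro always_eventually allI impI)
    fix x :: real assume x: "x \<noteq> 0"
    have "f x = 1 / (pi * we.limit_energy \<bar>x\<bar>)"
      using we.spectral_density_eq[OF assms(4,5) x] by (simp add: we.limit_density_def)
    moreover have "\<bar>x\<bar> powr (- ((3 * \<alpha> - 2) / (1 - \<alpha>))) = 1 / \<bar>x\<bar> powr we.density_exponent"
      by (simp only: we.density_exponent_def powr_minus_divide)
    ultimately show "1 / (pi * (\<bar>x\<bar> powr we.density_exponent * we.limit_energy \<bar>x\<bar>)) = f x * \<bar>x\<bar> powr (- ((3 * \<alpha> - 2) / (1 - \<alpha>)))"
      by simp
  qed
  ultimately have "((\<lambda>x. f x * \<bar>x\<bar> powr (- ((3 * \<alpha> - 2) / (1 - \<alpha>)))) \<longlongrightarrow> 1 / (pi * n)) (at 0)"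
    by (rule Lim_transform_eventually)
  thus ?thesis using n(1) by (intro exI[of _ "1 / (pi * n)"]) simp
qed

end
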